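(* Let $n,d\in\mathbb{N}$, $m=\binom{n+d}{d}$, and let $y=(y_\alpha)_{\alpha\in\mathbb{N}^n_d}\in\mathbb{Q}^m$ with $y_0>0$. Let $g=(g_1,\dots,g_k)\in\mathbb{R}[x]^k$ be such that the quadratic module $Q(g)$ is archimedean and $K=S(g)$ is non-empty. Assume that $y\notin\mathscr{M}(K)_d$. Then there exists a polynomial $p\in\operatorname{Int}(\mathscr{P}(K)_d)$ with rational coefficients such that $p\in1+Q(g)$, $\mathscr{L}_y(p)=0$, and $p^*:=\inf_{a\in K}p(a)>1$ is arbitrarily large; that is, for every real $M\ge1$ there is such a $p$ with rational coefficients and $p^*>M$.
   Context: Notation: $x=(x_1,\dots,x_n)$; $\mathbb{R}[x]_{\le d}$ is the space of real polynomials of total degree at most $d$; $\mathbb{N}^n_d=\{\alpha\in\mathbb{N}^n:\sum_i\alpha_i\le d\}$; $y_0$ is the entry of $y$ indexed by $\alpha=0$. For $g=(g_1,\dots,g_k)\in\mathbb{R}[x]^k$, $S(g)=\{a\in\mathbb{R}^n: g_1(a)\ge0,\dots,g_k(a)\ge0\}$. $\Sigma_n\subset\mathbb{R}[x]$ is the cone of sums of squares of real polynomials. With $g_0:=1$, the quadratic module of $g$ is $Q(g)=\{\sum_{i=0}^k\sigma_ig_i:\sigma_i\in\Sigma_n\}$ (the $\sigma_i$ are not required to have rational coefficients or to be sums of squares of rational polynomials). It is archimedean if there exists $u\in Q(g)$ such that $S(u)=\{a\in\mathbb{R}^n:u(a)\ge0\}$ is compact. $1+Q(g)=\{1+q:q\in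 Q(g)\}$. $\mathscr{P}(K)_d=\{f\in\mathbb{R}[x]_{\le d}: f(a)\ge0\ \forall a\in K\}$, with interior taken in $\mathbb{R}[x]_{\le d}$. The Riesz functional $\mathscr{L}_y:\mathbb{R}[x]_{\le d}\to\mathbb{R}$ is the linear map with $\mathscr{L}_y(x^\alpha)=y_\alpha$. $\mathscr{M}(K)_d$ is the set of all $y\in\mathbb{R}^m$ for which there is a nonnegative Borel measure $\mu$ on $\mathbb{R}^n$ with $\operatorname{supp}(\mu)\subset K$ and $y_\alpha=\int_Kx^\alpha\,d\mu$ for all $\alpha\in\mathbb{N}^n_d$. *)

theory Defs
  imports "HOL-Analysis.Analysis" "HOL-Library.Poly_Mapping"
begin

text \<open>
  Polynomials in the variables indexed by \<open>'n\<close>, as elements of the monoid algebra over the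
  exponent vectors; multiplication is the convolution product of \<^theory>\<open>HOL-Library.Poly_Mapping\<close>.
\<close>

type_synonym 'n expo = "'n \<Rightarrow>\<^sub>0 nat"
type_synonym 'n rpoly = "'n expo \<Rightarrow>\<^sub>0 real"

definition total_degree :: "'n::finite expo \<Rightarrow> nat"
  where "total_degree \<alpha> = (\<Sum>i\<in>UNIV. Poly_Mapping.lookup \<alpha> i)"

definition exponents_le :: "nat \<Rightarrow> ('n::finite) expo set"
  where "exponents_le d = {\<alpha>. total_degree \<alpha> \<le> d}"

definition monomial_at :: "real ^ 'n \<Rightarrow> 'n::finite expo \<Rightarrow> real"
  where "monomial_at a \<alpha> = (\<Prod>i\<in>UNIV. (a $ i) ^ Poly_Mapping.lookup \<alpha> i)"

definition poly_at :: "'n::finite rpoly \<Rightarrow> real ^ 'n \<Rightarrow> real"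
  where "poly_at p a = (\<Sum>\<alpha>\<in>Poly_Mapping.keys p. Poly_Mapping.lookup p \<alpha> * monomial_at a \<alpha>)"

definition polys_le :: "nat \<Rightarrow> ('n::finite) rpoly set"
  where "polys_le d = {p. Poly_Mapping.keys p \<subseteq> exponents_le d}"

definition rational_coeffs :: "'n::finite rpoly \<Rightarrow> bool"
  where "rational_coeffs p \<longleftrightarrow> (\<forall>\<alpha>. Poly_Mapping.lookup p \<alpha> \<in> \<rat>)"

text \<open>
  The topology of coefficientwise convergence. Only the finitely many coefficients indexed by
  \<^term>\<open>exponents_le d\<close> can be nonzero, so this is the Euclidean topology of the
  finite-dimensional space \<^term>\<open>polys_le d\<close>.
\<close>

definition polys_le_topology :: "nat \<Rightarrow> ('n::finite) rpoly topology"
  where "polys_le_topology d = pullback_topology (polys_le d) Poly_Mapping.lookup euclidean"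

definition basic_closed :: "'n::finite rpoly list \<Rightarrow> (real ^ 'n) set"
  where "basic_closed g = {a. \<forall>p\<in>set g. poly_at p a \<ge> 0}"

definition sums_of_squares :: "('n::finite) rpoly set"
  where "sums_of_squares = {p. \<exists>(N::nat) q. p = (\<Sum>j<N. (q j)\<^sup>2)}"

definition quadratic_module :: "'n::finite rpoly list \<Rightarrow> 'n rpoly set"
  where "quadratic_module g =
    {p. \<exists>\<sigma>. (\<forall>i\<le>length g. \<sigma> i \<in> sums_of_squares) \<and> p = (\<Sum>i\<le>length g. \<sigma> i * (1 # g) ! i)}"

definition archimedean :: "'n::finite rpoly set \<Rightarrow> bool"
  where "archimedean Q \<longleftrightarrow> (\<exists>u\<in>Q. compact (basic_closed [u]))"

definition nonneg_polys :: "(real ^ 'n::finite) set \<Rightarrow> nat \<Rightarrow> 'n rpoly set"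
  where "nonneg_polys K d = {f \<in> polys_le d. \<forall>a\<in>K. poly_at f a \<ge> 0}"

text \<open>
  The Riesz functional does not carry the degree \<open>d\<close>: for \<open>p\<close> in \<^term>\<open>polys_le d\<close> only the
  entries of \<open>y\<close> indexed by \<^term>\<open>exponents_le d\<close> are used.
\<close>

definition riesz :: "('n::finite expo \<Rightarrow> real) \<Rightarrow> 'n rpoly \<Rightarrow> real"
  where "riesz y p = (\<Sum>\<alpha>\<in>Poly_Mapping.keys p. Poly_Mapping.lookup p \<alpha> * y \<alpha>)"

definition measure_support :: "'a::topological_space measure \<Rightarrow> 'a set"
  where "measure_support \<mu> = {x. \<forall>U. open U \<and> x \<in> U \<longrightarrow> emeasure \<mu> U > 0}"

text \<open>
  Real vectors indexed by \<^term>\<open>exponents_le d\<close> are functions that are undefined elsewhere.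
  Integrability is required explicitly because the integral of a non-integrable function
  defaults to 0.
\<close>

definition moment_cone :: "(real ^ 'n::finite) set \<Rightarrow> nat \<Rightarrow> ('n expo \<Rightarrow> real) set"
  where "moment_cone K d = {y \<in> exponents_le d \<rightarrow>\<^sub>E UNIV.
    \<exists>\<mu>. sets \<mu> = sets borel \<and> measure_support \<mu> \<subseteq> K \<and>
      (\<forall>\<alpha>\<in>exponents_le d.
        set_integrable \<mu> K (\<lambda>x. monomial_at x \<alpha>) \<and>
        y \<alpha> = set_lebesgue_integral \<mu> K (\<lambda>x. monomial_at x \<alpha>))}"

end

theory Submission
  imports Defs "HOL-Algebra.Algebraic_Closure_Type" "HOL-Computational_Algebra.Fraction_Field"
begin

text \<open>
  By conic duality, some polynomial of degree at most \<open>d\<close> is nonnegative on the compact set \<open>K\<close> and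
  negative under the Riesz functional. Adding a small constant and rounding makes it rational and positive
  on \<open>K\<close>; a large multiple plus the constant that annihilates the Riesz functional is \<open>p\<close>. As \<open>p - 1\<close> is
  positive on \<open>K\<close>, it lies in \<open>Q(g)\<close> by Putinar's Positivstellensatz.

  Putinar's theorem needs \<open>N - |x|\<^sup>2 \<in> Q(g)\<close>, while only an element \<open>u\<close> of \<open>Q(g)\<close> with compact \<open>S(u)\<close> is
  given. Let \<open>f = c - |x|\<^sup>2\<close> be positive on \<open>S(u)\<close> and \<open>T\<close> the preordering generated by \<open>u\<close>. By Woermann's
  argument it is enough to have \<open>p f = 1 + q\<close> with \<open>p\<close>, \<open>q\<close> in \<open>T\<close>. Otherwise some ordering of a residue
  field of the polynomial ring has \<open>u \<ge> 0\<close> and \<open>f \<le> 0\<close>. Its real closure then contains a point with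
  these signs, and by Tarski's transfer principle so does \<open>\<real>\<^sup>n\<close>, a contradiction. Transfer is proved with
  Hoermander's comparison of the sign diagrams of two families of univariate polynomials.
\<close>

hide_const (open) Polynomials.degree Polynomials.lead_coeff up_ring.coeff up_ring.monom Coset.order Module.smult

subsection \<open>Real closed fields\<close>

text \<open>The constant that cancels the negative Riesz value is nonnegative because
  \<open>y 0 > 0\<close>, so it can only raise the values on \<open>K\<close>.

  The main obstacle is that the hypothesis on \<open>u\<close> is geometric, while Putinar's theorem
  asks for an identity. Passing from one to the other means producing real points out of abstract
  orderings, and all the real algebra serves this. No formulas are formalised: what is transferred
  is only the existence of a point at which finitely many polynomials have prescribed signs, a form
  that survives the elimination of one variable. Two ring homomorphisms out of one coefficient ring
  specialise the polynomials into both fields at once, so a sign diagram is a finite relation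
  between the zeros on the two sides.

  The real closure consists of the differences of a maximal cone in the algebraic closure.
  Maximality yields roots for sign changes directly, so \<open>rcf\<close> asks for the intermediate
  value property and not for square roots and roots of polynomials of odd degree.\<close>

class rcf = linordered_field +
  assumes ivt_coeffs: "a < b \<Longrightarrow> (\<Sum>i\<le>n. f i * a ^ i) < 0 \<Longrightarrow> 0 < (\<Sum>i\<le>n. f i * b ^ i)
    \<Longrightarrow> \<exists>c. a < c \<and> c < b \<and> (\<Sum>i\<le>n. f i * c ^ i) = 0"

instance real :: rcf
proof
  fix a b :: real and f :: "nat \<Rightarrow> real" and n :: nat
  let ?g = "\<lambda>x. \<Sum>i\<le>n. f i * x ^ i"
  assume ab: "a < b" and neg: "?g a < 0" and pos: "0 < ?g b"
  have "continuous_on {a..b} ?g" by (intro continuous_intros)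
  then obtain c where "a \<le> c" "c \<le> b" "?g c = 0"
    using IVT'[of ?g a 0 b] ab neg pos by auto
  moreover from this neg pos have "c \<noteq> a" "c \<noteq> b" by auto
  ultimately show "\<exists>c. a < c \<and> c < b \<and> ?g c = 0" by (metis order_le_less)
qed

definition sg :: "'a::linordered_idom \<Rightarrow> int"
  where "sg x = (if x > 0 then 1 else if x < 0 then -1 else 0)"

lemma sg_0 [simp]: "sg 0 = 0" and sg_pos [simp]: "x > 0 \<Longrightarrow> sg x = 1"
  and sg_neg [simp]: "x < 0 \<Longrightarrow> sg x = -1"
  by (auto simp: sg_def)

lemma sg_eq_0_iff [simp]: "sg x = 0 \<longleftrightarrow> x = 0" and sg_eq_1_iff [simp]: "sg x = 1 \<longleftrightarrow> x > 0"
  and sg_eq_m1_iff [simp]: "sg x = -1 \<longleftrightarrow> x < 0"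
  by (auto simp: sg_def)

lemma sg_mult: "sg (x * y) = sg x * sg y"
  by (auto simp: sg_def zero_less_mult_iff mult_less_0_iff)

lemma sg_uminus: "sg (- x) = - sg x"
  by (auto simp: sg_def)

lemma sg_cases: "sg x = 1 \<or> sg x = -1 \<or> sg x = 0"
  by (auto simp: sg_def)

lemma sg_even_power_mult: "c \<noteq> 0 \<Longrightarrow> sg (c ^ (2 * N) * x) = sg x"
  by (simp add: sg_mult power_mult)

lemma sg_eqD: "sg x = sg y \<Longrightarrow> (x = 0 \<longleftrightarrow> y = 0) \<and> (x > 0 \<longleftrightarrow> y > 0) \<and> (x < 0 \<longleftrightarrow> y < 0)"
  by (metis sg_eq_0_iff sg_eq_1_iff sg_eq_m1_iff)

lemma poly_ivt_sg:
  fixes p :: "'a::rcf poly"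
  assumes ab: "a < b" and ne: "sg (poly p a) \<noteq> sg (poly p b)"
    and na: "poly p a \<noteq> 0" and nb: "poly p b \<noteq> 0"
  shows "\<exists>c. a < c \<and> c < b \<and> poly p c = 0"
proof -
  have *: "\<exists>c. a < c \<and> c < b \<and> poly q c = 0" if "poly q a < 0" "poly q b > 0" for q :: "'a poly"
    using ivt_coeffs[OF ab, of "coeff q" "degree q"] that by (simp add: poly_altdef)
  from na nb ne consider "poly p a < 0 \<and> poly p b > 0" | "poly p a > 0 \<and> poly p b < 0"
    by (auto simp: sg_def split: if_splits)
  then show ?thesis using *[of p] *[of "- p"] by cases auto
qed

lemma sg_poly_eq_if_no_root:
  fixes p :: "'a::rcf poly"
  assumes "a \<le> b" and no: "\<And>x. a \<le> x \<Longrightarrow> x \<le> b \<Longrightarrow> poly p x \<noteq> 0"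
  shows "sg (poly p a) = sg (poly p b)"
proof (cases "a = b")
  case False
  then show ?thesis using poly_ivt_sg[of a b p] assms by force
qed auto

section \<open>Rolle's theorem and the mean value theorem for polynomials\<close>

lemma pderiv_two_factors:
  fixes u v g :: "'a::idom poly"
  assumes u: "pderiv u = 1" and v: "pderiv v = 1"
  shows "pderiv (u ^ Suc m * (v ^ Suc n * g)) =
    u ^ m * v ^ n * (of_nat (Suc m) * v * g + of_nat (Suc n) * u * g + u * v * pderiv g)"
proof -
  have sm: "smult (of_nat k) q = of_nat k * q" for k and q :: "'a poly" by (simp add: of_nat_poly)
  show ?thesis
    unfolding pderiv_mult pderiv_power_Suc u v sm
    by (simp add: algebra_simps del: of_nat_Suc)
qed

text \<open>Instead of a maximum on the interval, a factorisation is used. With \<open>b'\<close>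
  the next root after \<open>a\<close>, \<open>p\<close> is (x - a)^(m+1) (x - b')^(n+1) g with
  \<open>g\<close> free of roots from \<open>a\<close> to \<open>b'\<close>, hence of constant sign
  there. The cofactor \<open>g1\<close> of (x - a)^m (x - b')^n in the derivative is a negative
  multiple of \<open>g\<close> at \<open>a\<close> and a positive one at \<open>b'\<close>, so it
  vanishes in between.\<close>

lemma poly_rolle:
  fixes p :: "'a::rcf poly"
  assumes ab: "a < b" and pa: "poly p a = 0" and pb: "poly p b = 0"
  shows "\<exists>c. a < c \<and> c < b \<and> poly (pderiv p) c = 0"
proof (cases "p = 0")
  case True
  then show ?thesis using dense[OF ab] by auto
next
  case False
  define R where "R = {x. poly p x = 0 \<and> a < x}"
  have finR: "finite R" using poly_roots_finite[OF False] unfolding R_def by (rule rev_finite_subset) auto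
  define b' where "b' = Min R"
  have bR: "b \<in> R" using ab pb by (simp add: R_def)
  have b'R: "b' \<in> R" unfolding b'_def using finR bR by (intro Min_in) auto
  have b'b: "b' \<le> b" unfolding b'_def using finR bR by simp
  have ab': "a < b'" and pb': "poly p b' = 0" using b'R by (auto simp: R_def)
  have nor: "poly p x \<noteq> 0" if "a < x" "x < b'" for x
  proof
    assume "poly p x = 0"
    then have "x \<in> R" using that by (simp add: R_def)
    then show False using Min_le[OF finR, of x] that by (simp add: b'_def)
  qed
  obtain q where q: "p = [:- a, 1:] ^ order a p * q" and na: "\<not> [:- a, 1:] dvd q"
    using order_decomp[OF False] by blast
  have q0: "q \<noteq> 0" using na by auto
  have qa: "poly q a \<noteq> 0" using na by (simp add: poly_eq_0_iff_dvd)
  obtain g where g: "q = [:- b', 1:] ^ order b' q * g" and nb: "\<not> [:- b', 1:] dvd g"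
    using order_decomp[OF q0] by blast
  have gb: "poly g b' \<noteq> 0" using nb by (simp add: poly_eq_0_iff_dvd)
  have ga: "poly g a \<noteq> 0" using qa by (subst (asm) g) simp
  have qb: "poly q b' = 0"
    using pb' ab' by (subst (asm) q) simp
  have "order a p \<noteq> 0" using False pa by (simp add: order_root)
  then obtain m where m: "order a p = Suc m" by (metis not0_implies_Suc)
  have "order b' q \<noteq> 0" using q0 qb by (simp add: order_root)
  then obtain n where n: "order b' q = Suc n" by (metis not0_implies_Suc)
  have p_eq: "p = [:- a, 1:] ^ Suc m * ([:- b', 1:] ^ Suc n * g)"
    using q g m n by metis
  define g1 where "g1 = of_nat (Suc m) * [:- b', 1:] * g + of_nat (Suc n) * [:- a, 1:] * g
     + [:- a, 1:] * [:- b', 1:] * pderiv g"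
  have pd: "pderiv p = [:- a, 1:] ^ m * [:- b', 1:] ^ n * g1"
    unfolding p_eq g1_def
    by (rule pderiv_two_factors) (simp_all add: pderiv_pCons one_pCons)
  have g1a: "poly g1 a = - (of_nat (Suc m) * (b' - a) * poly g a)"
    by (simp add: g1_def algebra_simps del: of_nat_Suc)
  have g1b: "poly g1 b' = of_nat (Suc n) * (b' - a) * poly g b'"
    by (simp add: g1_def algebra_simps del: of_nat_Suc)
  have gn: "poly g x \<noteq> 0" if "a \<le> x" "x \<le> b'" for x
  proof (cases "x = a \<or> x = b'")
    case True
    then show ?thesis using ga gb by auto
  next
    case False
    then show ?thesis using nor[of x] that by (auto simp: p_eq)
  qed
  have sgg: "sg (poly g a) = sg (poly g b')"
    using sg_poly_eq_if_no_root[of a b' g] ab' gn by auto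
  have "(0::'a) < of_nat (Suc k) * (b' - a)" for k
    using ab' by (intro mult_pos_pos) (simp_all only: of_nat_0_less_iff zero_less_Suc diff_gt_0_iff_gt)
  then have s1: "sg (of_nat (Suc k) * (b' - a) * x) = sg x" for k x
    by (subst sg_mult) simp
  have "sg (poly g1 a) = - sg (poly g a)" "sg (poly g1 b') = sg (poly g b')"
    unfolding g1a g1b by (simp_all only: sg_uminus s1)
  moreover have "sg (poly g a) \<noteq> 0" using ga by simp
  ultimately obtain c where "a < c" "c < b'" "poly g1 c = 0"
    using poly_ivt_sg[OF ab', of g1] sgg by (metis neg_equal_zero sg_eq_0_iff neg_equal_iff_equal equal_neg_zero)
  then show ?thesis using b'b by (intro exI[of _ c]) (auto simp: pd)
qed

lemma poly_mvt:
  fixes p :: "'a::rcf poly"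
  assumes ab: "a < b"
  shows "\<exists>c. a < c \<and> c < b \<and> poly p b - poly p a = (b - a) * poly (pderiv p) c"
proof -
  define s where "s = (poly p b - poly p a) / (b - a)"
  define q where "q = p - [:poly p a - s * a, s:]"
  have "poly q a = 0" by (simp add: q_def algebra_simps)
  moreover have "poly q b = 0"
  proof -
    have "s * (b - a) = poly p b - poly p a" using ab by (simp add: s_def)
    then show ?thesis by (simp add: q_def algebra_simps)
  qed
  ultimately obtain c where c: "a < c" "c < b" "poly (pderiv q) c = 0" using poly_rolle[OF ab] by blast
  then have "poly (pderiv p) c = s" by (simp add: q_def pderiv_diff pderiv_pCons)
  then show ?thesis using c ab by (intro exI[of _ c]) (simp add: s_def)
qed

section \<open>Signs of polynomials near infinity\<close>

text \<open>Horner induction: if p(x) \<ge> l > 0 beyond some bound, with l the leading coefficient,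
  then a + x p(x) \<ge> x l - |a| for x \<ge> 0, and this is at least l once x \<ge> 1 + |a| /
  l.\<close>

lemma poly_at_top_ge_lead_coeff:
  fixes p :: "'a::linordered_field poly"
  assumes "lead_coeff p > 0"
  shows "\<exists>B. \<forall>x\<ge>B. poly p x \<ge> lead_coeff p"
  using assms
proof (induction p)
  case (pCons a p)
  show ?case
  proof (cases "p = 0")
    case False
    then have lc: "lead_coeff (pCons a p) = lead_coeff p" by simp
    with pCons obtain B where B: "\<And>x. x \<ge> B \<Longrightarrow> poly p x \<ge> lead_coeff p" by auto
    have l0: "lead_coeff p > 0" using pCons lc by simp
    let ?l = "lead_coeff p"
    have "poly (pCons a p) x \<ge> ?l" if x: "x \<ge> max B (1 + \<bar>a\<bar> / ?l)" for x
    proof -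
      have x1: "x \<ge> 1 + \<bar>a\<bar> / ?l" using x by simp
      have "\<bar>a\<bar> / ?l \<ge> 0" using l0 by simp
      then have x0: "x \<ge> 0" using x1 by linarith
      have "x * ?l \<ge> (1 + \<bar>a\<bar> / ?l) * ?l" using x1 l0 by (intro mult_right_mono) auto
      moreover have "(1 + \<bar>a\<bar> / ?l) * ?l = ?l + \<bar>a\<bar>" 
      proof -
        have "\<bar>a\<bar> / ?l * ?l = \<bar>a\<bar>" using l0 by (metis less_irrefl nonzero_eq_divide_eq)
        then show ?thesis by (simp only: distrib_right mult_1_left)
      qed
      ultimately have "x * ?l \<ge> ?l + \<bar>a\<bar>" by simp
      moreover have "x * poly p x \<ge> x * ?l" using B[of x] x x0 by (intro mult_left_mono) auto
      ultimately show ?thesis using abs_ge_minus_self[of a] by simp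
    qed
    then show ?thesis unfolding lc by blast
  qed auto
qed simp

lemma sg_poly_at_top:
  fixes p :: "'a::linordered_field poly"
  assumes "p \<noteq> 0"
  shows "\<exists>B. \<forall>x\<ge>B. sg (poly p x) = sg (lead_coeff p)"
proof -
  consider "lead_coeff p > 0" | "lead_coeff (- p) > 0"
    using assms by (metis lead_coeff_minus leading_coeff_0_iff linorder_neqE_linordered_idom neg_0_less_iff_less)
  then show ?thesis
  proof cases
    case 1
    then obtain B where B: "\<And>x. x \<ge> B \<Longrightarrow> poly p x \<ge> lead_coeff p"
      using poly_at_top_ge_lead_coeff by blast
    have "sg (poly p x) = sg (lead_coeff p)" if "x \<ge> B" for x
    proof -
      have "poly p x > 0" using B[OF that] 1 by (rule less_le_trans[rotated])
      then show ?thesis using 1 by simp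
    qed
    then show ?thesis by blast
  next
    case 2
    then obtain B where B: "\<And>x. x \<ge> B \<Longrightarrow> poly (- p) x \<ge> lead_coeff (- p)"
      using poly_at_top_ge_lead_coeff by blast
    have "sg (poly p x) = sg (lead_coeff p)" if "x \<ge> B" for x
    proof -
      have "poly (- p) x > 0" using B[OF that] 2 by (rule less_le_trans[rotated])
      then show ?thesis using 2 by simp
    qed
    then show ?thesis by blast
  qed
qed

lemma sg_poly_at_bot:
  fixes p :: "'a::linordered_field poly"
  assumes "p \<noteq> 0"
  shows "\<exists>B. \<forall>x\<le>B. sg (poly p x) = (-1) ^ degree p * sg (lead_coeff p)"
proof -
  define q where "q = pcompose p [:0, -1:]"
  have deg: "degree q = degree p" by (simp add: q_def degree_pcompose)
  have lc: "lead_coeff q = lead_coeff p * (-1) ^ degree p"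
    unfolding q_def by (subst lead_coeff_comp) auto
  have "q \<noteq> 0" using lc assms by (metis leading_coeff_0_iff mult_eq_0_iff power_eq_0_iff zero_neq_neg_one)
  then obtain B where B: "\<And>x. x \<ge> B \<Longrightarrow> sg (poly q x) = sg (lead_coeff q)" using sg_poly_at_top by blast
  have s: "sg ((-1 :: 'a) ^ n) = (-1) ^ n" for n by (induction n) (auto simp: sg_uminus)
  have "sg (poly p x) = (-1) ^ degree p * sg (lead_coeff p)" if "x \<le> - B" for x
  proof -
    have "poly p x = poly q (- x)" by (simp add: q_def poly_pcompose)
    then show ?thesis using B[of "- x"] that lc by (simp add: sg_mult s)
  qed
  then show ?thesis by blast
qed

subsection \<open>Sign diagrams\<close>

text \<open>Members that vanish identically contribute nothing, which keeps the set finite.\<close>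

definition zeros :: "'i set \<Rightarrow> ('i \<Rightarrow> 'a::idom poly) \<Rightarrow> 'a set"
  where "zeros I p = {z. \<exists>i\<in>I. p i \<noteq> 0 \<and> poly (p i) z = 0}"

lemma finite_zeros: "finite I \<Longrightarrow> finite (zeros I p)"
proof -
  assume "finite I"
  then have "finite (\<Union>i\<in>{i\<in>I. p i \<noteq> 0}. {z. poly (p i) z = 0})"
    by (intro finite_UN_I) (auto simp: poly_roots_finite)
  then show ?thesis by (rule rev_finite_subset) (auto simp: zeros_def)
qed

text \<open>When \<open>H\<close> is an order isomorphism between two finite sets, matched points
  are corresponding points of these sets or lie in corresponding gaps. The relation takes the place
  of a cell decomposition of the line.\<close>

definition matched :: "('a::linordered_idom \<times> 'b::linordered_idom) set \<Rightarrow> 'a \<Rightarrow> 'b \<Rightarrow> bool"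
  where "matched H t t' \<longleftrightarrow> (\<forall>(z, w)\<in>H. sg (t - z) = sg (t' - w))"

lemma matchedD: "matched H t t' \<Longrightarrow> (z, w) \<in> H \<Longrightarrow> sg (t - z) = sg (t' - w)"
  by (auto simp: matched_def)

lemma matched_converse: "matched (H\<inverse>) t t' \<longleftrightarrow> matched H t' t"
  unfolding matched_def by (force simp: eq_commute)

lemma matched_mono: "matched H t t' \<Longrightarrow> H' \<subseteq> H \<Longrightarrow> matched H' t t'"
  by (auto simp: matched_def)

text \<open>The condition that every pair of \<open>H\<close> is matched makes \<open>H\<close> an
  order isomorphism between the zeros of the two families. Signs are never listed, only compared at
  matched points.\<close>

definition sign_diagram :: "'i set \<Rightarrow> ('i \<Rightarrow> 'a::linordered_idom poly) \<Rightarrow> ('i \<Rightarrow> 'b::linordered_idom poly)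
    \<Rightarrow> ('a \<times> 'b) set \<Rightarrow> bool"
  where "sign_diagram I p q H \<longleftrightarrow> finite H \<and> fst ` H = zeros I p \<and> snd ` H = zeros I q \<and>
    (\<forall>(z, w)\<in>H. matched H z w) \<and> (\<forall>i\<in>I. p i = 0 \<longleftrightarrow> q i = 0) \<and>
    (\<forall>t t'. matched H t t' \<longrightarrow> (\<forall>i\<in>I. sg (poly (p i) t) = sg (poly (q i) t')))"

lemma sign_diagramD:
  assumes "sign_diagram I p q H"
  shows "finite H" "fst ` H = zeros I p" "snd ` H = zeros I q"
    "(z, w) \<in> H \<Longrightarrow> matched H z w" "i \<in> I \<Longrightarrow> p i = 0 \<longleftrightarrow> q i = 0"
    "matched H t t' \<Longrightarrow> i \<in> I \<Longrightarrow> sg (poly (p i) t) = sg (poly (q i) t')"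
  using assms unfolding sign_diagram_def by blast+

lemma sign_diagramI:
  assumes "finite H" "fst ` H = zeros I p" "snd ` H = zeros I q"
    "\<And>z w. (z, w) \<in> H \<Longrightarrow> matched H z w" "\<And>i. i \<in> I \<Longrightarrow> p i = 0 \<longleftrightarrow> q i = 0"
    "\<And>t t' i. matched H t t' \<Longrightarrow> i \<in> I \<Longrightarrow> sg (poly (p i) t) = sg (poly (q i) t')"
  shows "sign_diagram I p q H"
  using assms unfolding sign_diagram_def by auto

lemma sign_diagram_converse: "sign_diagram I p q H \<Longrightarrow> sign_diagram I q p (H\<inverse>)"
proof -
  assume sd: "sign_diagram I p q H"
  note D = sign_diagramD[OF sd]
  have f: "fst ` (H\<inverse>) = snd ` H" "snd ` (H\<inverse>) = fst ` H" by force+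
  show ?thesis
  proof (rule sign_diagramI)
    show "finite (H\<inverse>)" using D(1) by simp
    show "fst ` (H\<inverse>) = zeros I q" "snd ` (H\<inverse>) = zeros I p" using f D(2,3) by simp_all
    show "matched (H\<inverse>) z w" if "(z, w) \<in> H\<inverse>" for z w using D(4) that by (auto simp: matched_converse)
    show "q i = 0 \<longleftrightarrow> p i = 0" if "i \<in> I" for i using D(5)[OF that] by simp
    show "sg (poly (q i) t) = sg (poly (p i) t')" if "matched (H\<inverse>) t t'" "i \<in> I" for t t' i
      using D(6) that by (simp add: matched_converse)
  qed
qed

lemma between_finite_sets:
  fixes A B :: "'a::linordered_field set"
  assumes "finite A" "finite B" and lt: "\<And>a b. a \<in> A \<Longrightarrow> b \<in> B \<Longrightarrow> a < b"
  shows "\<exists>x. (\<forall>a\<in>A. a < x) \<and> (\<forall>b\<in>B. x < b)"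
proof (cases "A = {}")
  case True
  then show ?thesis
    by (cases "B = {}") (use lt_ex[of "Min B"] assms(2) in auto)
next
  case A: False
  show ?thesis
  proof (cases "B = {}")
    case True
    then show ?thesis using gt_ex[of "Max A"] assms(1) A by auto
  next
    case False
    then have "Max A < Min B" using assms A by simp
    then obtain x where "Max A < x" "x < Min B" using dense by blast
    then show ?thesis using assms(1,2) A False by auto
  qed
qed

text \<open>A cut carries over: the partners of the zeros below \<open>t\<close> precede those of
  the zeros above \<open>t\<close>, and an ordered field has an element in between. This is how a
  coordinate moves from one field to the other after elimination.\<close>

lemma matched_exists:
  fixes H :: "('a::linordered_field \<times> 'b::linordered_field) set"
  assumes fin: "finite H" and iso: "\<And>z w. (z, w) \<in> H \<Longrightarrow> matched H z w"
  shows "\<exists>t'. matched H t t'"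
proof (cases "t \<in> fst ` H")
  case True
  then show ?thesis using iso by force
next
  case False
  define A where "A = snd ` {x \<in> H. fst x < t}"
  define B where "B = snd ` {x \<in> H. fst x > t}"
  have "a < b" if a: "a \<in> A" and b: "b \<in> B" for a b
  proof -
    obtain z where z: "(z, a) \<in> H" "z < t" using a by (auto simp: A_def)
    obtain z' where z': "(z', b) \<in> H" "t < z'" using b by (auto simp: B_def)
    have "sg (z - z') = sg (a - b)" using iso[OF z(1)] z'(1) by (rule matchedD)
    moreover have "z - z' < 0" using z z' by simp
    ultimately show ?thesis by (metis diff_less_0_iff_less sg_eq_m1_iff)
  qed
  moreover have "finite A" "finite B" using fin by (auto simp: A_def B_def)
  ultimately obtain t' where t': "\<And>a. a \<in> A \<Longrightarrow> a < t'" "\<And>b. b \<in> B \<Longrightarrow> t' < b"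
    using between_finite_sets[of A B] by meson
  have "sg (t - z) = sg (t' - w)" if "(z, w) \<in> H" for z w
  proof -
    have "z \<noteq> t" using False that by force
    then consider "z < t" | "z > t" by fastforce
    then show ?thesis
    proof cases
      case 1
      then have "w \<in> A" using that by (force simp: A_def)
      then show ?thesis using t'(1)[of w] 1 by simp
    next
      case 2
      then have "w \<in> B" using that by (force simp: B_def)
      then show ?thesis using t'(2)[of w] 2 by simp
    qed
  qed
  then show ?thesis by (auto simp: matched_def)
qed

text \<open>Dropping members merges gaps, so a pair matched for the smaller relation may fail to be
  matched for \<open>H\<close>. Then \<open>t'\<close> is compared with a point \<open>t''\<close>
  that \<open>H\<close> matches to \<open>t\<close>: both lie in the same merged gap, where no
  remaining \<open>q i\<close> changes sign.\<close>

lemma sign_diagram_subset: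
  fixes p :: "'i \<Rightarrow> 'a::rcf poly" and q :: "'i \<Rightarrow> 'b::rcf poly"
  assumes sd: "sign_diagram I p q H" and J: "J \<subseteq> I"
  shows "sign_diagram J p q {(z, w) \<in> H. z \<in> zeros J p}"
proof -
  note D = sign_diagramD[OF sd]
  define H0 where "H0 = {(z, w) \<in> H. z \<in> zeros J p}"
  have sub: "H0 \<subseteq> H" by (auto simp: H0_def)
  have iff: "z \<in> zeros J p \<longleftrightarrow> w \<in> zeros J q" if zw: "(z, w) \<in> H" for z w
  proof -
    have "(p i = 0 \<longleftrightarrow> q i = 0) \<and> (poly (p i) z = 0 \<longleftrightarrow> poly (q i) w = 0)" if "i \<in> J" for i
    proof -
      have i: "i \<in> I" using that J by blast
      show ?thesis using D(5)[OF i] sg_eqD[OF D(6)[OF D(4)[OF zw] i]] by blast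
    qed
    then show ?thesis unfolding zeros_def by blast
  qed
  have zJ: "zeros J p \<subseteq> zeros I p" "zeros J q \<subseteq> zeros I q" using J by (auto simp: zeros_def)
  have f: "fst ` H0 = zeros J p" using D(2) zJ(1) by (force simp: H0_def)
  have s: "snd ` H0 = zeros J q" using D(3) zJ(2) iff by (force simp: H0_def)
  have fin: "finite H0" using D(1) sub by (rule rev_finite_subset)
  have m: "matched H0 z w" if "(z, w) \<in> H0" for z w
    using D(4) that sub by (meson matched_mono subsetD)
  have "sg (poly (p i) t) = sg (poly (q i) t')" if mt: "matched H0 t t'" and i: "i \<in> J" for t t' i
  proof (cases "t \<in> zeros J p")
    case True
    then obtain w where w: "(t, w) \<in> H0" using f by force
    then have "sg (t' - w) = 0" using matchedD[OF mt w] by simp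
    then have "t' = w" by simp
    then show ?thesis using D(4,6) w sub i J by blast
  next
    case False
    obtain t'' where t'': "matched H t t''" using matched_exists[of H t] D(1,4) by blast
    have e: "sg (poly (p i) t) = sg (poly (q i) t'')" using D(6)[OF t''] i J by blast
    have no: "poly (q i) x \<noteq> 0" if "q i \<noteq> 0" "min t' t'' \<le> x" "x \<le> max t' t''" for x
    proof
      assume "poly (q i) x = 0"
      then have "x \<in> zeros J q" using that i by (auto simp: zeros_def)
      then obtain z where z: "(z, x) \<in> H0" using s by force
      then have "sg (t' - x) = sg (t'' - x)" using matchedD[OF mt z] matchedD[OF t'', of z x] sub by auto
      then have "t' = x" using that by (auto simp: sg_def min_def max_def split: if_splits)
      then have "t = z" using matchedD[OF mt z] by simp
      then show False using False z f by force
    qed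
    have "sg (poly (q i) t') = sg (poly (q i) t'')"
    proof (cases "q i = 0")
      case False
      have "sg (poly (q i) (min t' t'')) = sg (poly (q i) (max t' t''))"
        by (rule sg_poly_eq_if_no_root) (use no[OF False] in auto)
      then show ?thesis by (auto simp: min_def max_def split: if_splits)
    qed simp
    then show ?thesis using e by simp
  qed
  note sgn = this
  show ?thesis
    unfolding H0_def[symmetric]
  proof (rule sign_diagramI[OF fin f s m _ sgn])
    show "p i = 0 \<longleftrightarrow> q i = 0" if "i \<in> J" for i using D(5) that J by blast
  qed
qed

text \<open>The two families are extended by an antiderivative \<open>P\<close> resp. \<open>Q\<close> of one of their members.
  Then \<open>P\<close> is monotone between consecutive zeros, so its sign on a gap is known from the signs
  at the two ends.\<close>

locale diagram_step =
  fixes I :: "'i set" and p :: "'i \<Rightarrow> 'a::rcf poly" and q :: "'i \<Rightarrow> 'b::rcf poly"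
    and H :: "('a \<times> 'b) set" and P :: "'a poly" and Q :: "'b poly" and j :: 'i
  assumes sd: "sign_diagram I p q H" and finI: "finite I"
    and j: "j \<in> I" and pj: "p j = pderiv P" and qj: "q j = pderiv Q"
    and degP: "degree P > 0" and degQ: "degree Q = degree P"
    and lead: "sg (lead_coeff P) = sg (lead_coeff Q)"
    and ends: "\<And>z w. (z, w) \<in> H \<Longrightarrow> sg (poly P z) = sg (poly Q w)"
begin

lemmas D = sign_diagramD[OF sd]

lemma P0: "P \<noteq> 0" and Q0: "Q \<noteq> 0" and P'0: "pderiv P \<noteq> 0"
  using degP degQ by (auto simp: pderiv_eq_0_iff)

lemma sgP': "matched H t t' \<Longrightarrow> sg (poly (pderiv P) t) = sg (poly (pderiv Q) t')"
  using D(6)[of t t' j] j by (simp add: pj qj)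

text \<open>The assumptions are symmetric in the two families, so each fact about \<open>P\<close>
  has a counterpart for \<open>Q\<close>.\<close>

lemma converse: "diagram_step I q p (H\<inverse>) Q P j"
  using sign_diagram_converse[OF sd] finI j pj qj degP degQ lead ends
  by unfold_locales auto

lemma root_P'_in_zeros: "poly (pderiv P) u = 0 \<Longrightarrow> u \<in> zeros I p"
  using P'0 j pj unfolding zeros_def by force

lemma notin_zeros: "matched H t t' \<Longrightarrow> t \<in> zeros I p \<longleftrightarrow> t' \<in> zeros I q"
  unfolding D(2)[symmetric] D(3)[symmetric]
  by (force dest: matchedD simp: image_iff)

lemma rolle_gap:
  assumes r: "poly P r = 0" and s: "poly P s = 0" and rs: "r < s"
  shows "\<exists>z\<in>zeros I p. r < z \<and> z < s"
proof -
  obtain c where "r < c" "c < s" "poly (pderiv P) c = 0" using poly_rolle[OF rs r s] by blast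
  then show ?thesis using root_P'_in_zeros by blast
qed

lemma sgP'_gap:
  assumes no: "\<And>u. u \<in> zeros I p \<Longrightarrow> (x \<le> u \<and> u \<le> r) \<or> (r \<le> u \<and> u \<le> x) \<Longrightarrow> False"
  shows "sg (poly (pderiv P) x) = sg (poly (pderiv P) r)"
proof (cases "x \<le> r")
  case True
  show ?thesis by (rule sg_poly_eq_if_no_root[OF True]) (use no root_P'_in_zeros in blast)
next
  case False
  then have "r \<le> x" by simp
  from sg_poly_eq_if_no_root[OF this, of "pderiv P"] show ?thesis
    using no root_P'_in_zeros by metis
qed

text \<open>By the mean value theorem P(t) = (t - r) P'(c), and P' keeps its sign between
  \<open>c\<close> and \<open>r\<close>, as \<open>t\<close> is the only point of the closed
  interval that may belong to \<open>zeros I p\<close>. So \<open>t\<close> is allowed to be an end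
  of the gap.\<close>

lemma sg_P_gap:
  assumes r: "poly P r = 0" and no: "\<And>u. u \<in> zeros I p \<Longrightarrow> (t \<le> u \<and> u \<le> r) \<or> (r \<le> u \<and> u \<le> t) \<Longrightarrow> u = t"
    and "t \<noteq> r"
  shows "sg (poly P t) = sg (t - r) * sg (poly (pderiv P) r)"
proof -
  consider "t < r" | "r < t" using \<open>t \<noteq> r\<close> by fastforce
  then show ?thesis
  proof cases
    case 1
    obtain c where c: "t < c" "c < r" "poly P r - poly P t = (r - t) * poly (pderiv P) c"
      using poly_mvt[OF 1] by blast
    have "poly P t = (t - r) * poly (pderiv P) c" using c(3) r by (simp add: algebra_simps)
    moreover have "sg (poly (pderiv P) c) = sg (poly (pderiv P) r)"
    proof (rule sgP'_gap)
      fix u assume u: "u \<in> zeros I p" "(c \<le> u \<and> u \<le> r) \<or> (r \<le> u \<and> u \<le> c)"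
      then have "t < u" "u \<le> r" using c 1 by auto
      then show False using no[OF u(1)] by simp
    qed
    ultimately show ?thesis by (simp add: sg_mult)
  next
    case 2
    obtain c where c: "r < c" "c < t" "poly P t - poly P r = (t - r) * poly (pderiv P) c"
      using poly_mvt[OF 2] by blast
    have "poly P t = (t - r) * poly (pderiv P) c" using c(3) r by (simp add: algebra_simps)
    moreover have "sg (poly (pderiv P) c) = sg (poly (pderiv P) r)"
    proof (rule sgP'_gap)
      fix u assume u: "u \<in> zeros I p" "(c \<le> u \<and> u \<le> r) \<or> (r \<le> u \<and> u \<le> c)"
      then have "u < t" "r \<le> u" using c 2 by auto
      then show False using no[OF u(1)] by simp
    qed
    ultimately show ?thesis by (simp add: sg_mult)
  qed
qed

section \<open>Roots of the antiderivative in corresponding gaps\<close>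

lemma matched_below:
  assumes "matched H r t" and lo: "\<And>z w. (z, w) \<in> H \<Longrightarrow> z < r \<Longrightarrow> w < x"
    and xt: "x \<le> t" and rn: "r \<notin> zeros I p"
  shows "matched H r x"
  unfolding matched_def
proof safe
  fix z w assume zw: "(z, w) \<in> H"
  then have "z \<noteq> r" using rn D(2) by force
  then consider "z < r" | "r < z" by fastforce
  then show "sg (r - z) = sg (x - w)"
  proof cases
    case 1
    then show ?thesis using lo[OF zw] by simp
  next
    case 2
    then have "t - w < 0" using matchedD[OF assms(1) zw] by (metis diff_less_0_iff_less sg_eq_m1_iff)
    then show ?thesis using 2 xt by simp
  qed
qed

lemma matched_above:
  assumes "matched H r t" and hi: "\<And>z w. (z, w) \<in> H \<Longrightarrow> r < z \<Longrightarrow> x < w"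
    and xt: "t \<le> x" and rn: "r \<notin> zeros I p"
  shows "matched H r x"
  unfolding matched_def
proof safe
  fix z w assume zw: "(z, w) \<in> H"
  then have "z \<noteq> r" using rn D(2) by force
  then consider "z < r" | "r < z" by fastforce
  then show "sg (r - z) = sg (x - w)"
  proof cases
    case 2
    then show ?thesis using hi[OF zw] by simp
  next
    case 1
    then have "t - w > 0" using matchedD[OF assms(1) zw] by (metis diff_gt_0_iff_gt sg_eq_1_iff)
    then show ?thesis using 1 xt by simp
  qed
qed

lemma H_mono: "(z, w) \<in> H \<Longrightarrow> (z', w') \<in> H \<Longrightarrow> z \<le> z' \<Longrightarrow> w \<le> w'"
  using matchedD[OF D(4), of z w z' w'] by (auto simp: sg_def split: if_splits)

text \<open>In the gap of \<open>r\<close> the derivative has a constant sign \<open>d\<close>, so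
  \<open>P\<close> has sign \<open>- d\<close> at the left end and \<open>d\<close> at the right
  end, ends at infinity included. \<open>Q\<close> has the same signs at the ends of the
  corresponding gap, by \<open>ends\<close> or by the leading coefficients. The sign of
  \<open>Q\<close> at an arbitrary point \<open>t\<close> of that gap decides towards which end a
  sign change, and hence a root, is found.\<close>

lemma root_matched:
  assumes r: "poly P r = 0" and rn: "r \<notin> zeros I p"
  shows "\<exists>r'. matched H r r' \<and> poly Q r' = 0"
proof (rule ccontr)
  assume neg: "\<not> ?thesis"
  obtain t where t: "matched H r t" using matched_exists[of H r] D(1,4) by blast
  define d where "d = sg (poly (pderiv P) r)"
  define e where "e = sg (poly Q t)"
  have d0: "d \<noteq> 0" using rn P'0 j pj by (auto simp: d_def zeros_def)
  have e0: "e \<noteq> 0" using neg t by (auto simp: e_def)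
  have finz: "finite {z \<in> zeros I p. z < r}" "finite {z \<in> zeros I p. r < z}"
    using finite_subset[OF _ finite_zeros[OF finI, of p]] by auto
  have left: "\<exists>t1<t. sg (poly Q t1) = - d \<and> (\<forall>x. t1 < x \<longrightarrow> x \<le> t \<longrightarrow> matched H r x)"
  proof (cases "\<exists>z\<in>zeros I p. z < r")
    case True
    define z where "z = Max {z \<in> zeros I p. z < r}"
    have z: "z \<in> zeros I p" "z < r" "\<And>u. u \<in> zeros I p \<Longrightarrow> u < r \<Longrightarrow> u \<le> z"
      using True Max_in[OF finz(1)] Max_ge[OF finz(1)] unfolding z_def by auto
    obtain w where w: "(z, w) \<in> H" using z(1) D(2) by force
    have "w < t" using matchedD[OF t w] z(2) by (metis diff_gt_0_iff_gt sg_eq_1_iff)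
    moreover have "sg (poly P z) = sg (z - r) * d"
      unfolding d_def
    proof (rule sg_P_gap[OF r])
      fix u assume u: "u \<in> zeros I p" "(z \<le> u \<and> u \<le> r) \<or> (r \<le> u \<and> u \<le> z)"
      then have "u \<noteq> r" "z \<le> u" "u \<le> r" using rn z(2) by auto
      then show "u = z" using z(3)[OF u(1)] by simp
    qed (use z in simp)
    then have "sg (poly Q w) = - d" using ends[OF w] z(2) by simp
    moreover have "matched H r x" if x: "w < x" "x \<le> t" for x
    proof (rule matched_below[OF t _ x(2) rn])
      fix z' w' assume zw': "(z', w') \<in> H" "z' < r"
      then have "z' \<le> z" using z(3) D(2) by force
      then show "w' < x" using H_mono[OF zw'(1) w] x(1) by simp
    qed
    ultimately show ?thesis by blast
  next
    case False
    obtain B where B: "\<And>x. x \<le> B \<Longrightarrow> sg (poly P x) = (-1) ^ degree P * sg (lead_coeff P)"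
      using sg_poly_at_bot[OF P0] by blast
    obtain C where C: "\<And>x. x \<le> C \<Longrightarrow> sg (poly Q x) = (-1) ^ degree Q * sg (lead_coeff Q)"
      using sg_poly_at_bot[OF Q0] by blast
    \<comment> \<open>Far to the left the sign of \<open>P\<close> is known both from the leading
      coefficient and from \<open>sg_P_gap\<close>. Comparing the two writes \<open>- d\<close> in
      terms of data that \<open>Q\<close> shares.\<close>
    define u where "u = min B (r - 1)"
    have ur: "u - r < 0" by (auto simp: u_def min_def)
    have "sg (poly P u) = sg (u - r) * d"
      unfolding d_def
    proof (rule sg_P_gap[OF r])
      fix v assume v: "v \<in> zeros I p" "(u \<le> v \<and> v \<le> r) \<or> (r \<le> v \<and> v \<le> u)"
      then have "v = r" using False ur by force
      then show "v = u" using v(1) rn by simp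
    qed (use ur in simp)
    with ur have s: "(-1) ^ degree P * sg (lead_coeff P) = - d" using B[of u] by (simp add: u_def)
    define x0 where "x0 = min C (t - 1)"
    have "sg (poly Q x0) = - d" using C[of x0] s lead degQ by (simp add: x0_def)
    moreover have "x0 < t" by (auto simp: x0_def min_def)
    moreover have "matched H r x" if x: "x0 < x" "x \<le> t" for x
      by (rule matched_below[OF t _ x(2) rn]) (use False D(2) in force)
    ultimately show ?thesis by blast
  qed
  have right: "\<exists>t1>t. sg (poly Q t1) = d \<and> (\<forall>x. x < t1 \<longrightarrow> t \<le> x \<longrightarrow> matched H r x)"
  proof (cases "\<exists>z\<in>zeros I p. r < z")
    case True
    define z where "z = Min {z \<in> zeros I p. r < z}"
    have z: "z \<in> zeros I p" "r < z" "\<And>u. u \<in> zeros I p \<Longrightarrow> r < u \<Longrightarrow> z \<le> u"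
      using True Min_in[OF finz(2)] Min_le[OF finz(2)] unfolding z_def by auto
    obtain w where w: "(z, w) \<in> H" using z(1) D(2) by force
    have "t < w" using matchedD[OF t w] z(2) by (metis diff_less_0_iff_less sg_eq_m1_iff)
    moreover have "sg (poly P z) = sg (z - r) * d"
      unfolding d_def
    proof (rule sg_P_gap[OF r])
      fix u assume u: "u \<in> zeros I p" "(z \<le> u \<and> u \<le> r) \<or> (r \<le> u \<and> u \<le> z)"
      then have "u \<noteq> r" "u \<le> z" "r \<le> u" using rn z(2) by auto
      then show "u = z" using z(3)[OF u(1)] by simp
    qed (use z in simp)
    then have "sg (poly Q w) = d" using ends[OF w] z(2) by simp
    moreover have "matched H r x" if x: "x < w" "t \<le> x" for x
    proof (rule matched_above[OF t _ x(2) rn])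
      fix z' w' assume zw': "(z', w') \<in> H" "r < z'"
      then have "z \<le> z'" using z(3) D(2) by force
      then show "x < w'" using H_mono[OF w zw'(1)] x(1) by simp
    qed
    ultimately show ?thesis by blast
  next
    case False
    obtain B where B: "\<And>x. x \<ge> B \<Longrightarrow> sg (poly P x) = sg (lead_coeff P)"
      using sg_poly_at_top[OF P0] by blast
    obtain C where C: "\<And>x. x \<ge> C \<Longrightarrow> sg (poly Q x) = sg (lead_coeff Q)"
      using sg_poly_at_top[OF Q0] by blast
    define u where "u = max B (r + 1)"
    have ur: "u - r > 0" by (auto simp: u_def max_def)
    have "sg (poly P u) = sg (u - r) * d"
      unfolding d_def
    proof (rule sg_P_gap[OF r])
      fix v assume v: "v \<in> zeros I p" "(u \<le> v \<and> v \<le> r) \<or> (r \<le> v \<and> v \<le> u)"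
      then have "v = r" using False ur by force
      then show "v = u" using v(1) rn by simp
    qed (use ur in simp)
    with ur have s: "sg (lead_coeff P) = d" using B[of u] by (simp add: u_def)
    define x0 where "x0 = max C (t + 1)"
    have "sg (poly Q x0) = d" using C[of x0] s lead degQ by (simp add: x0_def)
    moreover have "t < x0" by (auto simp: x0_def max_def)
    moreover have "matched H r x" if x: "x < x0" "t \<le> x" for x
      by (rule matched_above[OF t _ x(2) rn]) (use False D(2) in force)
    ultimately show ?thesis by blast
  qed
  have "e = d \<or> e = - d" using d0 e0 sg_cases[of "poly Q t"] sg_cases[of "poly (pderiv P) r"]
    unfolding d_def[symmetric] e_def[symmetric] by auto
  then show False
  proof
    assume ed: "e = d"
    from left obtain t1 where t1: "t1 < t" "sg (poly Q t1) = - d" "\<And>x. t1 < x \<Longrightarrow> x \<le> t \<Longrightarrow> matched H r x"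
      by blast
    have "poly Q t1 \<noteq> 0" "poly Q t \<noteq> 0" using t1(2) d0 e0 unfolding e_def by auto
    then obtain c where "t1 < c" "c < t" "poly Q c = 0"
      using poly_ivt_sg[OF t1(1), of Q] t1(2) ed d0 unfolding e_def by auto
    then show False using neg t1(3)[of c] by auto
  next
    assume ed: "e = - d"
    from right obtain t1 where t1: "t < t1" "sg (poly Q t1) = d" "\<And>x. x < t1 \<Longrightarrow> t \<le> x \<Longrightarrow> matched H r x"
      by blast
    have "poly Q t1 \<noteq> 0" "poly Q t \<noteq> 0" using t1(2) d0 e0 unfolding e_def by auto
    then obtain c where "t < c" "c < t1" "poly Q c = 0"
      using poly_ivt_sg[OF t1(1), of Q] t1(2) ed d0 unfolding e_def by auto
    then show False using neg t1(3)[of c] by auto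
  qed
qed

text \<open>No partner is chosen: by Rolle a gap of \<open>H\<close> contains at most one root of
  \<open>P\<close> and at most one of \<open>Q\<close>, so being matched already pairs them.\<close>

definition H' :: "('a \<times> 'b) set"
  where "H' = {(r, r'). matched H r r' \<and> (r \<in> zeros I p \<or> poly P r = 0) \<and> (r' \<in> zeros I q \<or> poly Q r' = 0)}"

lemma H'_converse: "diagram_step.H' I q p (H\<inverse>) Q P = H'\<inverse>"
  unfolding H'_def diagram_step.H'_def[OF converse] by (auto simp: matched_converse)

lemma H_sub_H': "H \<subseteq> H'"
  unfolding H'_def using D(2,3,4) by force

text \<open>Some old zero lies between \<open>r\<close> and \<open>s\<close>, by Rolle if neither is
  one itself, and its partner then separates \<open>r'\<close> from \<open>s'\<close>.\<close>

lemma H'_less: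
  assumes "(r, r') \<in> H'" "(s, s') \<in> H'" and rs: "r < s"
  shows "r' < s'"
proof -
  have m: "matched H r r'" "matched H s s'" using assms by (auto simp: H'_def)
  have "\<exists>z\<in>zeros I p. r \<le> z \<and> z \<le> s"
  proof (cases "r \<in> zeros I p \<or> s \<in> zeros I p")
    case False
    then have "poly P r = 0" "poly P s = 0" using assms by (auto simp: H'_def)
    then show ?thesis using rolle_gap[OF _ _ rs] by (metis less_imp_le)
  qed (use rs in \<open>auto intro: less_imp_le\<close>)
  then obtain z w where zw: "(z, w) \<in> H" "r \<le> z" "z \<le> s" using D(2) by force
  then show ?thesis
    using matchedD[OF m(1) zw(1)] matchedD[OF m(2) zw(1)] rs by (auto simp: sg_def split: if_splits)
qed

lemma fst_H': "fst ` H' = zeros I p \<union> {r. poly P r = 0}"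
proof -
  have "\<exists>r'. (r, r') \<in> H'" if "r \<in> zeros I p \<or> poly P r = 0" for r
  proof (cases "r \<in> zeros I p")
    case True
    then obtain w where "(r, w) \<in> H" using D(2) by force
    then show ?thesis using H_sub_H' by blast
  next
    case False
    then show ?thesis using root_matched[OF _ False] that by (auto simp: H'_def)
  qed
  then show ?thesis by (force simp: H'_def)
qed

lemma snd_H': "snd ` H' = zeros I q \<union> {r. poly Q r = 0}"
proof -
  have "fst ` (H'\<inverse>) = zeros I q \<union> {r. poly Q r = 0}"
    using diagram_step.fst_H'[OF converse] unfolding H'_converse .
  moreover have "fst ` (H'\<inverse>) = snd ` H'" by force
  ultimately show ?thesis by simp
qed

lemma H'_iff:
  assumes "(r, r') \<in> H'" "(s, s') \<in> H'"
  shows "sg (r - s) = sg (r' - s')"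
proof -
  have "r' < s' \<Longrightarrow> r < s" "s' < r' \<Longrightarrow> s < r"
    using diagram_step.H'_less[OF converse] assms unfolding H'_converse by auto
  moreover have "r < s \<Longrightarrow> r' < s'" "s < r \<Longrightarrow> s' < r'" using H'_less assms by blast+
  ultimately show ?thesis
    by (cases r s rule: linorder_cases; cases r' s' rule: linorder_cases) auto
qed

text \<open>At old zeros \<open>ends\<close> applies, and at new roots both sides vanish. In a gap
  with a root the sign is read off from the side of the root and the sign of the derivative. In a
  gap without roots the sign is constant: it is that at the left end, or that of the derivative if
  the left end is a root, or that near minus infinity if there is no left end.\<close>

lemma sg_PQ:
  assumes m': "matched H' t t'"
  shows "sg (poly P t) = sg (poly Q t')"
proof -
  have m: "matched H t t'" using m' H_sub_H' by (rule matched_mono)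
  have root: "t \<in> zeros I p \<or> poly P t = 0 \<Longrightarrow> (t, t') \<in> H'"
  proof -
    assume "t \<in> zeros I p \<or> poly P t = 0"
    then obtain w where w: "(t, w) \<in> H'" using fst_H' by force
    then have "sg (t' - w) = 0" using matchedD[OF m' w] by simp
    then show ?thesis using w by simp
  qed
  have root': "poly Q t' = 0 \<Longrightarrow> (t, t') \<in> H'"
  proof -
    assume "poly Q t' = 0"
    then obtain z where z: "(z, t') \<in> H'" using snd_H' by force
    then have "sg (t - z) = 0" using matchedD[OF m' z] by simp
    then show ?thesis using z by simp
  qed
  show ?thesis
  proof (cases "t \<in> zeros I p")
    case True
    then obtain w where w: "(t, w) \<in> H" using D(2) by force
    then have "sg (t' - w) = 0" using matchedD[OF m w] by simp
    then show ?thesis using ends[OF w] by simp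
  next
    case tn: False
    then have t'n: "t' \<notin> zeros I q" using notin_zeros[OF m] by blast
    show ?thesis
    proof (cases "poly P t = 0 \<or> poly Q t' = 0")
      case True
      then have "(t, t') \<in> H'" using root root' by blast
      then show ?thesis using tn t'n by (auto simp: H'_def)
    next
      case ne: False
      show ?thesis
      proof (cases "\<exists>(r, r')\<in>H'. matched H r t'")
        case True
        then obtain r r' where rr: "(r, r') \<in> H'" and mr: "matched H r t'" by blast
        have mrr: "matched H r r'" using rr by (simp add: H'_def)
        have rn: "r \<notin> zeros I p" using notin_zeros[OF mr] t'n by blast
        then have r'n: "r' \<notin> zeros I q" using notin_zeros[OF mrr] by blast
        have r0: "poly P r = 0" "poly Q r' = 0" using rr rn r'n by (auto simp: H'_def)
        have tr: "t \<noteq> r" "t' \<noteq> r'" using r0 ne by auto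
        have gap: "u = t" if u: "u \<in> zeros I p" "(t \<le> u \<and> u \<le> r) \<or> (r \<le> u \<and> u \<le> t)" for u
        proof -
          obtain w where w: "(u, w) \<in> H" using u(1) D(2) by force
          have "sg (t - u) = sg (r - u)" using matchedD[OF m w] matchedD[OF mr w] by simp
          then show ?thesis using that(2) by (auto simp: sg_def split: if_splits)
        qed
        have gap': "u = t'" if u: "u \<in> zeros I q" "(t' \<le> u \<and> u \<le> r') \<or> (r' \<le> u \<and> u \<le> t')" for u
        proof -
          obtain z where z: "(z, u) \<in> H" using u(1) D(3) by force
          have "sg (t' - u) = sg (r' - u)" using matchedD[OF mr z] matchedD[OF mrr z] by simp
          then show ?thesis using that(2) by (auto simp: sg_def split: if_splits)
        qed
        have "sg (poly P t) = sg (t - r) * sg (poly (pderiv P) r)"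
          by (rule sg_P_gap[OF r0(1) gap tr(1)])
        moreover have "sg (poly Q t') = sg (t' - r') * sg (poly (pderiv Q) r')"
          by (rule diagram_step.sg_P_gap[OF converse r0(2) gap' tr(2)])
        ultimately show ?thesis using sgP'[OF mrr] matchedD[OF m' rr] by simp
      next
        case no: False
        have noP: "poly P x \<noteq> 0" if "matched H x t'" for x
        proof
          assume "poly P x = 0"
          then obtain x' where "(x, x') \<in> H'" using fst_H' by force
          then show False using no that by blast
        qed
        have noQ: "poly Q x \<noteq> 0" if mx: "matched H t x" for x
        proof
          assume "poly Q x = 0"
          then obtain r where r: "(r, x) \<in> H'" using snd_H' by force
          have "matched H r t'"
            unfolding matched_def
          proof safe
            fix z w assume zw: "(z, w) \<in> H"
            have "matched H r x" using r by (simp add: H'_def)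
            then show "sg (r - z) = sg (t' - w)"
              using matchedD[OF mx zw] matchedD[OF m zw] matchedD[of H r x z w] zw by simp
          qed
          then show False using no r by blast
        qed
        show ?thesis
        proof (cases "\<exists>z\<in>zeros I p. z < t")
          case True
          define z where "z = Max {z \<in> zeros I p. z < t}"
          have finz: "finite {z \<in> zeros I p. z < t}"
            using finite_subset[OF _ finite_zeros[OF finI, of p]] by auto
          have z: "z \<in> zeros I p" "z < t" "\<And>u. u \<in> zeros I p \<Longrightarrow> u < t \<Longrightarrow> u \<le> z"
            using True Max_in[OF finz] Max_ge[OF finz] unfolding z_def by auto
          obtain w where w: "(z, w) \<in> H" using z(1) D(2) by force
          have wt: "w < t'" using matchedD[OF m w] z(2) by (metis diff_gt_0_iff_gt sg_eq_1_iff)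
          have mz: "matched H x t'" if x: "z < x" "x \<le> t" for x
            unfolding matched_def
          proof safe
            fix u v assume uv: "(u, v) \<in> H"
            then have "u \<in> zeros I p" using D(2) by force
            then have "u \<noteq> t" "u < t \<Longrightarrow> u \<le> z" using tn z(3) by auto
            then have "sg (x - u) = sg (t - u)" using x by (auto simp: sg_def)
            then show "sg (x - u) = sg (t' - v)" using matchedD[OF m uv] by simp
          qed
          have mw: "matched H t x" if x: "w < x" "x \<le> t'" for x
            unfolding matched_def
          proof safe
            fix u v assume uv: "(u, v) \<in> H"
            then have u: "u \<in> zeros I p" using D(2) by force
            have "v \<noteq> t'" using t'n D(3) uv by force
            moreover have "v \<le> w" if "v < t'"
            proof -
              have "u < t" using that matchedD[OF m uv] by (metis diff_gt_0_iff_gt sg_eq_1_iff)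
              then show ?thesis using H_mono[OF uv w] z(3)[OF u] by simp
            qed
            ultimately have "sg (x - v) = sg (t' - v)" using x by (auto simp: sg_def)
            then show "sg (t - u) = sg (x - v)" using matchedD[OF m uv] by simp
          qed
          show ?thesis
          proof (cases "poly P z = 0")
            case Pz: False
            have "poly Q w \<noteq> 0" using ends[OF w] Pz by (metis sg_eq_0_iff)
            have "sg (poly P z) = sg (poly P t)"
            proof (rule sg_poly_eq_if_no_root)
              fix x assume "z \<le> x" "x \<le> t"
              then show "poly P x \<noteq> 0" using noP[OF mz[of x]] Pz by (cases "x = z") auto
            qed (use z in simp)
            moreover have "sg (poly Q w) = sg (poly Q t')"
            proof (rule sg_poly_eq_if_no_root)
              fix x assume "w \<le> x" "x \<le> t'"
              then show "poly Q x \<noteq> 0" using noQ[OF mw[of x]] \<open>poly Q w \<noteq> 0\<close> by (cases "x = w") auto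
            qed (use wt in simp)
            ultimately show ?thesis using ends[OF w] by simp
          next
            case Pz: True
            then have Qw: "poly Q w = 0" using ends[OF w] by (metis sg_eq_0_iff)
            obtain c where c: "z < c" "c < t" "poly P t - poly P z = (t - z) * poly (pderiv P) c"
              using poly_mvt[OF z(2)] by blast
            obtain c' where c': "w < c'" "c' < t'" "poly Q t' - poly Q w = (t' - w) * poly (pderiv Q) c'"
              using poly_mvt[OF wt] by blast
            have "matched H c c'"
              unfolding matched_def
            proof safe
              fix u v assume uv: "(u, v) \<in> H"
              show "sg (c - u) = sg (c' - v)"
                using matchedD[OF mz[of c] uv] matchedD[OF mw[of c'] uv] matchedD[OF m uv] c c' by simp
            qed
            then have "sg (poly (pderiv P) c) = sg (poly (pderiv Q) c')" by (rule sgP')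
            then show ?thesis using c c' Pz Qw z(2) wt by (simp add: sg_mult)
          qed
        next
          case False
          obtain B where B: "\<And>x. x \<le> B \<Longrightarrow> sg (poly P x) = (-1) ^ degree P * sg (lead_coeff P)"
            using sg_poly_at_bot[OF P0] by blast
          obtain C where C: "\<And>x. x \<le> C \<Longrightarrow> sg (poly Q x) = (-1) ^ degree Q * sg (lead_coeff Q)"
            using sg_poly_at_bot[OF Q0] by blast
          have up: "u > t \<and> v > t'" if "(u, v) \<in> H" for u v
          proof -
            have "u \<in> zeros I p" using that D(2) by force
            then have "u > t" using False tn by (metis linorder_neqE_linordered_idom)
            then show ?thesis using matchedD[OF m that] by (metis diff_less_0_iff_less sg_eq_m1_iff)
          qed
          have "sg (poly P (min B t)) = sg (poly P t)"
          proof (rule sg_poly_eq_if_no_root)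
            fix x assume "x \<le> t"
            then have "matched H x t'" using up by (force simp: matched_def)
            then show "poly P x \<noteq> 0" by (rule noP)
          qed simp
          moreover have "sg (poly Q (min C t')) = sg (poly Q t')"
          proof (rule sg_poly_eq_if_no_root)
            fix x assume "x \<le> t'"
            then have "matched H t x" using up by (force simp: matched_def)
            then show "poly Q x \<noteq> 0" by (rule noQ)
          qed simp
          ultimately show ?thesis using B[of "min B t"] C[of "min C t'"] lead degQ by simp
        qed
      qed
    qed
  qed
qed

lemma sign_diagram_insert:
  assumes "p k = P" "q k = Q"
  shows "sign_diagram (insert k I) p q H'"
proof -
  have z: "zeros (insert k I) p = fst ` H'" "zeros (insert k I) q = snd ` H'"
    unfolding fst_H' snd_H' using P0 Q0 assms by (auto simp: zeros_def)
  have fin: "finite H'"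
  proof (rule finite_subset)
    show "H' \<subseteq> fst ` H' \<times> snd ` H'" by force
    show "finite (fst ` H' \<times> snd ` H')"
      unfolding fst_H' snd_H' using finite_zeros[OF finI, of p] finite_zeros[OF finI, of q] poly_roots_finite[OF P0] poly_roots_finite[OF Q0]
      by (intro finite_cartesian_product finite_UnI) auto
  qed
  show ?thesis
  proof (rule sign_diagramI[OF fin z[symmetric]])
    show "matched H' u v" if "(u, v) \<in> H'" for u v using H'_iff that by (auto simp: matched_def)
    show "p i = 0 \<longleftrightarrow> q i = 0" if "i \<in> insert k I" for i
      using D(5)[of i] P0 Q0 assms that by auto
    show "sg (poly (p i) t) = sg (poly (q i) t')" if "matched H' t t'" "i \<in> insert k I" for t t' i
      using sg_PQ[OF that(1)] D(6)[OF matched_mono[OF that(1) H_sub_H']] that(2) assms by blast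
  qed
qed

end

subsection \<open>Parametric sign diagrams\<close>

definition rhom :: "('a::comm_ring_1 \<Rightarrow> 'b::comm_ring_1) \<Rightarrow> bool"
  where "rhom f \<longleftrightarrow> f 1 = 1 \<and> (\<forall>x y. f (x + y) = f x + f y) \<and> (\<forall>x y. f (x * y) = f x * f y)"

lemma rhom_add: "rhom f \<Longrightarrow> f (x + y) = f x + f y" and rhom_mult: "rhom f \<Longrightarrow> f (x * y) = f x * f y"
  and rhom_1: "rhom f \<Longrightarrow> f 1 = 1"
  by (auto simp: rhom_def)

lemma rhom_0: "rhom f \<Longrightarrow> f 0 = 0"
  using rhom_add[of f 0 0] by simp

lemma rhom_uminus: "rhom f \<Longrightarrow> f (- x) = - f x"
  using rhom_add[of f x "- x"] by (simp add: rhom_0 eq_neg_iff_add_eq_0 add.commute)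

lemma rhom_diff: "rhom f \<Longrightarrow> f (x - y) = f x - f y"
  using rhom_add[of f x "- y"] by (simp add: rhom_uminus)

lemma rhom_sum: "rhom f \<Longrightarrow> f (sum g A) = (\<Sum>x\<in>A. f (g x))"
  by (induction A rule: infinite_finite_induct) (auto simp: rhom_0 rhom_add)

lemma rhom_prod: "rhom f \<Longrightarrow> f (prod g A) = (\<Prod>x\<in>A. f (g x))"
  by (induction A rule: infinite_finite_induct) (auto simp: rhom_1 rhom_mult)

lemma rhom_power: "rhom f \<Longrightarrow> f (x ^ n) = f x ^ n"
  by (induction n) (auto simp: rhom_1 rhom_mult)

lemma rhom_of_nat: "rhom f \<Longrightarrow> f (of_nat n) = of_nat n"
  by (induction n) (auto simp: rhom_0 rhom_1 rhom_add)

lemma rhom_comp: "rhom f \<Longrightarrow> rhom g \<Longrightarrow> rhom (\<lambda>x. f (g x))"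
  by (simp add: rhom_def)

lemma rhom_poly_eval: "rhom (\<lambda>p. poly p x)"
  by (simp add: rhom_def)

lemma rhom_map_poly:
  assumes "rhom f"
  shows "rhom (map_poly f)"
proof -
  note [simp] = rhom_0[OF assms] rhom_1[OF assms]
  have "map_poly f 1 = 1" by (simp add: map_poly_1')
  moreover have "map_poly f (p + q) = map_poly f p + map_poly f q" for p q
    by (rule poly_eqI) (simp add: coeff_map_poly rhom_add[OF assms])
  moreover have "map_poly f (p * q) = map_poly f p * map_poly f q" for p q
    by (rule poly_eqI) (simp add: coeff_map_poly coeff_mult rhom_sum[OF assms] rhom_mult[OF assms])
  ultimately show ?thesis by (simp add: rhom_def)
qed

text \<open>\<^const>\<open>pderiv\<close> is only available in the absence of zero divisors.\<close>

definition formal_deriv :: "'a::comm_ring_1 poly \<Rightarrow> 'a poly"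
  where "formal_deriv p = (\<Sum>i<degree p. monom (of_nat (Suc i) * coeff p (Suc i)) i)"

lemma coeff_formal_deriv: "coeff (formal_deriv p) i = of_nat (Suc i) * coeff p (Suc i)"
proof -
  have "coeff (formal_deriv p) i = (if i < degree p then of_nat (Suc i) * coeff p (Suc i) else 0)"
    by (simp add: formal_deriv_def coeff_sum if_distrib sum.delta' cong: if_cong del: of_nat_Suc)
  then show ?thesis by (simp add: coeff_eq_0 del: of_nat_Suc)
qed

lemma map_poly_formal_deriv:
  assumes "rhom f"
  shows "map_poly f (formal_deriv p) = pderiv (map_poly f p)"
  by (rule poly_eqI)
     (simp add: coeff_map_poly coeff_pderiv coeff_formal_deriv rhom_0[OF assms] rhom_mult[OF assms] rhom_of_nat[OF assms]
       del: of_nat_Suc)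

section \<open>Pseudo-remainders that keep the sign of the dividend\<close>

text \<open>An even power of the leading coefficient stays positive under every specialisation into
  an ordered ring that does not kill this coefficient. Pseudo-division gives some power, and
  multiplying by the same power once more makes the exponent even.\<close>

lemma pseudo_remainder_even:
  fixes p d :: "'a::comm_ring_1 poly"
  assumes "d \<noteq> 0"
  shows "\<exists>N s r. smult (lead_coeff d ^ (2 * N)) p = d * s + r \<and> (r = 0 \<or> degree r < degree d)"
proof -
  let ?n = "1 + degree p - degree d" and ?c = "lead_coeff d"
  obtain q r where qr: "pseudo_divmod_main ?c 0 p d (degree p) ?n = (q, r)" by force
  have "(r = 0 \<or> degree r < degree d) \<and> smult (?c ^ ?n) (d * 0 + p) = d * q + r"
    by (rule pseudo_divmod_main[OF assms refl _ qr]) auto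
  then have e: "smult (?c ^ ?n) p = d * q + r" and r: "r = 0 \<or> degree r < degree d" by auto
  have "smult (?c ^ (2 * ?n)) p = smult (?c ^ ?n) (smult (?c ^ ?n) p)"
    by (simp add: mult_2 power_add)
  also have "\<dots> = d * smult (?c ^ ?n) q + smult (?c ^ ?n) r" unfolding e by (simp add: smult_add_right)
  finally have "smult (?c ^ (2 * ?n)) p = d * smult (?c ^ ?n) q + smult (?c ^ ?n) r" .
  moreover have "smult (?c ^ ?n) r = 0 \<or> degree (smult (?c ^ ?n) r) < degree d"
    using r degree_smult_le[of "?c ^ ?n" r] by auto
  ultimately show ?thesis by blast
qed

definition even_rem :: "'a::comm_ring_1 poly \<Rightarrow> 'a poly \<Rightarrow> 'a poly"
  where "even_rem p d = (SOME r. \<exists>N s. smult (lead_coeff d ^ (2 * N)) p = d * s + r \<and> (r = 0 \<or> degree r < degree d))"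

lemma even_rem:
  assumes "d \<noteq> 0"
  shows "\<exists>N s. smult (lead_coeff d ^ (2 * N)) p = d * s + even_rem p d"
    and "even_rem p d = 0 \<or> degree (even_rem p d) < degree d"
proof -
  have "\<exists>r N s. smult (lead_coeff d ^ (2 * N)) p = d * s + r \<and> (r = 0 \<or> degree r < degree d)"
    using pseudo_remainder_even[OF assms, of p] by blast
  from someI_ex[OF this]
  show "\<exists>N s. smult (lead_coeff d ^ (2 * N)) p = d * s + even_rem p d"
    and "even_rem p d = 0 \<or> degree (even_rem p d) < degree d"
    unfolding even_rem_def by blast+
qed

lemma sg_even_rem:
  fixes \<phi> :: "'r::comm_ring_1 \<Rightarrow> 'a::linordered_idom"
  assumes \<phi>: "rhom \<phi>" and lc: "\<phi> (lead_coeff d) \<noteq> 0" and z: "poly (map_poly \<phi> d) z = 0"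
  shows "sg (poly (map_poly \<phi> p) z) = sg (poly (map_poly \<phi> (even_rem p d)) z)"
proof -
  note [simp] = rhom_0[OF \<phi>]
  have "d \<noteq> 0" using lc by auto
  from even_rem(1)[OF this] obtain N s where "smult (lead_coeff d ^ (2 * N)) p = d * s + even_rem p d" by blast
  then have "map_poly \<phi> (smult (lead_coeff d ^ (2 * N)) p) = map_poly \<phi> (d * s + even_rem p d)" by simp
  then have "smult (\<phi> (lead_coeff d) ^ (2 * N)) (map_poly \<phi> p)
      = map_poly \<phi> d * map_poly \<phi> s + map_poly \<phi> (even_rem p d)"
    by (simp add: rhom_add[OF rhom_map_poly[OF \<phi>]] rhom_mult[OF rhom_map_poly[OF \<phi>]]
      map_poly_smult rhom_mult[OF \<phi>] rhom_power[OF \<phi>])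
  then have "poly (smult (\<phi> (lead_coeff d) ^ (2 * N)) (map_poly \<phi> p)) z
      = poly (map_poly \<phi> d * map_poly \<phi> s + map_poly \<phi> (even_rem p d)) z"
    by simp
  then have "\<phi> (lead_coeff d) ^ (2 * N) * poly (map_poly \<phi> p) z = poly (map_poly \<phi> (even_rem p d)) z"
    using z by simp
  then show ?thesis using sg_even_power_mult[OF lc] by metis
qed

text \<open>Elimination of one variable in semantic form: the signs of the finitely many ring
  elements in \<open>S\<close> fix the sign diagram of \<P> up to matching, for all pairs of
  specialisations. The two \<open>itself\<close> arguments name the target fields, which occur in no
  other argument.\<close>

definition determined_by :: "('r::comm_ring_1 \<Rightarrow> 'a::rcf) itself \<Rightarrow> ('r \<Rightarrow> 'b::rcf) itself \<Rightarrow> 'r poly set \<Rightarrow> 'r set \<Rightarrow> bool"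
  where "determined_by _ _ \<P> S \<longleftrightarrow> finite S \<and>
    (\<forall>(\<phi> :: 'r \<Rightarrow> 'a) (\<psi> :: 'r \<Rightarrow> 'b). rhom \<phi> \<longrightarrow> rhom \<psi> \<longrightarrow> (\<forall>s\<in>S. sg (\<phi> s) = sg (\<psi> s)) \<longrightarrow>
      (\<exists>H. sign_diagram \<P> (map_poly \<phi>) (map_poly \<psi>) H))"

text \<open>Hoermander's elimination: a polynomial \<open>p\<close> of maximal degree is traded for its derivative and
  its remainders modulo the other polynomials. The degrees of the specialisations of the latter are not
  known in advance, so all their truncations are used.\<close>

lemma determined_by_step:
  fixes p :: "'r::comm_ring_1 poly" and \<Q> :: "'r poly set"
  defines "\<Q>' \<equiv> insert (formal_deriv p) \<Q>"
  defines "trunc \<equiv> (\<lambda>q k. poly_cutoff (Suc k) q)"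
  defines "\<R> \<equiv> {even_rem p (trunc q k) | q k. q \<in> \<Q>' \<and> k \<le> degree q \<and> coeff q k \<noteq> 0}"
  assumes fin: "finite \<Q>" and deg: "degree p > 0"
    and S1: "determined_by TYPE('r \<Rightarrow> 'a::rcf) TYPE('r \<Rightarrow> 'b::rcf) (insert (p - monom (lead_coeff p) (degree p)) \<Q>) S1"
    and S2: "determined_by TYPE('r \<Rightarrow> 'a) TYPE('r \<Rightarrow> 'b) (\<Q>' \<union> \<R>) S2"
  shows "\<exists>S. determined_by TYPE('r \<Rightarrow> 'a) TYPE('r \<Rightarrow> 'b) (insert p \<Q>) S"
proof -
  let ?c = "lead_coeff p"
  \<comment> \<open>The leading coefficient of \<open>p\<close> separates the two cases, served by
    \<open>S1\<close> and \<open>S2\<close>. The coefficients of the divisors tell which of them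
    vanish, and so the degrees after specialisation.\<close>
  define S where "S = insert ?c (S1 \<union> S2 \<union> (\<Union>q\<in>\<Q>'. set (coeffs q)))"
  have finQ: "finite \<Q>'" using fin by (simp add: \<Q>'_def)
  have finS: "finite S" using S1 S2 finQ by (auto simp: S_def determined_by_def)
  have "\<exists>H. sign_diagram (insert p \<Q>) (map_poly \<phi>) (map_poly \<psi>) H"
    if \<phi>: "rhom \<phi>" and \<psi>: "rhom \<psi>" and s: "\<forall>s\<in>S. sg (\<phi> s) = sg (\<psi> s)"
    for \<phi> :: "'r \<Rightarrow> 'a" and \<psi> :: "'r \<Rightarrow> 'b"
  proof -
    note [simp] = rhom_0[OF \<phi>] rhom_0[OF \<psi>]
    have sc: "sg (\<phi> ?c) = sg (\<psi> ?c)" using s by (simp add: S_def)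
    show ?thesis
    proof (cases "\<phi> ?c = 0")
      case True
      then have \<psi>c: "\<psi> ?c = 0" using sc by (metis sg_eq_0_iff)
      let ?p = "p - monom ?c (degree p)"
      obtain H where H: "sign_diagram (insert ?p \<Q>) (map_poly \<phi>) (map_poly \<psi>) H"
        using S1 \<phi> \<psi> s unfolding determined_by_def S_def by blast
      have "map_poly \<phi> ?p = map_poly \<phi> p" "map_poly \<psi> ?p = map_poly \<psi> p"
        using True \<psi>c by (simp_all add: rhom_diff[OF rhom_map_poly] \<phi> \<psi> map_poly_monom)
      then have "sign_diagram (insert p \<Q>) (map_poly \<phi>) (map_poly \<psi>) H"
        using H unfolding sign_diagram_def zeros_def by simp
      then show ?thesis by blast
    next
      case False
      then have \<psi>c: "\<psi> ?c \<noteq> 0" using sc by (metis sg_eq_0_iff)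
      obtain H1 where H1: "sign_diagram (\<Q>' \<union> \<R>) (map_poly \<phi>) (map_poly \<psi>) H1"
        using S2 \<phi> \<psi> s unfolding determined_by_def S_def by blast
      define H where "H = {(z, w) \<in> H1. z \<in> zeros \<Q>' (map_poly \<phi>)}"
      have H: "sign_diagram \<Q>' (map_poly \<phi>) (map_poly \<psi>) H"
        unfolding H_def using sign_diagram_subset[OF H1] by blast
      note D = sign_diagramD[OF H]
      have degs: "degree (map_poly \<phi> p) = degree p" "degree (map_poly \<psi> p) = degree p"
        using False \<psi>c by (simp_all add: map_poly_degree_eq)
      have ends: "sg (poly (map_poly \<phi> p) z) = sg (poly (map_poly \<psi> p) w)" if zw: "(z, w) \<in> H" for z w
      proof -
        have "z \<in> zeros \<Q>' (map_poly \<phi>)" using zw by (simp add: H_def)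
        then obtain q where q: "q \<in> \<Q>'" "map_poly \<phi> q \<noteq> 0" "poly (map_poly \<phi> q) z = 0"
          by (auto simp: zeros_def)
        have qw: "poly (map_poly \<psi> q) w = 0"
          using D(6)[OF D(4)[OF zw] q(1)] q(3) by simp
        \<comment> \<open>Both specialisations kill the same coefficients of \<open>q\<close>, so
          the truncation at \<open>k\<close> becomes \<open>q\<close> under either one, and its
          leading coefficient survives in both fields. The remainder modulo it therefore has the
          sign of \<open>p\<close> at \<open>z\<close> and at \<open>w\<close>.\<close>
        define k where "k = degree (map_poly \<phi> q)"
        have ck: "\<phi> (coeff q k) \<noteq> 0" using q(2) by (simp add: k_def coeff_map_poly flip: leading_coeff_0_iff)
        have s_co: "sg (\<phi> (coeff q i)) = sg (\<psi> (coeff q i))" for i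
        proof (cases "coeff q i = 0")
          case False
          then have "q \<noteq> 0" "i \<le> degree q" by (auto intro: le_degree)
          then have "coeff q i \<in> set (coeffs q)" by (rule coeff_in_coeffs)
          then show ?thesis using s q(1) by (auto simp: S_def)
        qed simp
        have ck': "\<psi> (coeff q k) \<noteq> 0" using ck s_co[of k] by (metis sg_eq_0_iff)
        have cq: "coeff q k \<noteq> 0" using ck by auto
        define d where "d = trunc q k"
        have cd: "coeff d i = (if i \<le> k then coeff q i else 0)" for i
          by (auto simp: d_def trunc_def coeff_poly_cutoff)
        have degd: "degree d = k"
          by (rule antisym[OF degree_le le_degree]) (auto simp: cd cq)
        have lc: "lead_coeff d = coeff q k" by (simp add: degd cd)
        have d0: "d \<noteq> 0" using lc cq by auto
        have "\<phi> (coeff q i) = 0" if "i > k" for i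
          using coeff_eq_0[of "map_poly \<phi> q" i] that by (simp add: k_def coeff_map_poly)
        then have md: "map_poly \<phi> d = map_poly \<phi> q"
          by (intro poly_eqI) (auto simp: coeff_map_poly cd)
        have "\<psi> (coeff q i) = 0" if "i > k" for i
          using s_co[of i] \<open>\<And>i. i > k \<Longrightarrow> \<phi> (coeff q i) = 0\<close>[OF that] by (metis sg_eq_0_iff)
        then have md': "map_poly \<psi> d = map_poly \<psi> q"
          by (intro poly_eqI) (auto simp: coeff_map_poly cd)
        define r where "r = even_rem p d"
        have "r \<in> \<R>" unfolding \<R>_def r_def d_def using q(1) cq by (auto intro: le_degree)
        have "sg (poly (map_poly \<phi> p) z) = sg (poly (map_poly \<phi> r) z)"
          unfolding r_def by (rule sg_even_rem[OF \<phi>]) (use lc ck md q(3) in auto)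
        moreover have "sg (poly (map_poly \<psi> p) w) = sg (poly (map_poly \<psi> r) w)"
          unfolding r_def by (rule sg_even_rem[OF \<psi>]) (use lc ck' md' qw in auto)
        moreover have "matched H1 z w" using sign_diagramD(4)[OF H1] zw by (simp add: H_def)
        then have "sg (poly (map_poly \<phi> r) z) = sg (poly (map_poly \<psi> r) w)"
          using sign_diagramD(6)[OF H1] \<open>r \<in> \<R>\<close> by blast
        ultimately show ?thesis by simp
      qed
      interpret diagram_step \<Q>' "map_poly \<phi>" "map_poly \<psi>" H "map_poly \<phi> p" "map_poly \<psi> p" "formal_deriv p"
        using H finQ ends deg degs sc
        by unfold_locales (auto simp: \<Q>'_def map_poly_formal_deriv \<phi> \<psi> coeff_map_poly)
      have "sign_diagram (insert p \<Q>') (map_poly \<phi>) (map_poly \<psi>) H'"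
        by (rule sign_diagram_insert) auto
      moreover have "insert p \<Q> \<subseteq> insert p \<Q>'" by (auto simp: \<Q>'_def)
      ultimately show ?thesis using sign_diagram_subset by blast
    qed
  qed
  then show ?thesis using finS unfolding determined_by_def by blast
qed

lemma determined_by_constants:
  fixes \<P> :: "'r::comm_ring_1 poly set"
  assumes fin: "finite \<P>" and deg: "\<And>p. p \<in> \<P> \<Longrightarrow> degree p = 0"
  shows "\<exists>S. determined_by TYPE('r \<Rightarrow> 'a::rcf) TYPE('r \<Rightarrow> 'b::rcf) \<P> S"
proof -
  have "sign_diagram \<P> (map_poly \<phi>) (map_poly \<psi>) {}"
    if \<phi>: "rhom \<phi>" and \<psi>: "rhom \<psi>" and s: "\<forall>s\<in>(\<lambda>p. coeff p 0) ` \<P>. sg (\<phi> s) = sg (\<psi> s)"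
    for \<phi> :: "'r \<Rightarrow> 'a" and \<psi> :: "'r \<Rightarrow> 'b"
  proof -
    note [simp] = rhom_0[OF \<phi>] rhom_0[OF \<psi>]
    have c: "map_poly \<phi> p = [:\<phi> (coeff p 0):]" "map_poly \<psi> p = [:\<psi> (coeff p 0):]"
      "sg (\<phi> (coeff p 0)) = sg (\<psi> (coeff p 0))" if "p \<in> \<P>" for p
    proof -
      have "degree p = 0" using deg that by blast
      then obtain a where "p = [:a:]" by (rule degree_eq_zeroE)
      then show "map_poly \<phi> p = [:\<phi> (coeff p 0):]" "map_poly \<psi> p = [:\<psi> (coeff p 0):]"
        by (simp_all add: map_poly_pCons)
      show "sg (\<phi> (coeff p 0)) = sg (\<psi> (coeff p 0))" using s that by simp
    qed
    show ?thesis
    proof (rule sign_diagramI)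
      show "fst ` {} = zeros \<P> (map_poly \<phi>)" "snd ` {} = zeros \<P> (map_poly \<psi>)"
        using c by (auto simp: zeros_def)
      show "map_poly \<phi> p = 0 \<longleftrightarrow> map_poly \<psi> p = 0" if "p \<in> \<P>" for p
        using c[OF that] by (metis pCons_eq_0_iff sg_eq_0_iff)
      show "sg (poly (map_poly \<phi> p) t) = sg (poly (map_poly \<psi> p) t')" if "p \<in> \<P>" for t t' p
        using c[OF that] by simp
    qed auto
  qed
  then show ?thesis using fin unfolding determined_by_def by blast
qed

text \<open>Induction on a degree bound and, inside, on the number of members of the top degree. One
  elimination step removes such a member and adds only polynomials of lower degree: \<open>p\<close>
  without its leading term, its derivative, and remainders modulo divisors of at most the top
  degree.\<close>

theorem sign_diagram_determined:
  fixes \<P> :: "'r::comm_ring_1 poly set"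
  assumes "finite \<P>"
  shows "\<exists>S. determined_by TYPE('r \<Rightarrow> 'a::rcf) TYPE('r \<Rightarrow> 'b::rcf) \<P> S"
proof -
  have main: "\<exists>S. determined_by TYPE('r \<Rightarrow> 'a) TYPE('r \<Rightarrow> 'b) \<P> S"
    if "finite \<P>" "\<And>p. p \<in> \<P> \<Longrightarrow> degree p \<le> m" for \<P> :: "'r poly set" and m
    using that
  proof (induction m arbitrary: \<P>)
    case 0
    then show ?case by (intro determined_by_constants) auto
  next
    case (Suc m)
    note outer = Suc.IH
    show ?case
      using Suc.prems
    proof (induction "card {p \<in> \<P>. degree p = Suc m}" arbitrary: \<P>)
      case 0
      then have "{p \<in> \<P>. degree p = Suc m} = {}" by simp
      then have "degree p \<le> m" if "p \<in> \<P>" for p using 0(3)[OF that] that by fastforce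
      then show ?case using outer 0(2) by blast
    next
      case (Suc k)
      let ?top = "\<lambda>\<P>. {p \<in> \<P>. degree p = Suc m}"
      have ft: "finite (?top \<P>)" using Suc.prems by simp
      obtain p where p: "p \<in> \<P>" "degree p = Suc m"
        using Suc.hyps(2) by (metis (mono_tags, lifting) card.empty empty_Collect_eq nat.distinct(1))
      define \<Q> where "\<Q> = \<P> - {p}"
      have topQ: "card (?top \<Q>) = k"
      proof -
        have "?top \<Q> = ?top \<P> - {p}" by (auto simp: \<Q>_def)
        then show ?thesis using Suc.hyps(2) p ft by simp
      qed
      have IH: "\<exists>S. determined_by TYPE('r \<Rightarrow> 'a) TYPE('r \<Rightarrow> 'b) (\<Q> \<union> \<R>) S"
        if "finite \<R>" "\<And>r. r \<in> \<R> \<Longrightarrow> degree r \<le> m" for \<R>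
      proof (rule Suc.hyps(1))
        have "?top (\<Q> \<union> \<R>) = ?top \<Q>" using that(2) by fastforce
        then show "k = card (?top (\<Q> \<union> \<R>))" using topQ by simp
        show "finite (\<Q> \<union> \<R>)" using that Suc.prems by (simp add: \<Q>_def)
        show "degree q \<le> Suc m" if "q \<in> \<Q> \<union> \<R>" for q
          using that \<open>\<And>r. r \<in> \<R> \<Longrightarrow> degree r \<le> m\<close> Suc.prems(2) by (auto simp: \<Q>_def intro: le_SucI)
      qed
      have "degree (p - monom (lead_coeff p) (degree p)) \<le> m"
        by (rule degree_le) (auto simp: p(2) coeff_eq_0 less_Suc_eq_le dest!: Suc_leI simp: le_less)
      then obtain S1 where S1: "determined_by TYPE('r \<Rightarrow> 'a) TYPE('r \<Rightarrow> 'b)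
          (insert (p - monom (lead_coeff p) (degree p)) \<Q>) S1"
        using IH[of "{p - monom (lead_coeff p) (degree p)}"] by auto
      let ?Q' = "insert (formal_deriv p) \<Q>"
      let ?R = "{even_rem p (poly_cutoff (Suc k) q) | q k. q \<in> ?Q' \<and> k \<le> degree q \<and> coeff q k \<noteq> 0}"
      have finQ: "finite ?Q'" using Suc.prems by (simp add: \<Q>_def)
      have "?R \<subseteq> (\<lambda>(q, k). even_rem p (poly_cutoff (Suc k) q)) ` (SIGMA q:?Q'. {..degree q})" by auto
      moreover have "finite (SIGMA q:?Q'. {..degree q})" using finQ by (intro finite_SigmaI) auto
      ultimately have finR: "finite ?R" by (meson finite_imageI finite_subset)
      have dp: "degree (formal_deriv p) \<le> m"
        by (rule degree_le) (simp add: coeff_formal_deriv p(2) coeff_eq_0)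
      have dR: "degree r \<le> m" if r: "r \<in> ?R" for r
      proof -
        obtain q k where q: "r = even_rem p (poly_cutoff (Suc k) q)" "q \<in> ?Q'" "k \<le> degree q" "coeff q k \<noteq> 0"
          using r by blast
        have "coeff (poly_cutoff (Suc k) q) k \<noteq> 0" using q(4) by (simp add: coeff_poly_cutoff)
        then have "poly_cutoff (Suc k) q \<noteq> 0" by auto
        then have "r = 0 \<or> degree r < degree (poly_cutoff (Suc k) q)" using even_rem(2) q(1) by blast
        moreover have "degree (poly_cutoff (Suc k) q) \<le> k" by (rule degree_le) (simp add: coeff_poly_cutoff)
        moreover have "degree q \<le> Suc m" using q(2) dp Suc.prems(2) by (auto simp: \<Q>_def)
        ultimately show ?thesis using q(3) by auto
      qed
      obtain S2 where S2: "determined_by TYPE('r \<Rightarrow> 'a) TYPE('r \<Rightarrow> 'b) (?Q' \<union> ?R) S2"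
      proof -
        have "\<exists>S. determined_by TYPE('r \<Rightarrow> 'a) TYPE('r \<Rightarrow> 'b) (\<Q> \<union> insert (formal_deriv p) ?R) S"
          by (rule IH) (use finR dp dR in auto)
        then show ?thesis using that by auto
      qed
      have "\<exists>S. determined_by TYPE('r \<Rightarrow> 'a) TYPE('r \<Rightarrow> 'b) (insert p \<Q>) S"
        by (rule determined_by_step[OF _ _ S1 S2]) (use Suc.prems p in \<open>auto simp: \<Q>_def\<close>)
      moreover have "insert p \<Q> = \<P>" using p by (auto simp: \<Q>_def)
      ultimately show ?case by simp
    qed
  qed
  show ?thesis
    by (rule main[OF assms, of "Max (insert 0 (degree ` \<P>))"]) (use assms in simp)
qed

subsection \<open>Real closures\<close>

definition diffs :: "'k::field set \<Rightarrow> 'k set"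
  where "diffs P = {a - b | a b. a \<in> P \<and> b \<in> P}"

text \<open>\<open>P\<close> is the set of nonnegative elements of a possibly partial order on the
  subfield of its differences. As the cone determines the subfield, Zorn's lemma runs over single
  sets, and a larger cone may have a larger subfield.\<close>

locale ordcone =
  fixes P :: "'k::field set"
  assumes oc: "0 \<in> P \<and> 1 \<in> P \<and> (\<forall>a\<in>P. \<forall>b\<in>P. a + b \<in> P \<and> a * b \<in> P \<and> (a - b)\<^sup>2 \<in> P) \<and>
    (\<forall>a\<in>P. inverse a \<in> P) \<and> - 1 \<notin> P"
begin

abbreviation K where "K \<equiv> diffs P"

lemma P0: "0 \<in> P" and P1: "1 \<in> P" and P_add: "a \<in> P \<Longrightarrow> b \<in> P \<Longrightarrow> a + b \<in> P"
  and P_mult: "a \<in> P \<Longrightarrow> b \<in> P \<Longrightarrow> a * b \<in> P" and P_inv: "a \<in> P \<Longrightarrow> inverse a \<in> P" and m1: "- 1 \<notin> P"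
  using oc by auto

lemma KI: "a \<in> P \<Longrightarrow> b \<in> P \<Longrightarrow> a - b \<in> K"
  by (auto simp: diffs_def)

lemma KE: assumes "x \<in> K" obtains a b where "x = a - b" "a \<in> P" "b \<in> P"
  using assms by (auto simp: diffs_def)

lemma P_K: "a \<in> P \<Longrightarrow> a \<in> K"
  using KI[of a 0] P0 by simp

lemma K0: "0 \<in> K" and K1: "1 \<in> K"
  using P_K P0 P1 by auto

lemma K_add: assumes "x \<in> K" "y \<in> K" shows "x + y \<in> K"
proof -
  obtain a b where x: "x = a - b" "a \<in> P" "b \<in> P" using assms(1) by (rule KE)
  obtain c d where y: "y = c - d" "c \<in> P" "d \<in> P" using assms(2) by (rule KE)
  have e: "x + y = (a + c) - (b + d)" by (simp add: x(1) y(1))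
  show ?thesis unfolding e by (intro KI P_add x y)
qed

lemma K_uminus: assumes "x \<in> K" shows "- x \<in> K"
proof -
  obtain a b where "x = a - b" "a \<in> P" "b \<in> P" using assms by (rule KE)
  then show ?thesis using KI[of b a] by simp
qed

lemma K_diff: "x \<in> K \<Longrightarrow> y \<in> K \<Longrightarrow> x - y \<in> K"
  using K_add[of x "- y"] K_uminus by simp

lemma K_mult: assumes "x \<in> K" "y \<in> K" shows "x * y \<in> K"
proof -
  obtain a b where x: "x = a - b" "a \<in> P" "b \<in> P" using assms(1) by (rule KE)
  obtain c d where y: "y = c - d" "c \<in> P" "d \<in> P" using assms(2) by (rule KE)
  have e: "x * y = (a * c + b * d) - (a * d + b * c)" by (simp add: x(1) y(1) algebra_simps)
  show ?thesis unfolding e by (intro KI P_add P_mult x y)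
qed

lemma K_square: assumes "x \<in> K" shows "x\<^sup>2 \<in> P"
  using assms oc by (auto simp: diffs_def)

lemma K_inverse: assumes "x \<in> K" shows "inverse x \<in> K"
proof -
  have "inverse x = x * inverse (x\<^sup>2)" by (cases "x = 0") (simp_all add: power2_eq_square)
  then show ?thesis using K_mult[OF assms P_K[OF P_inv[OF K_square[OF assms]]]] by simp
qed

lemma K_divide: "x \<in> K \<Longrightarrow> y \<in> K \<Longrightarrow> x / y \<in> K"
  using K_mult K_inverse by (simp add: divide_inverse)

lemma K_sum: "(\<And>i. i \<in> A \<Longrightarrow> f i \<in> K) \<Longrightarrow> sum f A \<in> K"
  by (induction A rule: infinite_finite_induct) (auto simp: K0 K_add)

lemma K_power: "x \<in> K \<Longrightarrow> x ^ n \<in> K"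
  by (induction n) (auto simp: K1 K_mult)

lemma antisym: assumes "a \<in> P" "- a \<in> P" shows "a = 0"
proof (rule ccontr)
  assume "a \<noteq> 0"
  then have "(- a) * inverse a = - 1" by simp
  then show False using m1 P_mult[OF assms(2) P_inv[OF assms(1)]] by simp
qed

lemma one_plus_neq_0: "a \<in> P \<Longrightarrow> 1 + a \<noteq> 0"
  using m1 by (auto simp: add_eq_0_iff)

section \<open>Polynomials over the subfield of differences\<close>

definition Kpoly :: "'k poly \<Rightarrow> bool"
  where "Kpoly p \<longleftrightarrow> (\<forall>i. coeff p i \<in> K)"

lemma Kpoly_0: "Kpoly 0" and Kpoly_1: "Kpoly 1"
  by (auto simp: Kpoly_def K0 K1 coeff_1)

lemma Kpoly_add: "Kpoly p \<Longrightarrow> Kpoly q \<Longrightarrow> Kpoly (p + q)"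
  and Kpoly_diff: "Kpoly p \<Longrightarrow> Kpoly q \<Longrightarrow> Kpoly (p - q)"
  and Kpoly_uminus: "Kpoly p \<Longrightarrow> Kpoly (- p)"
  and Kpoly_mult: "Kpoly p \<Longrightarrow> Kpoly q \<Longrightarrow> Kpoly (p * q)"
  and Kpoly_smult: "c \<in> K \<Longrightarrow> Kpoly p \<Longrightarrow> Kpoly (smult c p)"
  and Kpoly_monom: "c \<in> K \<Longrightarrow> Kpoly (monom c n)"
  unfolding Kpoly_def by (simp_all add: K0 K_add K_diff K_mult K_uminus coeff_mult K_sum)

lemma Kpoly_linear: "a \<in> K \<Longrightarrow> b \<in> K \<Longrightarrow> Kpoly [:a, b:]"
  by (auto simp: Kpoly_def coeff_pCons K0 split: nat.split)

lemma Kpoly_eval: "Kpoly p \<Longrightarrow> x \<in> K \<Longrightarrow> poly p x \<in> K"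
  unfolding Kpoly_def poly_altdef by (intro K_sum K_mult K_power) auto

lemma Kpoly_divide:
  assumes "Kpoly f" "Kpoly g" "g \<noteq> 0"
  shows "\<exists>q r. Kpoly q \<and> Kpoly r \<and> f = g * q + r \<and> (r = 0 \<or> degree r < degree g)"
  using assms(1)
proof (induction "degree f" arbitrary: f rule: less_induct)
  case less
  show ?case
  proof (cases "f = 0 \<or> degree f < degree g")
    case True
    then show ?thesis using less.prems Kpoly_0 by (intro exI[of _ 0] exI[of _ f]) auto
  next
    case False
    define b where "b = monom (lead_coeff f / lead_coeff g) (degree f - degree g)"
    have b: "Kpoly b" unfolding b_def
      using less.prems assms(2) by (intro Kpoly_monom K_divide) (auto simp: Kpoly_def)
    define f' where "f' = f - g * b"
    have f': "Kpoly f'" unfolding f'_def using less.prems assms(2) b by (intro Kpoly_diff Kpoly_mult)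
    have "coeff (g * b) (degree f) = lead_coeff f"
      using False assms(3) by (simp add: b_def mult.commute[of g] coeff_monom_mult)
    then have c0: "coeff f' (degree f) = 0" by (simp add: f'_def)
    have "degree (g * b) \<le> degree g + (degree f - degree g)"
      by (rule order.trans[OF degree_mult_le]) (simp add: b_def degree_monom_le)
    then have "degree f' \<le> degree f" unfolding f'_def using False by (intro degree_diff_le) auto
    then have "f' = 0 \<or> degree f' < degree f" using c0 by (rule eq_zero_or_degree_less)
    then obtain q r where qr: "Kpoly q" "Kpoly r" "f' = g * q + r" "r = 0 \<or> degree r < degree g"
    proof
      assume "f' = 0"
      then show ?thesis using that[of 0 0] Kpoly_0 by simp
    next
      assume "degree f' < degree f"
      then show ?thesis using less.hyps f' that by blast
    qed
    have "f = g * (q + b) + r" using qr(3) by (simp add: f'_def algebra_simps)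
    then show ?thesis using qr b Kpoly_add by blast
  qed
qed

text \<open>Sums of squares weighted by elements of \<open>P\<close>. Their values at a root
  \<theta> are the candidate for a larger cone in \<open>root_in_K\<close>.\<close>

inductive_set sos :: "'k poly set" where
  zero: "0 \<in> sos"
| add: "s \<in> sos \<Longrightarrow> c \<in> P \<Longrightarrow> Kpoly f \<Longrightarrow> s + smult c (f\<^sup>2) \<in> sos"

lemma sos_single: "c \<in> P \<Longrightarrow> Kpoly f \<Longrightarrow> smult c (f\<^sup>2) \<in> sos"
  using sos.add[OF sos.zero] by simp

lemma sos_plus: assumes "s \<in> sos" "t \<in> sos" shows "s + t \<in> sos"
  using assms(2) by (induction) (use assms(1) in \<open>auto simp: add.assoc[symmetric] intro: sos.add\<close>)

lemma sos_mult_single: assumes "s \<in> sos" "c \<in> P" "Kpoly f" shows "s * smult c (f\<^sup>2) \<in> sos"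
  using assms(1)
proof induction
  case (add s d g)
  have "(s + smult d (g\<^sup>2)) * smult c (f\<^sup>2) = s * smult c (f\<^sup>2) + smult (d * c) ((g * f)\<^sup>2)"
    by (simp add: algebra_simps power_mult_distrib)
  then show ?case using add assms by (auto intro: sos.add P_mult Kpoly_mult)
qed (simp add: sos.zero)

lemma sos_mult: assumes "s \<in> sos" "t \<in> sos" shows "s * t \<in> sos"
  using assms(2)
proof induction
  case (add t c f)
  then show ?case using sos_plus sos_mult_single[OF assms(1)] by (simp add: distrib_left)
qed (simp add: sos.zero)

lemma sos_Kpoly: "s \<in> sos \<Longrightarrow> Kpoly s"
  by (induction rule: sos.induct)
     (auto simp: Kpoly_0 power2_eq_square intro!: Kpoly_add Kpoly_smult Kpoly_mult P_K)

lemma sos_eval: assumes "s \<in> sos" "x \<in> K" shows "poly s x \<in> P"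
  using assms(1) by induction (auto simp: P0 assms K_square Kpoly_eval intro!: P_add P_mult)

lemma sos_reduce:
  assumes p: "Kpoly p" "p \<noteq> 0" and "s \<in> sos"
  shows "\<exists>s' k. s' \<in> sos \<and> Kpoly k \<and> s = s' + p * k \<and> degree s' \<le> 2 * (degree p - 1)"
  using assms(3)
proof induction
  case zero
  then show ?case using sos.zero Kpoly_0 by (intro exI[of _ 0]) auto
next
  case (add s c f)
  obtain s' k where s': "s' \<in> sos" "Kpoly k" "s = s' + p * k" "degree s' \<le> 2 * (degree p - 1)"
    using add.IH by blast
  obtain q r where qr: "Kpoly q" "Kpoly r" "f = p * q + r" "r = 0 \<or> degree r < degree p"
    using Kpoly_divide[OF add(3) p] by blast
  have "f\<^sup>2 = r\<^sup>2 + p * (q * (f + r))" by (simp add: qr(3) power2_eq_square algebra_simps)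
  then have "s + smult c (f\<^sup>2) = (s' + smult c (r\<^sup>2)) + p * (k + smult c (q * (f + r)))"
    by (simp add: s'(3) smult_add_right algebra_simps)
  moreover have "s' + smult c (r\<^sup>2) \<in> sos" using s' add(2) qr by (auto intro: sos.add)
  moreover have "Kpoly (k + smult c (q * (f + r)))"
    using s' qr add by (intro Kpoly_add Kpoly_smult Kpoly_mult P_K)
  moreover have "degree (s' + smult c (r\<^sup>2)) \<le> 2 * (degree p - 1)"
  proof (rule degree_add_le[OF s'(4)])
    have "degree r \<le> degree p - 1" using qr(4) by auto
    moreover have "degree (smult c (r\<^sup>2)) \<le> degree r * 2"
      using degree_smult_le degree_power_le order.trans by blast
    ultimately show "degree (smult c (r\<^sup>2)) \<le> 2 * (degree p - 1)" by linarith
  qed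
  ultimately show ?case by blast
qed

text \<open>Opposite nonzero signs, expressed through the product because \<open>P\<close> need not
  compare every element of \<open>K\<close> with \<open>0\<close>.\<close>

definition opp :: "'k \<Rightarrow> 'k \<Rightarrow> bool"
  where "opp x y \<longleftrightarrow> - (x * y) \<in> P \<and> x * y \<noteq> 0"

lemma opp_self: "x \<in> K \<Longrightarrow> \<not> opp x x"
  using K_square[of x] antisym[of "x * x"] unfolding opp_def power2_eq_square by blast

lemma opp_transfer:
  assumes "opp x y" "x * u \<in> P" "x * u \<noteq> 0" "y * v \<in> P" "y * v \<noteq> 0" "x \<in> K" "y \<in> K"
  shows "opp u v"
proof -
  have e: "- (u * v) = (x * u) * (y * v) * (- (x * y)) * inverse ((x * y)\<^sup>2)"
    using assms by (simp add: power2_eq_square field_simps)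
  have "(x * y)\<^sup>2 \<in> P" using K_square K_mult assms by blast
  moreover have "- (x * y) \<in> P" using assms(1) by (simp add: opp_def)
  ultimately have "- (u * v) \<in> P" unfolding e by (intro P_mult P_inv assms(2,4))
  then show ?thesis using assms by (simp add: opp_def)
qed

text \<open>After reducing the squares modulo \<open>p\<close>, the cofactor of \<open>p\<close> changes sign as well and has
  smaller degree.\<close>

lemma no_sos_multiple:
  assumes "Kpoly p" "a \<in> K" "b \<in> K" "opp (poly p a) (poly p b)" "s \<in> sos" "Kpoly h"
  shows "1 + s \<noteq> p * h"
  using assms(1,4,5,6)
proof (induction "degree p" arbitrary: p s h rule: less_induct)
  case less
  show ?case
  proof
    assume e: "1 + s = p * h"
    have p0: "p \<noteq> 0" using less.prems(2) by (auto simp: opp_def)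
    have "degree p \<noteq> 0"
    proof
      assume "degree p = 0"
      then obtain c where "p = [:c:]" by (rule degree_eq_zeroE)
      moreover have "c \<in> K" using Kpoly_eval[OF less.prems(1) assms(2)] calculation by simp
      ultimately show False using less.prems(2) opp_self by simp
    qed
    obtain s' k where s': "s' \<in> sos" "Kpoly k" "s = s' + p * k" "degree s' \<le> 2 * (degree p - 1)"
      using sos_reduce[OF less.prems(1) p0 less.prems(3)] by blast
    define h' where "h' = h - k"
    have e': "1 + s' = p * h'" using e s'(3) by (simp add: h'_def algebra_simps)
    have Kh': "Kpoly h'" unfolding h'_def using less.prems(4) s'(2) by (rule Kpoly_diff)
    \<comment> \<open>On \<open>K\<close> the product of \<open>p\<close> and \<open>h'\<close> is
      \<open>1\<close> plus an element of \<open>P\<close>, so \<open>h'\<close> agrees in sign with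
      \<open>p\<close> and inherits the change between \<open>a\<close> and \<open>b\<close> through
      \<open>opp_transfer\<close>.\<close>
    have *: "poly p x * poly h' x \<in> P \<and> poly p x * poly h' x \<noteq> 0" if "x \<in> K" for x
    proof -
      have "poly p x * poly h' x = 1 + poly s' x" using arg_cong[OF e', of "\<lambda>q. poly q x"] by simp
      then show ?thesis using sos_eval[OF s'(1) that] P_add P1 one_plus_neq_0 by auto
    qed
    have "opp (poly h' a) (poly h' b)"
      using opp_transfer[OF less.prems(2)] * assms(2,3) Kpoly_eval[OF less.prems(1)] by blast
    moreover have "degree h' < degree p"
    proof -
      have "h' \<noteq> 0" using *[OF K0] by auto
      then have "degree p + degree h' = degree (1 + s')" using p0 by (simp add: e' degree_mult_eq)
      also have "\<dots> \<le> 2 * (degree p - 1)" using s'(4) by (intro degree_add_le) auto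
      finally show ?thesis using \<open>degree p \<noteq> 0\<close> by linarith
    qed
    moreover have "1 + s' = h' * p" using e' by (simp add: mult.commute)
    ultimately show False using less.hyps Kh' s'(1) less.prems(1) by blast
  qed
qed

text \<open>Euclid's algorithm, with minimality of the degree of \<open>p\<close> among the
  polynomials that annihilate \<theta> in place of irreducibility. From p = g s + r follows
  r(\<theta>) = - g(\<theta>) s(\<theta>), so an inverse for the smaller remainder yields one for
  \<open>g\<close>.\<close>

lemma inverse_in_adjoin:
  assumes p: "Kpoly p" "poly p \<theta> = 0" "p \<noteq> 0"
    and min: "\<And>f. Kpoly f \<Longrightarrow> poly f \<theta> = 0 \<Longrightarrow> f \<noteq> 0 \<Longrightarrow> degree p \<le> degree f"
    and g: "Kpoly g" "poly g \<theta> \<noteq> 0"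
  shows "\<exists>h. Kpoly h \<and> poly h \<theta> * poly g \<theta> = 1"
proof -
  have small: "\<exists>h. Kpoly h \<and> poly h \<theta> * poly g \<theta> = 1"
    if "Kpoly g" "poly g \<theta> \<noteq> 0" "degree g < degree p" for g
    using that
  proof (induction "degree g" arbitrary: g rule: less_induct)
    case less
    have g0: "g \<noteq> 0" using less.prems by auto
    obtain s r where sr: "Kpoly s" "Kpoly r" "p = g * s + r" "r = 0 \<or> degree r < degree g"
      using Kpoly_divide[OF p(1) less.prems(1) g0] by blast
    show ?case
    proof (cases "r = 0")
      case True
      then have ps: "p = g * s" using sr by simp
      then have "poly s \<theta> = 0" "s \<noteq> 0" using p less.prems(2) by auto
      then have "degree p \<le> degree s" using min sr by blast
      moreover have "degree p = degree g + degree s" using ps g0 \<open>s \<noteq> 0\<close> by (simp add: degree_mult_eq)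
      ultimately have "degree g = 0" by simp
      then obtain c where c: "g = [:c:]" by (rule degree_eq_zeroE)
      then have "c \<in> K" using Kpoly_eval[OF less.prems(1) K0] by simp
      then have "Kpoly [:inverse c:]" using Kpoly_linear[OF K_inverse K0] by simp
      then show ?thesis using c less.prems(2) by (intro exI[of _ "[:inverse c:]"]) simp
    next
      case False
      then have dr: "degree r < degree g" using sr by simp
      have "poly r \<theta> \<noteq> 0" using min[OF sr(2) _ False] dr less.prems(3) by linarith
      then obtain h where h: "Kpoly h" "poly h \<theta> * poly r \<theta> = 1"
        using less.hyps[OF dr sr(2)] dr less.prems(3) by auto
      have "poly r \<theta> = - poly g \<theta> * poly s \<theta>"
        using arg_cong[OF sr(3), of "\<lambda>q. poly q \<theta>"] p(2) by (simp add: eq_neg_iff_add_eq_0 add.commute)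
      then have "poly (- (h * s)) \<theta> * poly g \<theta> = 1" using h(2) by (simp add: algebra_simps)
      then show ?thesis using Kpoly_uminus[OF Kpoly_mult[OF h(1) sr(1)]] by blast
    qed
  qed
  obtain k r where kr: "Kpoly k" "Kpoly r" "g = p * k + r" "r = 0 \<or> degree r < degree p"
    using Kpoly_divide[OF g(1) p(1,3)] by blast
  have "poly g \<theta> = poly r \<theta>" using kr(3) p(2) by simp
  then show ?thesis using small[OF kr(2)] kr(4) g(2) by auto
qed

end

lemma ordconeI:
  assumes "0 \<in> P" "1 \<in> P" "\<And>a b. a \<in> P \<Longrightarrow> b \<in> P \<Longrightarrow> a + b \<in> P" "\<And>a b. a \<in> P \<Longrightarrow> b \<in> P \<Longrightarrow> a * b \<in> P"
    "\<And>a b. a \<in> P \<Longrightarrow> b \<in> P \<Longrightarrow> (a - b)\<^sup>2 \<in> P" "\<And>a. a \<in> P \<Longrightarrow> inverse a \<in> P" "- 1 \<notin> P"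
  shows "ordcone P"
  using assms unfolding ordcone_def by simp

section \<open>Maximal cones in an algebraically closed field\<close>

text \<open>Maximality is used twice: in \<open>total\<close> against a finer order on the same
  subfield, in \<open>root_in_K\<close> against an order on a subfield enlarged by a root.\<close>

locale max_ordcone = ordcone P for P :: "'k::alg_closed_field set" +
  assumes maximal: "\<And>Q. ordcone Q \<Longrightarrow> P \<subseteq> Q \<Longrightarrow> Q = P"
begin

text \<open>Otherwise P + P a is a larger cone inside \<open>K\<close>. It does not contain -1,
  since -1 = x + y a would give - a = (1 + x) / y, an element of \<open>P\<close>.\<close>

lemma total: assumes a: "a \<in> K" shows "a \<in> P \<or> - a \<in> P"
proof (rule ccontr)
  assume "\<not> ?thesis"
  then have n: "a \<notin> P" "- a \<notin> P" by auto
  define Q where "Q = {x + y * a | x y. x \<in> P \<and> y \<in> P}"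
  have QK: "z \<in> K" if "z \<in> Q" for z using that a P_K K_add K_mult by (auto simp: Q_def)
  have QI: "x + y * a \<in> Q" if "x \<in> P" "y \<in> P" for x y using that by (auto simp: Q_def)
  have PQ: "x \<in> Q" if "x \<in> P" for x using QI[OF that P0] by simp
  have Q_mult: "u * v \<in> Q" if u: "u \<in> Q" and v: "v \<in> Q" for u v
  proof -
    obtain x y x' y' where e: "u = x + y * a" "v = x' + y' * a" "x \<in> P" "y \<in> P" "x' \<in> P" "y' \<in> P"
      using u v by (auto simp: Q_def)
    have "u * v = (x * x' + y * y' * a\<^sup>2) + (x * y' + y * x') * a"
      by (simp add: e power2_eq_square algebra_simps)
    then show ?thesis using QI e K_square[OF a] P_add P_mult by metis
  qed
  have Q_m1: "- 1 \<notin> Q"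
  proof
    assume "- 1 \<in> Q"
    then obtain x y where xy: "- 1 = x + y * a" "x \<in> P" "y \<in> P" by (auto simp: Q_def)
    have "y \<noteq> 0" using xy m1 by auto
    then have "- a = (1 + x) * inverse y" using xy(1) by (simp add: field_simps) (metis add.commute add_eq_0_iff2 minus_add_cancel)
    then show False using n P_mult P_inv P_add P1 xy by simp
  qed
  have Q_add: "u + v \<in> Q" if "u \<in> Q" "v \<in> Q" for u v
  proof -
    obtain x y x' y' where e: "u = x + y * a" "v = x' + y' * a" "x \<in> P" "y \<in> P" "x' \<in> P" "y' \<in> P"
      using \<open>u \<in> Q\<close> \<open>v \<in> Q\<close> by (auto simp: Q_def)
    have "u + v = (x + x') + (y + y') * a" by (simp add: e algebra_simps)
    then show ?thesis using QI e P_add by metis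
  qed
  have Q_sq: "(u - v)\<^sup>2 \<in> Q" if "u \<in> Q" "v \<in> Q" for u v
    using QK that K_diff K_square PQ by blast
  have Q_inv: "inverse u \<in> Q" if u: "u \<in> Q" for u
  proof -
    have "inverse u = u * (inverse u)\<^sup>2" by (cases "u = 0") (simp_all add: power2_eq_square)
    then show ?thesis using Q_mult[OF u PQ[OF K_square[OF K_inverse[OF QK[OF u]]]]] by simp
  qed
  have "ordcone Q" by (rule ordconeI[OF PQ[OF P0] PQ[OF P1] Q_add Q_mult Q_sq Q_inv Q_m1])
  then have "Q = P" using maximal[of Q] PQ by blast
  then show False using QI[OF P0 P1] n by simp
qed

lemma opp_mult_cases:
  assumes "opp (x * u) (y * v)" "x \<in> K" "y \<in> K" "u \<in> K" "v \<in> K"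
  shows "opp x y \<or> opp u v"
proof (rule ccontr)
  assume n: "\<not> ?thesis"
  have nz: "x * y \<noteq> 0" "u * v \<noteq> 0" and neg: "- ((x * u) * (y * v)) \<in> P" using assms(1) by (auto simp: opp_def)
  have "x * y \<in> P" "u * v \<in> P" using n nz total[OF K_mult] assms by (auto simp: opp_def)
  then have "(x * u) * (y * v) \<in> P" using P_mult[of "x * y" "u * v"] by (simp add: algebra_simps)
  then have "(x * u) * (y * v) = 0" using neg by (rule antisym)
  then show False using nz by auto
qed

text \<open>If a root \<theta> of \<open>p\<close> is annihilated by a nonzero polynomial over
  \<open>K\<close> of smaller degree, \<open>p\<close> splits and one of the factors changes sign.
  Otherwise the values at \<theta> of the weighted sums of squares form a cone, as -1 is not among
  them by \<open>no_sos_multiple\<close>. Maximality identifies this cone with \<open>P\<close>,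
  which forces \<theta> into \<open>K\<close>.\<close>

lemma root_in_K:
  assumes "Kpoly p" "a \<in> K" "b \<in> K" "opp (poly p a) (poly p b)"
  shows "\<exists>c\<in>K. poly p c = 0"
  using assms(1,4)
proof (induction "degree p" arbitrary: p rule: less_induct)
  case less
  have p0: "p \<noteq> 0" using less.prems(2) by (auto simp: opp_def)
  have "degree p \<noteq> 0"
  proof
    assume "degree p = 0"
    then obtain c where "p = [:c:]" by (rule degree_eq_zeroE)
    moreover have "c \<in> K" using Kpoly_eval[OF less.prems(1) assms(2)] calculation by simp
    ultimately show False using less.prems(2) opp_self by simp
  qed
  then obtain \<theta> where \<theta>: "poly p \<theta> = 0" using alg_closed_imp_poly_has_root[of p] by auto
  define A where "A f \<longleftrightarrow> Kpoly f \<and> poly f \<theta> = 0 \<and> f \<noteq> 0" for f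
  define m where "m = (ARG_MIN degree f. A f)"
  have Am: "A m" and min: "\<And>f. A f \<Longrightarrow> degree m \<le> degree f"
    using arg_min_nat_lemma[of A p degree] \<theta> p0 less.prems(1) unfolding m_def A_def by auto
  show ?case
  proof (cases "degree m < degree p")
    case True
    obtain s r where sr: "Kpoly s" "Kpoly r" "p = m * s + r" "r = 0 \<or> degree r < degree m"
      using Kpoly_divide[of p m] less.prems(1) Am unfolding A_def by blast
    have "r = 0"
    proof (rule ccontr)
      assume "r \<noteq> 0"
      moreover have "poly r \<theta> = 0" using sr(3) \<theta> Am by (simp add: A_def)
      ultimately show False using min[of r] sr by (auto simp: A_def)
    qed
    then have ps: "p = m * s" using sr by simp
    have "degree m \<noteq> 0"
    proof
      assume "degree m = 0"
      then obtain c where "m = [:c:]" by (rule degree_eq_zeroE)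
      then show False using Am by (auto simp: A_def)
    qed
    moreover have "degree p = degree m + degree s" using ps p0 by (auto simp: degree_mult_eq)
    ultimately have ds: "degree s < degree p" by simp
    have Km: "Kpoly m" using Am by (simp add: A_def)
    have "opp (poly m a) (poly m b) \<or> opp (poly s a) (poly s b)"
      by (rule opp_mult_cases) (use less.prems(2) ps Kpoly_eval Km sr assms in auto)
    then show ?thesis using less.hyps[OF True Km] less.hyps[OF ds sr(1)] ps by auto
  next
    case False
    then have minp: "degree p \<le> degree f" if "Kpoly f" "poly f \<theta> = 0" "f \<noteq> 0" for f
      using min[of f] that by (auto simp: A_def)
    define Q where "Q = (\<lambda>s. poly s \<theta>) ` sos"
    have PQ: "c \<in> Q" if "c \<in> P" for c
      using sos_single[OF that Kpoly_1] by (force simp: Q_def)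
    have sqQ: "(poly f \<theta>)\<^sup>2 \<in> Q" if "Kpoly f" for f
      using sos_single[OF P1 that] by (force simp: Q_def)
    have Q_mult: "u * v \<in> Q" if "u \<in> Q" "v \<in> Q" for u v
      using that sos_mult by (force simp: Q_def simp flip: poly_mult)
    have Q_add: "u + v \<in> Q" if "u \<in> Q" "v \<in> Q" for u v
      using that sos_plus by (force simp: Q_def simp flip: poly_add)
    have Q_sq: "(u - v)\<^sup>2 \<in> Q" if "u \<in> Q" "v \<in> Q" for u v
    proof -
      obtain s t where st: "s \<in> sos" "t \<in> sos" "u = poly s \<theta>" "v = poly t \<theta>"
        using \<open>u \<in> Q\<close> \<open>v \<in> Q\<close> by (auto simp: Q_def)
      then show ?thesis using sqQ[OF Kpoly_diff[OF sos_Kpoly sos_Kpoly]] by simp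
    qed
    have Q_inv: "inverse u \<in> Q" if u: "u \<in> Q" for u
    proof (cases "u = 0")
      case True
      then show ?thesis using PQ[OF P0] by simp
    next
      case u0: False
      obtain s where s: "s \<in> sos" "u = poly s \<theta>" using u by (auto simp: Q_def)
      obtain h where h: "Kpoly h" "poly h \<theta> * poly s \<theta> = 1"
        using inverse_in_adjoin[OF less.prems(1) \<theta> p0 minp sos_Kpoly[OF s(1)]] s u0 by blast
      then have hu: "inverse u = poly h \<theta>" using s by (metis inverse_unique mult.commute)
      have "inverse u = u * (poly h \<theta>)\<^sup>2" using u0 by (simp add: power2_eq_square flip: hu)
      then show ?thesis using Q_mult[OF u sqQ[OF h(1)]] by simp
    qed
    have Q_m1: "- 1 \<notin> Q"
    proof
      assume "- 1 \<in> Q"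
      then obtain s where s: "s \<in> sos" "poly s \<theta> = - 1" by (force simp: Q_def)
      have K1s: "Kpoly (1 + s)" using Kpoly_add[OF Kpoly_1 sos_Kpoly[OF s(1)]] .
      obtain h r where hr: "Kpoly h" "Kpoly r" "1 + s = p * h + r" "r = 0 \<or> degree r < degree p"
        using Kpoly_divide[OF K1s less.prems(1) p0] by blast
      have "poly r \<theta> = 0" using arg_cong[OF hr(3), of "\<lambda>q. poly q \<theta>"] s(2) \<theta> by simp
      then have "r = 0" using minp[OF hr(2)] hr(4) by force
      then show False
        using no_sos_multiple[OF less.prems(1) assms(2,3) less.prems(2) s(1) hr(1)] hr(3) by simp
    qed
    have "ordcone Q" by (rule ordconeI[OF PQ[OF P0] PQ[OF P1] Q_add Q_mult Q_sq Q_inv Q_m1])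
    then have QP: "Q = P" using maximal[of Q] PQ by blast
    \<comment> \<open>The squares of \<theta> + 1 and \<theta> - 1 lie in \<open>Q\<close>, hence in
      \<open>P\<close>, and their difference is 4 \<theta>. So \<theta> is reached by halving twice
      within \<open>K\<close>.\<close>
    have two: "(2::'k) \<noteq> 0" using one_plus_neq_0[OF P1] by simp
    have "(\<theta> + 1)\<^sup>2 \<in> P" "(\<theta> - 1)\<^sup>2 \<in> P"
      using sqQ[OF Kpoly_linear[OF K1 K1]] sqQ[OF Kpoly_linear[OF K_uminus[OF K1] K1]]
      unfolding QP by (simp_all add: add.commute)
    then have "(\<theta> + 1)\<^sup>2 - (\<theta> - 1)\<^sup>2 \<in> K" by (rule KI)
    moreover have "(\<theta> + 1)\<^sup>2 - (\<theta> - 1)\<^sup>2 = 2 * (2 * \<theta>)" by (simp add: power2_eq_square algebra_simps)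
    ultimately have "2 * (2 * \<theta>) \<in> K" by simp
    moreover have K2: "2 \<in> K" using K_add[OF K1 K1] by simp
    ultimately have "2 * (2 * \<theta>) / 2 \<in> K" by (rule K_divide)
    then have "2 * \<theta> \<in> K" unfolding nonzero_mult_div_cancel_left[OF two] .
    then have "2 * \<theta> / 2 \<in> K" using K2 by (rule K_divide)
    then have "\<theta> \<in> K" unfolding nonzero_mult_div_cancel_left[OF two] .
    then show ?thesis using \<theta> by blast
  qed
qed

text \<open>A root \<open>c\<close> outside the interval is divided out. The factor X - c has the
  same sign at \<open>a\<close> and \<open>b\<close>, so the quotient, of smaller degree, still
  changes sign.\<close>

lemma ivt_in_K:
  assumes "Kpoly p" "a \<in> K" "b \<in> K" "b - a \<in> P" "opp (poly p a) (poly p b)"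
  shows "\<exists>c\<in>K. c - a \<in> P \<and> b - c \<in> P \<and> poly p c = 0"
  using assms(1,5)
proof (induction "degree p" arbitrary: p rule: less_induct)
  case less
  obtain c where c: "c \<in> K" "poly p c = 0" using root_in_K[OF less.prems(1) assms(2,3) less.prems(2)] by blast
  show ?case
  proof (cases "c - a \<in> P \<and> b - c \<in> P")
    case False
    have p0: "p \<noteq> 0" using less.prems(2) by (auto simp: opp_def)
    have nac: "a \<noteq> c" "b \<noteq> c" using less.prems(2) c by (auto simp: opp_def)
    have "[:- c, 1:] dvd p" using c(2) by (simp add: poly_eq_0_iff_dvd)
    obtain q r where qr: "Kpoly q" "Kpoly r" "p = [:- c, 1:] * q + r" "r = 0 \<or> degree r < degree [:- c, 1:]"
      using Kpoly_divide[OF less.prems(1) Kpoly_linear[OF K_uminus[OF c(1)] K1]] by auto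
    have "degree r = 0" using qr(4) by auto
    then obtain e where e: "r = [:e:]" by (rule degree_eq_zeroE)
    have "e = 0" using arg_cong[OF qr(3), of "\<lambda>q. poly q c"] c(2) e by simp
    then have pq: "p = [:- c, 1:] * q" using qr(3) e by simp
    then have "q \<noteq> 0" using p0 by auto
    then have "degree p = degree [:- c, 1:] + degree q" unfolding pq by (intro degree_mult_eq) auto
    then have dq: "degree q < degree p" by simp
    have "opp (a - c) (b - c) \<or> opp (poly q a) (poly q b)"
      by (rule opp_mult_cases) (use less.prems(2) pq Kpoly_eval qr(1) assms c K_diff in \<open>auto simp: algebra_simps\<close>)
    moreover have "\<not> opp (a - c) (b - c)"
    proof
      assume o: "opp (a - c) (b - c)"
      consider "c - a \<notin> P" | "b - c \<notin> P" using False by blast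
      then show False
      proof cases
        case 1
        then have ac: "a - c \<in> P" using total[OF K_diff[OF c(1) assms(2)]] by simp
        then have "b - c \<in> P" using P_add[OF assms(4) ac] by simp
        then have "(a - c) * (b - c) \<in> P" using ac P_mult by blast
        then show False using o antisym unfolding opp_def by blast
      next
        case 2
        then have cb: "c - b \<in> P" using total[OF K_diff[OF assms(3) c(1)]] by simp
        then have "c - a \<in> P" using P_add[OF assms(4) cb] by simp
        then have "(c - a) * (c - b) \<in> P" using cb P_mult by blast
        then have "(a - c) * (b - c) \<in> P" by (simp add: algebra_simps)
        then show False using o antisym unfolding opp_def by blast
      qed
    qed
    ultimately have "opp (poly q a) (poly q b)" by blast
    then show ?thesis using less.hyps[OF dq qr(1)] pq by auto
  qed (use c in blast)
qed

end

lemma max_ordcone_exists: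
  fixes B :: "'k::alg_closed_field set"
  assumes "ordcone B"
  shows "\<exists>P. max_ordcone P \<and> B \<subseteq> P"
proof -
  define A where "A = {P. ordcone P \<and> B \<subseteq> P}"
  have "\<exists>M\<in>A. \<forall>Q\<in>A. M \<subseteq> Q \<longrightarrow> Q = M"
  proof (rule subset_Zorn_nonempty)
    show "A \<noteq> {}" using assms by (auto simp: A_def)
    fix C assume C: "C \<noteq> {}" "subset.chain A C"
    then have CA: "\<And>P. P \<in> C \<Longrightarrow> ordcone P \<and> B \<subseteq> P" by (auto simp: subset.chain_def A_def)
    have two: "\<exists>P\<in>C. a \<in> P \<and> b \<in> P" if "a \<in> \<Union>C" "b \<in> \<Union>C" for a b
      using that subset_chain_def[of A C] C(2) by (metis UnionE subsetD)
    have "a + b \<in> \<Union>C \<and> a * b \<in> \<Union>C \<and> (a - b)\<^sup>2 \<in> \<Union>C" if "a \<in> \<Union>C" "b \<in> \<Union>C" for a b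
      using two[OF that] CA unfolding ordcone_def by blast
    moreover have "\<forall>a\<in>\<Union>C. inverse a \<in> \<Union>C" using CA unfolding ordcone_def by blast
    moreover have "- 1 \<notin> \<Union>C" "0 \<in> \<Union>C" "1 \<in> \<Union>C" "B \<subseteq> \<Union>C" using CA C(1) unfolding ordcone_def by blast+
    ultimately show "\<Union>C \<in> A" unfolding A_def ordcone_def by blast
  qed
  then obtain M where M: "M \<in> A" "\<And>Q. Q \<in> A \<Longrightarrow> M \<subseteq> Q \<Longrightarrow> Q = M" by blast
  have "ordcone M" using M by (simp add: A_def)
  then interpret ordcone M .
  have "max_ordcone M"
  proof
    show "Q = M" if "ordcone Q" "M \<subseteq> Q" for Q using M that by (auto simp: A_def)
  qed
  then show ?thesis using M by (auto simp: A_def)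
qed

section \<open>The real closure of an ordered field as a type\<close>

definition nonneg_image :: "'f::linordered_field alg_closure set"
  where "nonneg_image = to_ac ` {x. 0 \<le> x}"

lemma ordcone_nonneg_image: "ordcone (nonneg_image :: 'f::linordered_field alg_closure set)"
proof (rule ordconeI)
  show "0 \<in> (nonneg_image :: 'f alg_closure set)" "1 \<in> (nonneg_image :: 'f alg_closure set)"
    unfolding nonneg_image_def by (force intro: image_eqI[of _ _ 0] image_eqI[of _ _ 1])+
  show "- 1 \<notin> (nonneg_image :: 'f alg_closure set)"
  proof
    assume "- 1 \<in> (nonneg_image :: 'f alg_closure set)"
    then obtain x :: 'f where "0 \<le> x" "to_ac x = - 1" unfolding nonneg_image_def by auto
    then have "to_ac x = to_ac (- 1)" by simp
    then have "x = - 1" by (simp only: to_ac_eq_iff)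
    then show False using \<open>0 \<le> x\<close> by simp
  qed
  fix a b :: "'f alg_closure" assume "a \<in> nonneg_image" "b \<in> nonneg_image"
  then obtain x y where xy: "a = to_ac x" "b = to_ac y" "0 \<le> x" "0 \<le> y" unfolding nonneg_image_def by auto
  have "to_ac (x + y) \<in> nonneg_image" "to_ac (x * y) \<in> nonneg_image" "to_ac ((x - y)\<^sup>2) \<in> nonneg_image"
    unfolding nonneg_image_def using xy by (intro imageI; simp)+
  then show "a + b \<in> nonneg_image" "a * b \<in> nonneg_image" "(a - b)\<^sup>2 \<in> nonneg_image"
    by (simp_all add: xy)
next
  fix a :: "'f alg_closure" assume "a \<in> nonneg_image"
  then obtain x where x: "a = to_ac x" "0 \<le> x" unfolding nonneg_image_def by auto
  have "to_ac (inverse x) \<in> nonneg_image" unfolding nonneg_image_def using x by (intro imageI) simp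
  then show "inverse a \<in> nonneg_image" by (simp add: x)
qed

definition rc_cone :: "'f::linordered_field alg_closure set"
  where "rc_cone = (SOME P. max_ordcone P \<and> nonneg_image \<subseteq> P)"

lemma rc_cone: "max_ordcone rc_cone" "nonneg_image \<subseteq> rc_cone"
  using someI_ex[OF max_ordcone_exists[OF ordcone_nonneg_image]] unfolding rc_cone_def by auto

interpretation rc: max_ordcone "rc_cone :: 'f::linordered_field alg_closure set"
  by (rule rc_cone(1))

text \<open>The differences of a chosen maximal cone, ordered by that cone. They are made a type
  because transfer is stated for instances of \<open>rcf\<close>.\<close>

typedef (overloaded) 'f rc = "diffs (rc_cone :: 'f::linordered_field alg_closure set)"
  using rc.K0 by blast

setup_lifting type_definition_rc

instantiation rc :: (linordered_field) linordered_field
begin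

lift_definition zero_rc :: "'a rc" is 0 by (rule rc.K0)
lift_definition one_rc :: "'a rc" is 1 by (rule rc.K1)
lift_definition plus_rc :: "'a rc \<Rightarrow> 'a rc \<Rightarrow> 'a rc" is "(+)" by (rule rc.K_add)
lift_definition minus_rc :: "'a rc \<Rightarrow> 'a rc \<Rightarrow> 'a rc" is "(-)" by (rule rc.K_diff)
lift_definition uminus_rc :: "'a rc \<Rightarrow> 'a rc" is uminus by (rule rc.K_uminus)
lift_definition times_rc :: "'a rc \<Rightarrow> 'a rc \<Rightarrow> 'a rc" is "(*)" by (rule rc.K_mult)
lift_definition inverse_rc :: "'a rc \<Rightarrow> 'a rc" is inverse by (rule rc.K_inverse)
lift_definition divide_rc :: "'a rc \<Rightarrow> 'a rc \<Rightarrow> 'a rc" is "(/)" by (rule rc.K_divide)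
lift_definition less_eq_rc :: "'a rc \<Rightarrow> 'a rc \<Rightarrow> bool" is "\<lambda>a b. b - a \<in> rc_cone" .
definition less_rc :: "'a rc \<Rightarrow> 'a rc \<Rightarrow> bool" where "less_rc a b \<longleftrightarrow> a \<le> b \<and> \<not> b \<le> a"
definition abs_rc :: "'a rc \<Rightarrow> 'a rc" where "abs_rc a = (if a < 0 then - a else a)"
definition sgn_rc :: "'a rc \<Rightarrow> 'a rc" where "sgn_rc a = (if a = 0 then 0 else if 0 < a then 1 else - 1)"

instance
proof
  fix a b c :: "'a rc"
  show "a * b * c = a * (b * c)" "a * b = b * a" "1 * a = a" "a + b + c = a + (b + c)" "a + b = b + a"
    "0 + a = a" "- a + a = 0" "a - b = a + - b" "(a + b) * c = a * c + b * c" "inverse (0 :: 'a rc) = 0"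
    "a div b = a * inverse b" "a + b - a = b" "a - b - c = a - (b + c)" "0 * a = 0" "a * 0 = 0"
    by (transfer, simp add: algebra_simps divide_inverse; fail)+
  show "0 \<noteq> (1 :: 'a rc)" by transfer simp
  show "inverse a * a = 1" if "a \<noteq> 0" using that by transfer simp
  show "a < b \<longleftrightarrow> a \<le> b \<and> \<not> b \<le> a" by (rule less_rc_def)
  show "a \<le> a" by transfer (simp add: rc.P0)
  show "a \<le> c" if "a \<le> b" "b \<le> c"
    using that
  proof transfer
    fix a b c :: "'a alg_closure"
    assume "b - a \<in> rc_cone" "c - b \<in> rc_cone"
    then show "c - a \<in> rc_cone" using rc.P_add[of "b - a" "c - b"] by simp
  qed
  show anti: "a = b" if "a \<le> b" "b \<le> a" for a b :: "'a rc"
    using that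
  proof transfer
    fix a b :: "'a alg_closure"
    assume "b - a \<in> rc_cone" "a - b \<in> rc_cone"
    then show "a = b" using rc.antisym[of "b - a"] by simp
  qed
  show "a \<le> b \<or> b \<le> a"
  proof transfer
    fix a b :: "'a alg_closure"
    assume "a \<in> diffs rc_cone" "b \<in> diffs rc_cone"
    then show "b - a \<in> rc_cone \<or> a - b \<in> rc_cone" using rc.total[OF rc.K_diff, of b a] by simp
  qed
  show "c + a \<le> c + b" if "a \<le> b" using that by transfer simp
  show "c * a < c * b" if "a < b" "0 < c"
  proof -
    have le: "c * a \<le> c * b" if "a \<le> b" "0 \<le> c"
      using that
    proof transfer
      fix a b c :: "'a alg_closure"
      assume "b - a \<in> rc_cone" "c - 0 \<in> rc_cone"
      then show "c * b - c * a \<in> rc_cone" using rc.P_mult[of c "b - a"] by (simp add: right_diff_distrib)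
    qed
    have "c \<noteq> 0" "a \<noteq> b" using that by (auto simp: less_rc_def)
    then have "c * a \<noteq> c * b" by transfer simp
    then show ?thesis using le that anti[of "c * a" "c * b"] by (auto simp: less_rc_def)
  qed
  show "\<bar>a\<bar> = (if a < 0 then - a else a)" by (rule abs_rc_def)
  show "sgn a = (if a = 0 then 0 else if 0 < a then 1 else - 1)" by (rule sgn_rc_def)
qed

end

instance rc :: (linordered_field) rcf
proof
  fix a b :: "'a rc" and f :: "nat \<Rightarrow> 'a rc" and n :: nat
  define p where "p = (\<Sum>i\<le>n. monom (Rep_rc (f i)) i)"
  have Rep_sum: "Rep_rc (sum g A) = (\<Sum>i\<in>A. Rep_rc (g i))" for g :: "nat \<Rightarrow> 'a rc" and A
    by (induction A rule: infinite_finite_induct) (auto simp: zero_rc.rep_eq plus_rc.rep_eq)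
  have Rep_power: "Rep_rc (x ^ k) = Rep_rc x ^ k" for x :: "'a rc" and k
    by (induction k) (auto simp: one_rc.rep_eq times_rc.rep_eq)
  have ev: "poly p (Rep_rc x) = Rep_rc (\<Sum>i\<le>n. f i * x ^ i)" for x
    by (simp add: p_def poly_sum poly_monom Rep_sum Rep_power times_rc.rep_eq)
  have Kp: "rc.Kpoly p"
    unfolding p_def rc.Kpoly_def
    by (auto simp: coeff_sum Rep_rc rc.K0 intro!: rc.K_sum)
  have less: "x < y \<longleftrightarrow> Rep_rc y - Rep_rc x \<in> rc_cone \<and> x \<noteq> y" for x y :: "'a rc"
    using less_eq_rc.rep_eq[of x y] by (auto simp: order_less_le)
  assume ab: "a < b" and neg: "(\<Sum>i\<le>n. f i * a ^ i) < 0" and pos: "0 < (\<Sum>i\<le>n. f i * b ^ i)"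
  have "(\<Sum>i\<le>n. f i * a ^ i) * (\<Sum>i\<le>n. f i * b ^ i) < 0" using neg pos by (rule mult_neg_pos)
  then have "rc.opp (poly p (Rep_rc a)) (poly p (Rep_rc b))"
    unfolding rc.opp_def ev less by (auto simp: zero_rc.rep_eq times_rc.rep_eq Rep_rc_inject[symmetric])
  moreover have "Rep_rc b - Rep_rc a \<in> rc_cone" using ab less by blast
  ultimately obtain c where c: "c \<in> diffs rc_cone" "c - Rep_rc a \<in> rc_cone" "Rep_rc b - c \<in> rc_cone" "poly p c = 0"
    using rc.ivt_in_K[OF Kp Rep_rc Rep_rc] by blast
  define c' where "c' = Abs_rc c"
  have cc: "Rep_rc c' = c" unfolding c'_def using c(1) by (rule Abs_rc_inverse)
  have "Rep_rc (\<Sum>i\<le>n. f i * c' ^ i) = Rep_rc 0" using c(4) ev[of c'] cc by (simp add: zero_rc.rep_eq)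
  then have z: "(\<Sum>i\<le>n. f i * c' ^ i) = 0" by (simp only: Rep_rc_inject)
  then have "c' \<noteq> a" "c' \<noteq> b" using neg pos by auto
  then have "a < c'" "c' < b" using c cc less by auto
  then show "\<exists>c>a. c < b \<and> (\<Sum>i\<le>n. f i * c ^ i) = 0" using z by blast
qed

lemma to_ac_in_rc: "to_ac x \<in> diffs rc_cone" for x :: "'f::linordered_field"
proof (cases "0 \<le> x")
  case True
  then have "to_ac x \<in> rc_cone" using rc_cone(2) by (auto simp: nonneg_image_def)
  then show ?thesis by (rule rc.P_K)
next
  case False
  then have "to_ac (- x) \<in> nonneg_image" unfolding nonneg_image_def by (intro imageI) simp
  then have "to_ac (- x) \<in> rc_cone" using rc_cone(2) by blast
  then show ?thesis using rc.K_uminus[OF rc.P_K] by force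
qed

lift_definition to_rc :: "'f::linordered_field \<Rightarrow> 'f rc" is to_ac by (rule to_ac_in_rc)

lemma rhom_to_rc: "rhom to_rc"
  unfolding rhom_def by (intro conjI allI; transfer; simp)

lemma sg_to_rc: "sg (to_rc x) = sg x"
proof -
  have nn: "0 \<le> to_rc y" if "0 \<le> y" for y :: 'a
    using that by transfer (use rc_cone(2) in \<open>auto simp: nonneg_image_def\<close>)
  have nz: "to_rc y \<noteq> 0" if "y \<noteq> 0" for y :: 'a
    using that by transfer simp
  consider "x = 0" | "0 < x" | "x < 0" by fastforce
  then show ?thesis
  proof cases
    case 1
    then show ?thesis using rhom_0[OF rhom_to_rc] by simp
  next
    case 2
    then have "0 < to_rc x" using nn[of x] nz[of x] by (simp add: order_less_le)
    then show ?thesis using 2 by simp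
  next
    case 3
    then have "0 < to_rc (- x)" using nn[of "- x"] nz[of "- x"] by (simp add: order_less_le)
    then show ?thesis using 3 by (simp add: rhom_uminus[OF rhom_to_rc])
  qed
qed

subsection \<open>Evaluation of polynomials\<close>

text \<open>\<open>h\<close> acts on the coefficients and \<open>s\<close> replaces the variables.
  One notion covers real points, points over a real closed field, and the rewriting of a polynomial
  as one in a single variable.\<close>

definition ev :: "(real \<Rightarrow> 'r::comm_ring_1) \<Rightarrow> ('n::finite \<Rightarrow> 'r) \<Rightarrow> 'n rpoly \<Rightarrow> 'r"
  where "ev h s p = (\<Sum>\<alpha>\<in>Poly_Mapping.keys p. h (Poly_Mapping.lookup p \<alpha>) * (\<Prod>i\<in>UNIV. s i ^ Poly_Mapping.lookup \<alpha> i))"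

definition const :: "real \<Rightarrow> 'n::finite rpoly"
  where "const c = Poly_Mapping.single 0 c"

definition var :: "'n::finite \<Rightarrow> 'n rpoly"
  where "var i = Poly_Mapping.single (Poly_Mapping.single i 1) 1"

lemma ev_superset:
  assumes "h 0 = 0" "finite A" "Poly_Mapping.keys p \<subseteq> A"
  shows "ev h s p = (\<Sum>\<alpha>\<in>A. h (Poly_Mapping.lookup p \<alpha>) * (\<Prod>i\<in>UNIV. s i ^ Poly_Mapping.lookup \<alpha> i))"
  unfolding ev_def by (rule sum.mono_neutral_left) (use assms in \<open>auto simp: in_keys_iff\<close>)

lemma ev_add:
  assumes "rhom h"
  shows "ev h s (p + q) = ev h s p + ev h s q"
proof -
  let ?A = "Poly_Mapping.keys p \<union> Poly_Mapping.keys q"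
  have h0: "h 0 = 0" using assms by (rule rhom_0)
  show ?thesis
    using ev_superset[of h ?A p s] ev_superset[of h ?A q s]
      ev_superset[of h ?A "p + q" s] keys_add[of p q] h0
    by (simp add: lookup_add rhom_add[OF assms] distrib_right sum.distrib)
qed

lemma ev_0: "ev h s 0 = 0"
  by (simp add: ev_def)

lemma ev_sum: "rhom h \<Longrightarrow> ev h s (sum f A) = (\<Sum>x\<in>A. ev h s (f x))"
  by (induction A rule: infinite_finite_induct) (auto simp: ev_0 ev_add)

lemma ev_single:
  assumes "rhom h"
  shows "ev h s (Poly_Mapping.single \<alpha> c) = h c * (\<Prod>i\<in>UNIV. s i ^ Poly_Mapping.lookup \<alpha> i)"
  using ev_superset[of h "{\<alpha>}" "Poly_Mapping.single \<alpha> c" s] rhom_0[OF assms] by (simp split: if_splits)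

lemma rpoly_as_sum: "p = (\<Sum>\<alpha>\<in>Poly_Mapping.keys p. Poly_Mapping.single \<alpha> (Poly_Mapping.lookup p \<alpha>))"
  by (rule poly_mapping_eqI)
     (auto simp: lookup_sum lookup_single when_def sum.delta in_keys_iff)

lemma rhom_ev:
  assumes h: "rhom h"
  shows "rhom (ev h s)"
proof -
  have "ev h s 1 = 1"
    using ev_single[OF h, of s 0 1] by (simp add: rhom_1[OF h] single_one)
  moreover have "ev h s (p * q) = ev h s p * ev h s q" for p q
  proof -
    have "p * q = (\<Sum>\<alpha>\<in>Poly_Mapping.keys p. \<Sum>\<beta>\<in>Poly_Mapping.keys q.
        Poly_Mapping.single (\<alpha> + \<beta>) (Poly_Mapping.lookup p \<alpha> * Poly_Mapping.lookup q \<beta>))"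
      by (subst (1) rpoly_as_sum[of p], subst (1) rpoly_as_sum[of q]) (simp add: sum_product mult_single)
    then show ?thesis
      by (simp add: ev_sum[OF h] ev_single[OF h] rhom_mult[OF h] lookup_add power_add prod.distrib
        ev_def[of h s p] ev_def[of h s q] sum_product mult_ac)
  qed
  ultimately show ?thesis by (simp add: rhom_def ev_add[OF h])
qed

lemma rhom_const: "rhom const"
  by (simp add: rhom_def const_def single_add mult_single)

lemma rhom_id: "rhom id"
  by (simp add: rhom_def)

lemma ev_const: "rhom h \<Longrightarrow> ev h s (const c) = h c"
  by (simp add: const_def ev_single)

lemma ev_var: assumes "rhom h" shows "ev h s (var i) = s i"
proof -
  have "(\<Prod>j\<in>UNIV. s j ^ Poly_Mapping.lookup (Poly_Mapping.single i 1) j) = (\<Prod>j\<in>UNIV. if j = i then s j else 1)"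
    by (intro prod.cong) (auto simp: lookup_single when_def)
  then show ?thesis by (simp add: var_def ev_single[OF assms] rhom_1[OF assms])
qed

lemma rhom_of_ev: "rhom G \<Longrightarrow> G (ev h s p) = ev (\<lambda>c. G (h c)) (\<lambda>i. G (s i)) p"
  by (simp add: ev_def rhom_sum rhom_mult rhom_prod rhom_power)

lemma prod_single: "(\<Prod>i\<in>A. Poly_Mapping.single (f i) 1) = Poly_Mapping.single (\<Sum>i\<in>A. f i) (1 :: 'a::comm_semiring_1)"
  by (induction A rule: infinite_finite_induct) (auto simp: mult_single)

lemma single_power: "Poly_Mapping.single a (1 :: 'a::comm_semiring_1) ^ n = Poly_Mapping.single (\<Sum>_<n. a) 1"
  by (induction n) (auto simp: mult_single add.commute)

lemma ev_const_var: "ev const var p = p"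
proof -
  have "(\<Prod>i\<in>UNIV. (var i :: 'a rpoly) ^ Poly_Mapping.lookup \<alpha> i) = Poly_Mapping.single \<alpha> 1" for \<alpha>
  proof -
    have "(\<Sum>i\<in>UNIV. \<Sum>_<Poly_Mapping.lookup \<alpha> i. Poly_Mapping.single i 1) = \<alpha>"
      by (rule poly_mapping_eqI) (simp add: lookup_sum lookup_single when_def if_distrib sum.delta cong: if_cong)
    then show ?thesis by (simp add: var_def single_power prod_single)
  qed
  then show ?thesis
    by (simp add: ev_def const_def mult_single flip: rpoly_as_sum)
qed

text \<open>The universal property of the polynomial ring, obtained by applying \<open>G\<close> to
  \<open>ev const var p = p\<close>.\<close>

lemma rhom_eq_ev: "rhom G \<Longrightarrow> G p = ev (\<lambda>c. G (const c)) (\<lambda>i. G (var i)) p"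
  using rhom_of_ev[of G const var p] by (simp add: ev_const_var)

lemma poly_at_eq_ev: "poly_at p a = ev id (\<lambda>i. a $ i) p"
  by (simp add: poly_at_def ev_def monomial_at_def)

lemma rhom_poly_at: "rhom (\<lambda>p. poly_at p a)"
  unfolding poly_at_eq_ev by (rule rhom_ev[OF rhom_id])

subsection \<open>Transfer to the reals\<close>

text \<open>Induction on the number of coordinates outside \<open>\<real>\<close>. Eliminating such a coordinate \<open>v\<close> gives
  finitely many polynomials without \<open>v\<close>, so its value may be replaced by \<open>0\<close>.\<close>

theorem sign_transfer:
  fixes h :: "real \<Rightarrow> 'a::rcf" and x :: "'n::finite \<Rightarrow> 'a" and \<P> :: "'n rpoly set"
  assumes h: "rhom h" and sg_h: "\<And>c. sg (h c) = sg c" and "finite \<P>"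
  shows "\<exists>a::'n \<Rightarrow> real. \<forall>p\<in>\<P>. sg (ev h x p) = sg (ev id a p)"
  using assms(3)
proof (induction "card {i. x i \<notin> range h}" arbitrary: x \<P> rule: less_induct)
  case less
  show ?case
  proof (cases "\<forall>i. x i \<in> range h")
    case True
    then have "\<forall>i. \<exists>c. x i = h c" by blast
    then obtain a where a: "\<And>i. x i = h (a i)" by metis
    have "ev h x p = h (ev id a p)" for p
    proof -
      have "x = (\<lambda>i. h (a i))" using a by blast
      then show ?thesis using rhom_of_ev[OF h, of id a p] by simp
    qed
    then have "\<forall>p\<in>\<P>. sg (ev h x p) = sg (ev id a p)" by (simp add: sg_h)
    then show ?thesis by blast
  next
    case False
    then obtain v where v: "x v \<notin> range h" by blast
    \<comment> \<open>\<open>E p\<close> is \<open>p\<close> as a polynomial in \<open>v\<close>.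
      Its coefficients stay in the full polynomial ring, although \<open>v\<close> no longer occurs
      in them, so that the induction keeps one type of polynomials.\<close>
    define E :: "'n rpoly \<Rightarrow> 'n rpoly poly"
      where "E = ev (\<lambda>c. [:const c:]) (\<lambda>i. if i = v then [:0, 1:] else [:var i:])"
    have E: "poly (map_poly \<phi> (E p)) t = ev (\<lambda>c. \<phi> (const c)) (\<lambda>i. if i = v then t else \<phi> (var i)) p"
      if \<phi>: "rhom \<phi>" for \<phi> :: "'n rpoly \<Rightarrow> 'c::rcf" and p t
    proof -
      note [simp] = rhom_0[OF \<phi>] rhom_1[OF \<phi>]
      have hom: "rhom (\<lambda>q. poly (map_poly \<phi> q) t)"
        by (rule rhom_comp[OF rhom_poly_eval rhom_map_poly[OF \<phi>]])
      have "poly (map_poly \<phi> (if i = v then [:0, 1:] else [:var i:])) t = (if i = v then t else \<phi> (var i))" for i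
        by (simp add: map_poly_pCons)
      then show ?thesis unfolding E_def rhom_of_ev[OF hom] by (simp add: map_poly_pCons)
    qed
    obtain S where S: "determined_by TYPE('n rpoly \<Rightarrow> 'a) TYPE('n rpoly \<Rightarrow> real) (E ` \<P>) S"
      using sign_diagram_determined[of "E ` \<P>"] less.prems by blast
    define x' where "x' = x(v := 0)"
    have "{i. x' i \<notin> range h} \<subset> {i. x i \<notin> range h}"
    proof -
      have "0 \<in> range h" using rhom_0[OF h] by (metis rangeI)
      then show ?thesis using v by (auto simp: x'_def)
    qed
    then have "card {i. x' i \<notin> range h} < card {i. x i \<notin> range h}" by (intro psubset_card_mono) auto
    moreover have "finite S" using S by (simp add: determined_by_def)
    ultimately obtain a' where a': "\<And>p. p \<in> S \<Longrightarrow> sg (ev h x' p) = sg (ev id a' p)"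
      using less.hyps[of x' S] by blast
    define \<phi> where "\<phi> = ev h x'"
    define \<psi> where "\<psi> = ev id a'"
    have \<phi>: "rhom \<phi>" and \<psi>: "rhom \<psi>" unfolding \<phi>_def \<psi>_def using rhom_ev h rhom_id by blast+
    obtain H where H: "sign_diagram (E ` \<P>) (map_poly \<phi>) (map_poly \<psi>) H"
      using S \<phi> \<psi> a' unfolding determined_by_def \<phi>_def \<psi>_def by blast
    \<comment> \<open>The signs depend on \<open>x v\<close> only through its position among the
      zeros, so a real number in the corresponding position takes its place.\<close>
    obtain t where t: "matched H (x v) t" using matched_exists sign_diagramD(1,4)[OF H] by blast
    have "sg (ev h x p) = sg (ev id (a'(v := t)) p)" if "p \<in> \<P>" for p
    proof -
      have "sg (poly (map_poly \<phi> (E p)) (x v)) = sg (poly (map_poly \<psi> (E p)) t)"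
        using sign_diagramD(6)[OF H t] that by blast
      moreover have "(\<lambda>i. if i = v then x v else x' i) = x" by (auto simp: x'_def)
      moreover have "(\<lambda>i. if i = v then t else a' i) = a'(v := t)" by auto
      ultimately show ?thesis
        unfolding E[OF \<phi>] E[OF \<psi>] by (simp add: \<phi>_def \<psi>_def ev_const ev_var h rhom_id id_def[symmetric] cong: if_cong)
    qed
    then show ?thesis by blast
  qed
qed

subsection \<open>Prime cones\<close>

text \<open>A point of the real spectrum: an ordering of the residue domain modulo the support, the
  prime ideal of all \<open>a\<close> with \<open>a\<close> and \<open>- a\<close> in
  \<open>P\<close>.\<close>

definition prime_cone :: "'a::comm_ring_1 set \<Rightarrow> bool"
  where "prime_cone P \<longleftrightarrow> (\<forall>a\<in>P. \<forall>b\<in>P. a + b \<in> P \<and> a * b \<in> P) \<and> (\<forall>a. a \<in> P \<or> - a \<in> P) \<and> - 1 \<notin> P \<and>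
    (\<forall>a b. a * b \<in> P \<longrightarrow> - (a * b) \<in> P \<longrightarrow> (a \<in> P \<and> - a \<in> P) \<or> (b \<in> P \<and> - b \<in> P))"

definition cone_sg :: "'a::comm_ring_1 set \<Rightarrow> 'a \<Rightarrow> int"
  where "cone_sg P p = (if p \<in> P then if - p \<in> P then 0 else 1 else - 1)"

definition realized :: "'n::finite rpoly set \<Rightarrow> bool"
  where "realized P \<longleftrightarrow> (\<forall>\<P>. finite \<P> \<longrightarrow> (\<exists>a. \<forall>p\<in>\<P>. cone_sg P p = sg (poly_at p a)))"

text \<open>The ordered domain attached to a prime cone has to be a type. So it is only built for one
  cone, namely a counterexample to the theorem that every prime cone is realized, if there is one.\<close>

definition test_cone :: "'n::finite rpoly set"
  where "test_cone = (if \<exists>P :: 'n rpoly set. prime_cone P \<and> \<not> realized P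
    then SOME P. prime_cone P \<and> \<not> realized P else {p. 0 \<le> poly_at p 0})"

lemma prime_cone_at: "prime_cone {p. 0 \<le> poly_at p a}"
  unfolding prime_cone_def
  by (auto simp: rhom_add[OF rhom_poly_at] rhom_mult[OF rhom_poly_at] rhom_uminus[OF rhom_poly_at]
    rhom_1[OF rhom_poly_at])

lemma prime_cone_test_cone: "prime_cone (test_cone :: 'n::finite rpoly set)"
proof (cases "\<exists>P :: 'n rpoly set. prime_cone P \<and> \<not> realized P")
  case True
  from someI_ex[OF this] show ?thesis using True by (simp add: test_cone_def)
next
  case False
  then have "test_cone = {p :: 'n rpoly. 0 \<le> poly_at p 0}" unfolding test_cone_def by (simp only: if_False)
  then show ?thesis using prime_cone_at by metis
qed

lemma realized_if_test_cone:
  assumes "realized (test_cone :: 'n::finite rpoly set)" "prime_cone (P :: 'n rpoly set)"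
  shows "realized P"
proof (rule ccontr)
  assume "\<not> realized P"
  then have ex: "\<exists>P :: 'n rpoly set. prime_cone P \<and> \<not> realized P" using assms(2) by blast
  from someI_ex[OF this] have "\<not> realized (test_cone :: 'n rpoly set)" using ex by (simp add: test_cone_def)
  then show False using assms(1) by blast
qed

section \<open>The ordered residue domain of a prime cone\<close>

locale prime_cone_loc =
  fixes P :: "'a::comm_ring_1 set"
  assumes pc: "prime_cone P"
begin

lemma add: "a \<in> P \<Longrightarrow> b \<in> P \<Longrightarrow> a + b \<in> P" and mult: "a \<in> P \<Longrightarrow> b \<in> P \<Longrightarrow> a * b \<in> P"
  and total: "a \<in> P \<or> - a \<in> P" and m1: "- 1 \<notin> P"
  and prime: "a * b \<in> P \<Longrightarrow> - (a * b) \<in> P \<Longrightarrow> (a \<in> P \<and> - a \<in> P) \<or> (b \<in> P \<and> - b \<in> P)"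
  using pc unfolding prime_cone_def by blast+

lemma square: "a * a \<in> P"
  using total[of a] mult[of a a] mult[of "- a" "- a"] by auto

lemma one: "1 \<in> P" and zero: "0 \<in> P"
  using square[of 1] square[of 0] by auto

definition eqv :: "'a \<Rightarrow> 'a \<Rightarrow> bool"
  where "eqv a b \<longleftrightarrow> a - b \<in> P \<and> b - a \<in> P"

lemma eqv_equivp: "equivp eqv"
proof (rule equivpI)
  show "reflp eqv" by (rule reflpI) (simp add: eqv_def zero)
  show "symp eqv" by (rule sympI) (simp add: eqv_def)
  show "transp eqv"
  proof (rule transpI)
    fix a b c assume "eqv a b" "eqv b c"
    then show "eqv a c" using add[of "a - b" "b - c"] add[of "c - b" "b - a"] by (simp add: eqv_def)
  qed
qed

lemma eqv_add: "eqv a b \<Longrightarrow> eqv c d \<Longrightarrow> eqv (a + c) (b + d)"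
  using add[of "a - b" "c - d"] add[of "b - a" "d - c"] by (simp add: eqv_def algebra_simps)

lemma eqv_uminus: "eqv a b \<Longrightarrow> eqv (- a) (- b)"
  by (simp add: eqv_def)

lemma eqv_diff: "eqv a b \<Longrightarrow> eqv c d \<Longrightarrow> eqv (a - c) (b - d)"
  using eqv_add[of a b "- c" "- d"] eqv_uminus by simp

lemma ideal_mult: "a \<in> P \<Longrightarrow> - a \<in> P \<Longrightarrow> c * a \<in> P"
  using total[of c] mult[of c a] mult[of "- c" "- a"] by auto

lemma eqv_mult1: assumes "eqv a b" shows "eqv (c * a) (c * b)"
  using ideal_mult[of "a - b" c] ideal_mult[of "b - a" c] assms by (simp add: eqv_def right_diff_distrib)

lemma eqv_mult: assumes "eqv a b" "eqv c d" shows "eqv (a * c) (b * d)"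
proof -
  have "eqv (a * c) (a * d)" using assms(2) by (rule eqv_mult1)
  moreover have "eqv (a * d) (b * d)" using eqv_mult1[OF assms(1), of d] by (simp add: mult.commute)
  ultimately show ?thesis using equivp_transp[OF eqv_equivp] by blast
qed

lemma eqv_mem: assumes "eqv a b" "a \<in> P" shows "b \<in> P"
  using add[of a "b - a"] assms by (simp add: eqv_def)

end

interpretation tc: prime_cone_loc "test_cone :: 'n::finite rpoly set"
  by unfold_locales (rule prime_cone_test_cone)

\<comment> \<open>The residue ring modulo the support. It has no zero divisors because the support
  is prime, and its order is total because the cone is.\<close>
quotient_type (overloaded) 'n cone_ring = "'n::finite rpoly" / "tc.eqv"
  morphisms rep_cr mk_cr
  by (rule tc.eqv_equivp)

instantiation cone_ring :: (finite) linordered_idom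
begin

lift_definition zero_cone_ring :: "'a cone_ring" is 0 .
lift_definition one_cone_ring :: "'a cone_ring" is 1 .
lift_definition plus_cone_ring :: "'a cone_ring \<Rightarrow> 'a cone_ring \<Rightarrow> 'a cone_ring" is "(+)" by (rule tc.eqv_add)
lift_definition minus_cone_ring :: "'a cone_ring \<Rightarrow> 'a cone_ring \<Rightarrow> 'a cone_ring" is "(-)" by (rule tc.eqv_diff)
lift_definition uminus_cone_ring :: "'a cone_ring \<Rightarrow> 'a cone_ring" is uminus by (rule tc.eqv_uminus)
lift_definition times_cone_ring :: "'a cone_ring \<Rightarrow> 'a cone_ring \<Rightarrow> 'a cone_ring" is "(*)" by (rule tc.eqv_mult)
lift_definition less_eq_cone_ring :: "'a cone_ring \<Rightarrow> 'a cone_ring \<Rightarrow> bool" is "\<lambda>a b. b - a \<in> test_cone"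
  using tc.eqv_mem tc.eqv_diff equivp_symp[OF tc.eqv_equivp] by (metis (no_types, lifting))
definition less_cone_ring :: "'a cone_ring \<Rightarrow> 'a cone_ring \<Rightarrow> bool" where "less_cone_ring a b \<longleftrightarrow> a \<le> b \<and> \<not> b \<le> a"
definition abs_cone_ring :: "'a cone_ring \<Rightarrow> 'a cone_ring" where "abs_cone_ring a = (if a < 0 then - a else a)"
definition sgn_cone_ring :: "'a cone_ring \<Rightarrow> 'a cone_ring" where "sgn_cone_ring a = (if a = 0 then 0 else if 0 < a then 1 else - 1)"

instance
proof
  fix a b c :: "'a cone_ring"
  have refl: "tc.eqv p p" for p :: "'a rpoly" using equivp_reflp[OF tc.eqv_equivp] .
  show "a * b * c = a * (b * c)" "a * b = b * a" "1 * a = a" "a + b + c = a + (b + c)" "a + b = b + a"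
    "0 + a = a" "- a + a = 0" "a - b = a + - b" "(a + b) * c = a * c + b * c"
    "a + b - a = b" "a - b - c = a - (b + c)" "0 * a = 0" "a * 0 = 0"
    by (transfer, simp add: algebra_simps refl; fail)+
  show "0 \<noteq> (1 :: 'a cone_ring)" by transfer (simp add: tc.eqv_def tc.m1)
  show "a < b \<longleftrightarrow> a \<le> b \<and> \<not> b \<le> a" by (rule less_cone_ring_def)
  show "a \<le> a" by transfer (simp add: tc.zero)
  show "a \<le> c" if "a \<le> b" "b \<le> c"
    using that
  proof transfer
    fix a b c :: "'a rpoly"
    assume "b - a \<in> test_cone" "c - b \<in> test_cone"
    then show "c - a \<in> test_cone" using tc.add[of "b - a" "c - b"] by simp
  qed
  show anti: "a = b" if "a \<le> b" "b \<le> a" for a b :: "'a cone_ring"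
    using that by transfer (simp add: tc.eqv_def)
  show "a \<le> b \<or> b \<le> a"
  proof transfer
    fix a b :: "'a rpoly"
    show "b - a \<in> test_cone \<or> a - b \<in> test_cone" using tc.total[of "b - a"] by simp
  qed
  show "c + a \<le> c + b" if "a \<le> b" using that by transfer simp
  show "c * a < c * b" if "a < b" "0 < c"
  proof -
    have le: "c * a \<le> c * b" if "a \<le> b" "0 \<le> c"
      using that
    proof transfer
      fix a b c :: "'a rpoly"
      assume "b - a \<in> test_cone" "c - 0 \<in> test_cone"
      then show "c * b - c * a \<in> test_cone" using tc.mult[of c "b - a"] by (simp add: right_diff_distrib)
    qed
    have "c \<noteq> 0" "a \<noteq> b" using that by (auto simp: less_cone_ring_def)
    then have "c * a \<noteq> c * b"
    proof transfer
      fix a b c :: "'a rpoly"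
      assume "\<not> tc.eqv c 0" "\<not> tc.eqv a b"
      then show "\<not> tc.eqv (c * a) (c * b)"
        using tc.prime[of c "a - b"] by (auto simp: tc.eqv_def right_diff_distrib)
    qed
    then show ?thesis using le that anti[of "c * a" "c * b"] by (auto simp: less_cone_ring_def)
  qed
  show "\<bar>a\<bar> = (if a < 0 then - a else a)" by (rule abs_cone_ring_def)
  show "sgn a = (if a = 0 then 0 else if 0 < a then 1 else - 1)" by (rule sgn_cone_ring_def)
qed

end

definition cone_embed :: "'n::finite rpoly \<Rightarrow> 'n cone_ring fract rc"
  where "cone_embed p = to_rc (Fract (mk_cr p) 1)"

lemma rhom_cone_embed: "rhom (cone_embed :: 'n::finite rpoly \<Rightarrow> _)"
proof -
  have m: "rhom (mk_cr :: 'n rpoly \<Rightarrow> _)"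
    by (simp add: rhom_def one_cone_ring.abs_eq plus_cone_ring.abs_eq times_cone_ring.abs_eq)
  have f: "rhom (\<lambda>a :: 'n cone_ring. Fract a 1)"
    by (simp add: rhom_def One_fract_def)
  have "(cone_embed :: 'n rpoly \<Rightarrow> _) = (\<lambda>p. to_rc (Fract (mk_cr p) 1))"
    by (rule ext) (rule cone_embed_def)
  then show ?thesis using rhom_comp[OF rhom_to_rc rhom_comp[OF f m]] by simp
qed

lemma sg_cone_embed: "sg (cone_embed p) = cone_sg test_cone p"
proof -
  have "sg (Fract a 1) = sg a" for a :: "'n::finite cone_ring"
    by (simp add: sg_def zero_less_Fract_iff Fract_less_zero_iff)
  then have "sg (cone_embed p) = sg (mk_cr p)" by (simp add: cone_embed_def sg_to_rc)
  moreover have "0 \<le> mk_cr p \<longleftrightarrow> p \<in> test_cone" "mk_cr p \<le> 0 \<longleftrightarrow> - p \<in> test_cone"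
    unfolding zero_cone_ring.abs_eq by (simp_all add: less_eq_cone_ring.abs_eq)
  ultimately show ?thesis by (auto simp: sg_def cone_sg_def order_less_le)
qed

text \<open>The images of the variables form a point over the real closure at which each polynomial
  has the sign prescribed by the cone. Real constants keep their signs there, a positive real being
  the square of a real, so \<open>sign_transfer\<close> yields a point with real
  coordinates.\<close>

theorem prime_cone_realized:
  assumes "prime_cone (P :: 'n::finite rpoly set)"
  shows "realized P"
proof (rule realized_if_test_cone[OF _ assms])
  let ?h = "\<lambda>c. cone_embed (const c :: 'n rpoly)"
  have h: "rhom ?h" by (rule rhom_comp[OF rhom_cone_embed rhom_const])
  have pos: "sg (?h c) = 1" if "c > 0" for c
  proof -
    have "const c = const (sqrt c) * (const (sqrt c) :: 'n rpoly)"
      using that by (simp flip: rhom_mult[OF rhom_const])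
    then have "?h c = ?h (sqrt c) * ?h (sqrt c)" using rhom_mult[OF rhom_cone_embed] by metis
    moreover have "?h (sqrt c) \<noteq> 0"
    proof
      assume "?h (sqrt c) = 0"
      moreover have "?h (sqrt c) * ?h (1 / sqrt c) = 1"
        using rhom_mult[OF h, of "sqrt c" "1 / sqrt c"] rhom_1[OF h] that by simp
      ultimately show False by simp
    qed
    moreover have "sg (y * y) = 1" if "y \<noteq> 0" for y :: "'n cone_ring fract rc"
      using sg_cases[of y] that by (auto simp: sg_mult)
    ultimately show ?thesis by simp
  qed
  have sg_h: "sg (?h c) = sg c" for c
  proof (cases c "0 :: real" rule: linorder_cases)
    case less
    then show ?thesis using pos[of "- c"] rhom_uminus[OF h, of c] by simp
  qed (use pos rhom_0[OF h] in auto)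
  show "realized (test_cone :: 'n rpoly set)"
    unfolding realized_def
  proof (intro allI impI)
    fix \<P> :: "'n rpoly set" assume "finite \<P>"
    then obtain a :: "'n \<Rightarrow> real" where a: "\<And>p. p \<in> \<P> \<Longrightarrow> sg (ev ?h (\<lambda>i. cone_embed (var i)) p) = sg (ev id a p)"
      using sign_transfer[OF h sg_h] by blast
    have "cone_sg test_cone p = sg (poly_at p (\<chi> i. a i))" if "p \<in> \<P>" for p
      using a[OF that] by (simp add: poly_at_eq_ev sg_cone_embed flip: rhom_eq_ev[OF rhom_cone_embed])
    then show "\<exists>a. \<forall>p\<in>\<P>. cone_sg test_cone p = sg (poly_at p a)" by blast
  qed
qed

subsection \<open>Quadratic modules and preorderings\<close>

lemma sos_0: "0 \<in> sums_of_squares"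
  unfolding sums_of_squares_def by (auto intro!: exI[of _ "0 :: nat"])

lemma sos_add_square:
  assumes "s \<in> sums_of_squares"
  shows "s + c\<^sup>2 \<in> sums_of_squares"
proof -
  obtain N :: nat and q where s: "s = (\<Sum>j<N. (q j)\<^sup>2)" using assms by (auto simp: sums_of_squares_def)
  have "s + c\<^sup>2 = (\<Sum>j<Suc N. ((q(N := c)) j)\<^sup>2)" by (simp add: s)
  then show ?thesis unfolding sums_of_squares_def by blast
qed

lemma sos_induct [consumes 1, case_names zero add]:
  assumes "s \<in> sums_of_squares" "P 0" "\<And>s c. s \<in> sums_of_squares \<Longrightarrow> P s \<Longrightarrow> P (s + c\<^sup>2)"
  shows "P s"
proof -
  obtain N :: nat and q where s: "s = (\<Sum>j<N. (q j)\<^sup>2)" using assms by (auto simp: sums_of_squares_def)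
  have "(\<Sum>j<N. (q j)\<^sup>2) \<in> sums_of_squares \<and> P (\<Sum>j<N. (q j)\<^sup>2)"
    by (induction N) (use assms(2,3) sos_0 sos_add_square in auto)
  then show ?thesis using s by simp
qed

lemma sos_square: "c\<^sup>2 \<in> sums_of_squares"
  using sos_add_square[OF sos_0, of c] by simp

lemma sos_add:
  assumes "s \<in> sums_of_squares" "t \<in> sums_of_squares"
  shows "s + t \<in> sums_of_squares"
  using assms(2)
  by (induction t rule: sos_induct) (use assms(1) in \<open>auto simp: add.assoc[symmetric] intro: sos_add_square\<close>)

lemma sos_mult_square: "s \<in> sums_of_squares \<Longrightarrow> c\<^sup>2 * s \<in> sums_of_squares"
  by (induction s rule: sos_induct)
     (auto simp: sos_0 distrib_left simp flip: power_mult_distrib intro: sos_add_square)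

lemma sos_mult: "s \<in> sums_of_squares \<Longrightarrow> t \<in> sums_of_squares \<Longrightarrow> s * t \<in> sums_of_squares"
  by (induction s rule: sos_induct) (auto simp: sos_0 distrib_right intro: sos_add sos_mult_square)

lemma sos_1: "1 \<in> sums_of_squares"
  using sos_square[of 1] by simp

lemma sos_sum: "(\<And>i. i \<in> A \<Longrightarrow> f i \<in> sums_of_squares) \<Longrightarrow> sum f A \<in> sums_of_squares"
  by (induction A rule: infinite_finite_induct) (auto simp: sos_0 sos_add)

lemma sos_const: assumes "0 \<le> r" shows "const r \<in> sums_of_squares"
proof -
  have "const r = (const (sqrt r))\<^sup>2"
    using assms by (simp add: power2_eq_square flip: rhom_mult[OF rhom_const])
  then show ?thesis using sos_square by metis
qed

lemma poly_at_sos: "s \<in> sums_of_squares \<Longrightarrow> 0 \<le> poly_at s a"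
  by (induction s rule: sos_induct)
     (simp_all add: rhom_0[OF rhom_poly_at] rhom_add[OF rhom_poly_at] rhom_power[OF rhom_poly_at])

definition qmod :: "'n::finite rpoly set \<Rightarrow> bool"
  where "qmod M \<longleftrightarrow> 1 \<in> M \<and> (\<forall>a\<in>M. \<forall>b\<in>M. a + b \<in> M) \<and> (\<forall>s\<in>sums_of_squares. \<forall>a\<in>M. s * a \<in> M)"

lemma qmod_add: "qmod M \<Longrightarrow> a \<in> M \<Longrightarrow> b \<in> M \<Longrightarrow> a + b \<in> M"
  and qmod_mult: "qmod M \<Longrightarrow> s \<in> sums_of_squares \<Longrightarrow> a \<in> M \<Longrightarrow> s * a \<in> M"
  and qmod_1: "qmod M \<Longrightarrow> 1 \<in> M"
  by (auto simp: qmod_def)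

lemma qmod_sos: "qmod M \<Longrightarrow> s \<in> sums_of_squares \<Longrightarrow> s \<in> M"
  using qmod_mult[of M s 1] qmod_1[of M] by simp

lemma qmod_square: "qmod M \<Longrightarrow> c\<^sup>2 \<in> M"
  by (rule qmod_sos[OF _ sos_square])

lemma qmod_square_mult: "qmod M \<Longrightarrow> a \<in> M \<Longrightarrow> c\<^sup>2 * a \<in> M"
  by (rule qmod_mult[OF _ sos_square])

lemma qmod_const: "qmod M \<Longrightarrow> 0 \<le> r \<Longrightarrow> const r \<in> M"
  by (rule qmod_sos[OF _ sos_const])

lemma qmod_const_mult: "qmod M \<Longrightarrow> 0 \<le> r \<Longrightarrow> a \<in> M \<Longrightarrow> const r * a \<in> M"
  by (rule qmod_mult[OF _ sos_const])

lemma qmod_adjoin: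
  assumes "qmod M"
  shows "qmod {m + s * a | m s. m \<in> M \<and> s \<in> sums_of_squares}" (is "qmod ?M")
    and "M \<subseteq> {m + s * a | m s. m \<in> M \<and> s \<in> sums_of_squares}"
    and "a \<in> {m + s * a | m s. m \<in> M \<and> s \<in> sums_of_squares}"
proof -
  have I: "m + s * a \<in> ?M" if "m \<in> M" "s \<in> sums_of_squares" for m s using that by blast
  show sub: "M \<subseteq> ?M" using I[OF _ sos_0] by auto
  show "a \<in> ?M" using I[OF qmod_sos[OF assms sos_0] sos_1] by simp
  have "x + y \<in> ?M" if "x \<in> ?M" "y \<in> ?M" for x y
  proof -
    obtain m s n t where e: "x = m + s * a" "y = n + t * a" "m \<in> M" "n \<in> M" "s \<in> sums_of_squares" "t \<in> sums_of_squares"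
      using \<open>x \<in> ?M\<close> \<open>y \<in> ?M\<close> by blast
    have xy: "x + y = (m + n) + (s + t) * a" by (simp add: e algebra_simps)
    show ?thesis unfolding xy by (intro I qmod_add[OF assms] sos_add e)
  qed
  moreover have "t * x \<in> ?M" if x: "x \<in> ?M" and t: "t \<in> sums_of_squares" for x t
  proof -
    obtain m s where e: "x = m + s * a" "m \<in> M" "s \<in> sums_of_squares" using x by blast
    have tx: "t * x = t * m + (t * s) * a" by (simp add: e algebra_simps)
    show ?thesis unfolding tx by (intro I qmod_mult[OF assms] sos_mult e t)
  qed
  moreover have "1 \<in> ?M" using sub qmod_1[OF assms] by blast
  ultimately show "qmod ?M" unfolding qmod_def by blast
qed

text \<open>The algebraic archimedean property: modulo \<open>M\<close> every polynomial is bounded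
  above by a constant. In contrast, \<open>archimedean\<close> only asks for a compact set.\<close>

definition arch :: "'n::finite rpoly set \<Rightarrow> bool"
  where "arch M \<longleftrightarrow> (\<forall>a. \<exists>r. const r - a \<in> M)"

lemma arch_mono: "arch M \<Longrightarrow> M \<subseteq> M' \<Longrightarrow> arch M'"
  unfolding arch_def by blast

definition bounded_elts :: "'n::finite rpoly set \<Rightarrow> 'n rpoly set"
  where "bounded_elts M = {a. \<exists>r>0. const r - a \<in> M \<and> const r + a \<in> M}"

text \<open>A quadratic module need not be closed under products, so (e - a)(e + a) has to be
  reached with squares as multipliers. The sum on the left is 2 e times this product.\<close>

lemma bounded_identity:
  fixes e a :: "'a::comm_ring_1"
  shows "(e + a)\<^sup>2 * (e - a) + (e - a)\<^sup>2 * (e + a) = (e + e) * (e\<^sup>2 - a\<^sup>2)"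
  by (simp add: power2_eq_square algebra_simps)

lemma qmod_diff_squares:
  assumes M: "qmod M" and r: "r > 0" and a: "const r - a \<in> M" "const r + a \<in> M"
  shows "const (r\<^sup>2) - a\<^sup>2 \<in> M"
proof -
  have "(const r + a)\<^sup>2 * (const r - a) + (const r - a)\<^sup>2 * (const r + a) \<in> M"
    by (rule qmod_add[OF M qmod_square_mult[OF M a(1)] qmod_square_mult[OF M a(2)]])
  then have *: "const (2 * r) * (const (r\<^sup>2) - a\<^sup>2) \<in> M"
    unfolding bounded_identity by (simp add: rhom_power[OF rhom_const] flip: rhom_add[OF rhom_const])
  have "const (1 / (2 * r)) * (const (2 * r) * (const (r\<^sup>2) - a\<^sup>2)) \<in> M"
    by (rule qmod_const_mult[OF M _ *]) (use r in simp)
  moreover have "const (1 / (2 * r)) * const (2 * r) = (1 :: 'a rpoly)"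
    using r by (simp add: rhom_1[OF rhom_const] flip: rhom_mult[OF rhom_const])
  ultimately show ?thesis by (simp only: mult.assoc[symmetric] mult_1_left)
qed

text \<open>Polarisation, written with sums and negations only, so that closure under addition,
  negation, scaling and squares extends to products by applying these rules.\<close>

lemma quarter_squares:
  "a * b = const (1 / 4) * ((a + b)\<^sup>2 + - ((a + - b)\<^sup>2))"
proof -
  have "(a + b)\<^sup>2 + - ((a + - b)\<^sup>2) = (1 + 1 + 1 + 1) * (a * b)"
    by (simp add: power2_eq_square algebra_simps)
  moreover have "const (1 / 4) * (1 + 1 + 1 + 1) = (1 :: 'a rpoly)"
    by (simp add: rhom_1[OF rhom_const, symmetric] flip: rhom_add[OF rhom_const] rhom_mult[OF rhom_const])
  ultimately show ?thesis by (simp only: mult.assoc[symmetric] mult_1_left)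
qed

lemma bounded_subring:
  assumes M: "qmod M"
  shows bounded_add: "a \<in> bounded_elts M \<Longrightarrow> b \<in> bounded_elts M \<Longrightarrow> a + b \<in> bounded_elts M"
    and bounded_uminus: "a \<in> bounded_elts M \<Longrightarrow> - a \<in> bounded_elts M"
    and bounded_const: "const c \<in> bounded_elts M"
    and bounded_mult: "a \<in> bounded_elts M \<Longrightarrow> b \<in> bounded_elts M \<Longrightarrow> a * b \<in> bounded_elts M"
proof -
  show add: "a + b \<in> bounded_elts M" if ab: "a \<in> bounded_elts M" "b \<in> bounded_elts M" for a b
  proof -
    obtain r where r: "r > 0" "const r - a \<in> M" "const r + a \<in> M" using ab(1) by (auto simp: bounded_elts_def)
    obtain s where s: "s > 0" "const s - b \<in> M" "const s + b \<in> M" using ab(2) by (auto simp: bounded_elts_def)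
    have "(const r - a) + (const s - b) \<in> M" "(const r + a) + (const s + b) \<in> M"
      using r s by (auto intro: qmod_add[OF M])
    then show ?thesis
      unfolding bounded_elts_def using r(1) s(1)
      by (intro CollectI exI[of _ "r + s"]) (simp add: rhom_add[OF rhom_const] algebra_simps)
  qed
  show uminus: "- a \<in> bounded_elts M" if "a \<in> bounded_elts M" for a
    using that by (auto simp: bounded_elts_def)
  show const: "const c \<in> bounded_elts M" for c
    unfolding bounded_elts_def
    by (intro CollectI exI[of _ "\<bar>c\<bar> + 1"])
       (auto intro!: qmod_const[OF M] simp flip: rhom_add[OF rhom_const] rhom_diff[OF rhom_const])
  have scale: "const c * a \<in> bounded_elts M" if a: "a \<in> bounded_elts M" and c: "c > 0" for c a
  proof -
    obtain r where r: "r > 0" "const r - a \<in> M" "const r + a \<in> M" using a by (auto simp: bounded_elts_def)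
    have "const c * (const r - a) \<in> M" "const c * (const r + a) \<in> M"
      by (rule qmod_const_mult[OF M _ r(2)] qmod_const_mult[OF M _ r(3)], use c in simp)+
    then show ?thesis
      unfolding bounded_elts_def using r(1) c
      by (intro CollectI exI[of _ "c * r"]) (simp add: rhom_mult[OF rhom_const] algebra_simps)
  qed
  have square: "a\<^sup>2 \<in> bounded_elts M" if a: "a \<in> bounded_elts M" for a
  proof -
    obtain r where r: "r > 0" "const r - a \<in> M" "const r + a \<in> M" using a by (auto simp: bounded_elts_def)
    have "const (r\<^sup>2) + a\<^sup>2 \<in> M" by (intro qmod_add[OF M] qmod_const[OF M] qmod_square[OF M]) simp
    then show ?thesis
      unfolding bounded_elts_def using r(1) qmod_diff_squares[OF M r]
      by (intro CollectI exI[of _ "r\<^sup>2"]) simp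
  qed
  show "a * b \<in> bounded_elts M" if "a \<in> bounded_elts M" "b \<in> bounded_elts M" for a b
    unfolding quarter_squares[of a b]
    by (intro scale add uminus square that) simp
qed

text \<open>The bounded elements form a subring containing the constants, so it is enough to bound
  each variable.\<close>

lemma arch_if_ball:
  assumes M: "qmod M" and c: "const c - (\<Sum>i\<in>UNIV. (var i)\<^sup>2) \<in> M"
  shows "arch M"
proof -
  have v: "var i \<in> bounded_elts M" for i
  proof -
    have "(const c - (\<Sum>i\<in>UNIV. (var i)\<^sup>2)) + (\<Sum>j\<in>UNIV - {i}. (var j)\<^sup>2) \<in> M"
      by (intro qmod_add[OF M] c qmod_sos[OF M] sos_sum sos_square)
    moreover have "(\<Sum>i\<in>UNIV. (var i)\<^sup>2) = (var i)\<^sup>2 + (\<Sum>j\<in>UNIV - {i}. (var j)\<^sup>2)"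
      by (rule sum.remove) auto
    ultimately have ci: "const c - (var i)\<^sup>2 \<in> M" by simp
    have half: "const (1 / 2) + const (1 / 2) = (1 :: 'a rpoly)" "const (1 / 2) * const (1 / 2) = const (1 / 4)"
      by (simp_all add: rhom_1[OF rhom_const] flip: rhom_add[OF rhom_const] rhom_mult[OF rhom_const])
    \<comment> \<open>Completing the square: c + 1/4 - x is the sum of c - x^2 and (x - 1/2)^2, and
      c + 1/4 + x that of c - x^2 and (x + 1/2)^2.\<close>
    let ?r = "c + 1 / 4"
    have e: "const ?r + - var i = (const c - (var i)\<^sup>2) + (var i - const (1 / 2))\<^sup>2"
      "const ?r + var i = (const c - (var i)\<^sup>2) + (var i + const (1 / 2))\<^sup>2"
    proof -
      have 1: "(var i - const (1 / 2))\<^sup>2 = (var i)\<^sup>2 - (const (1 / 2) + const (1 / 2)) * var i + const (1 / 2) * const (1 / 2)"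
        "(var i + const (1 / 2))\<^sup>2 = (var i)\<^sup>2 + (const (1 / 2) + const (1 / 2)) * var i + const (1 / 2) * const (1 / 2)"
        by (simp_all add: power2_eq_square algebra_simps)
      show "const ?r + - var i = (const c - (var i)\<^sup>2) + (var i - const (1 / 2))\<^sup>2"
        "const ?r + var i = (const c - (var i)\<^sup>2) + (var i + const (1 / 2))\<^sup>2"
        unfolding 1 half by (simp_all add: rhom_add[OF rhom_const])
    qed
    have m: "const ?r + - var i \<in> M" "const ?r + var i \<in> M"
      unfolding e by (intro qmod_add[OF M] ci qmod_square[OF M])+
    let ?s = "\<bar>?r\<bar> + 1"
    have s: "const ?s = const (?s - ?r) + const ?r"
      unfolding rhom_add[OF rhom_const, symmetric] by (simp only: diff_add_cancel)
    have "const (?s - ?r) + (const ?r + - var i) \<in> M" "const (?s - ?r) + (const ?r + var i) \<in> M"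
      by (intro qmod_add[OF M] m qmod_const[OF M]; simp)+
    moreover have "const (?s - ?r) + (const ?r + - var i) = const ?s - var i"
      "const (?s - ?r) + (const ?r + var i) = const ?s + var i"
      unfolding s by simp_all
    ultimately have "const ?s - var i \<in> M" "const ?s + var i \<in> M" by (simp_all only:)
    moreover have "?s > 0" by simp
    ultimately show ?thesis unfolding bounded_elts_def by blast
  qed
  have b0: "0 \<in> bounded_elts M" and b1: "1 \<in> bounded_elts M"
    using bounded_const[OF M, of 0] bounded_const[OF M, of 1]
    by (simp_all add: rhom_0[OF rhom_const] rhom_1[OF rhom_const])
  have sum: "sum f A \<in> bounded_elts M" if "\<And>x. x \<in> A \<Longrightarrow> f x \<in> bounded_elts M" for f :: "'b \<Rightarrow> 'a rpoly" and A
    using that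
  proof (induction A rule: infinite_finite_induct)
    case (insert x A)
    then show ?case using bounded_add[OF M] by simp
  qed (use b0 in simp_all)
  have prod: "prod f A \<in> bounded_elts M" if "\<And>x. x \<in> A \<Longrightarrow> f x \<in> bounded_elts M" for f :: "'c \<Rightarrow> 'a rpoly" and A
    using that
  proof (induction A rule: infinite_finite_induct)
    case (insert x A)
    then show ?case using bounded_mult[OF M] by simp
  qed (use b1 in simp_all)
  have power: "a ^ n \<in> bounded_elts M" if "a \<in> bounded_elts M" for a n
    by (induction n) (use that b1 in \<open>auto intro: bounded_mult[OF M]\<close>)
  have "a \<in> bounded_elts M" for a
    by (subst ev_const_var[symmetric])
       (unfold ev_def, intro sum bounded_mult[OF M] bounded_const[OF M] prod power v)
  then show ?thesis unfolding arch_def bounded_elts_def by blast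
qed

subsection \<open>Maximal quadratic modules\<close>

definition maximal_qmod :: "'n::finite rpoly set \<Rightarrow> bool"
  where "maximal_qmod M \<longleftrightarrow> qmod M \<and> - 1 \<notin> M \<and> (\<forall>M'. qmod M' \<longrightarrow> - 1 \<notin> M' \<longrightarrow> M \<subseteq> M' \<longrightarrow> M' = M)"

lemma maximal_qmod_exists:
  assumes "qmod M" "- 1 \<notin> M"
  shows "\<exists>M'. maximal_qmod M' \<and> M \<subseteq> M'"
proof -
  define A where "A = {N. qmod N \<and> - 1 \<notin> N \<and> M \<subseteq> N}"
  have "\<exists>N\<in>A. \<forall>N'\<in>A. N \<subseteq> N' \<longrightarrow> N' = N"
  proof (rule subset_Zorn_nonempty)
    show "A \<noteq> {}" using assms by (auto simp: A_def)
    fix C assume C: "C \<noteq> {}" "subset.chain A C"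
    then have CA: "\<And>N. N \<in> C \<Longrightarrow> qmod N \<and> - 1 \<notin> N \<and> M \<subseteq> N" by (auto simp: subset.chain_def A_def)
    have "a + b \<in> \<Union>C" if "a \<in> \<Union>C" "b \<in> \<Union>C" for a b
    proof -
      obtain N N' where N: "N \<in> C" "N' \<in> C" "a \<in> N" "b \<in> N'" using \<open>a \<in> \<Union>C\<close> \<open>b \<in> \<Union>C\<close> by blast
      then have "N \<subseteq> N' \<or> N' \<subseteq> N" using C(2) by (meson subset_chain_def)
      then show ?thesis using N qmod_add CA by (meson UnionI subsetD)
    qed
    moreover have "s * a \<in> \<Union>C" if "a \<in> \<Union>C" "s \<in> sums_of_squares" for a s
      using that CA qmod_mult by blast
    moreover have "- 1 \<notin> \<Union>C" "1 \<in> \<Union>C" "M \<subseteq> \<Union>C" using CA C(1) qmod_1 by blast+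
    ultimately show "\<Union>C \<in> A" unfolding A_def qmod_def by blast
  qed
  then obtain N where N: "N \<in> A" "\<And>N'. N' \<in> A \<Longrightarrow> N \<subseteq> N' \<Longrightarrow> N' = N" by blast
  then have "maximal_qmod N" unfolding maximal_qmod_def A_def by blast
  then show ?thesis using N by (auto simp: A_def)
qed

text \<open>Such a module consists of polynomials that are nonnegative at a common real point. The
  value of a polynomial there is recovered as the cut that \<open>M\<close> makes in the real
  constants, which is what \<open>near\<close> expresses.\<close>

locale arch_maximal =
  fixes M :: "'n::finite rpoly set"
  assumes max: "maximal_qmod M" and ar: "arch M"
begin

lemma M: "qmod M" and m1: "- 1 \<notin> M"
  using max by (auto simp: maximal_qmod_def)

lemma m1_adjoin:
  assumes "a \<notin> M"
  shows "\<exists>q s. q \<in> M \<and> s \<in> sums_of_squares \<and> - 1 = q + s * a"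
proof -
  have "- 1 \<in> {m + s * a | m s. m \<in> M \<and> s \<in> sums_of_squares}"
    using max qmod_adjoin[OF M, of a] assms unfolding maximal_qmod_def by blast
  then show ?thesis by blast
qed

text \<open>Two representations -1 = q + s a and -1 = q' - s' a show that - s' is in
  \<open>M\<close>, so both s' and - s' are. Such elements absorb arbitrary factors, since
  \<open>a\<close> is a difference of two squares up to the factor 1/4. Hence - s' a is in
  \<open>M\<close>, and with it -1 = q' - s' a.\<close>

lemma total: "a \<in> M \<or> - a \<in> M"
proof (rule ccontr)
  assume n: "\<not> ?thesis"
  obtain q s where q: "q \<in> M" "s \<in> sums_of_squares" "- 1 = q + s * a" using m1_adjoin[of a] n by blast
  obtain q' s' where q': "q' \<in> M" "s' \<in> sums_of_squares" "- 1 = q' + s' * - a" using m1_adjoin[of "- a"] n by blast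
  have "- s' = s' * q + (s + s * q')"
  proof -
    have "s' * a = 1 + q'" using q'(3) by (simp add: algebra_simps)
    then have "s * (s' * a) = s * (1 + q')" by simp
    moreover have "s' * - 1 = s' * (q + s * a)" using q(3) by simp
    ultimately show ?thesis by (simp add: algebra_simps)
  qed
  moreover have "s' * q + (s + s * q') \<in> M"
    by (intro qmod_add[OF M qmod_mult[OF M q'(2) q(1)]] qmod_add[OF M qmod_sos[OF M q(2)]] qmod_mult[OF M q(2) q'(1)])
  ultimately have ms': "- s' \<in> M" by simp
  have "const (1 / 4) * ((a + 1)\<^sup>2 * - s' + (a - 1)\<^sup>2 * s') \<in> M"
    by (rule qmod_const_mult[OF M _ qmod_add[OF M qmod_square_mult[OF M ms'] qmod_square_mult[OF M qmod_sos[OF M q'(2)]]]])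
      simp
  moreover have "const (1 / 4) * ((a + 1)\<^sup>2 * - s' + (a - 1)\<^sup>2 * s') = s' * - a"
  proof -
    have "const (1 / 4) * ((a + 1)\<^sup>2 * - s' + (a - 1)\<^sup>2 * s') = - s' * (const (1 / 4) * ((a + 1)\<^sup>2 + - ((a + - 1)\<^sup>2)))"
      by (simp add: algebra_simps)
    then show ?thesis unfolding quarter_squares[symmetric] by simp
  qed
  ultimately have "s' * - a \<in> M" by (simp only:)
  from qmod_add[OF M q'(1) this] have "- 1 \<in> M" unfolding q'(3)[symmetric] .
  then show False using m1 by simp
qed

lemma neg_const: "c < 0 \<Longrightarrow> const c \<notin> M"
proof
  assume c: "c < 0" "const c \<in> M"
  then have "const (- 1 / c) * const c \<in> M"
    by (intro qmod_const_mult[OF M _ c(2)]) (auto simp: divide_nonpos_neg)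
  moreover have "const (- 1 / c) * const c = (const (- 1 / c * c) :: 'n rpoly)" by (rule rhom_mult[OF rhom_const, symmetric])
  moreover have "- 1 / c * c = - 1" using c by simp
  ultimately show False using m1 by (simp only: rhom_uminus[OF rhom_const] rhom_1[OF rhom_const])
qed

text \<open>\<open>a\<close> equals \<open>v\<close> modulo \<open>M\<close> up to arbitrarily small
  constants. The margin \<open>e\<close> is there because \<open>v\<close> arises as an infimum that
  is not known to be attained.\<close>

definition near :: "'n rpoly \<Rightarrow> real \<Rightarrow> bool"
  where "near a v \<longleftrightarrow> (\<forall>e>0. const (v + e) - a \<in> M \<and> a - const (v - e) \<in> M)"

lemma near_unique: assumes "near a v" "near a w" shows "v = w"
proof -
  have "\<not> v < w" if vw: "near a v" "near a w" for v w
  proof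
    assume "v < w"
    define e where "e = (w - v) / 3"
    have e: "e > 0" using \<open>v < w\<close> by (simp add: e_def)
    then have "(const (v + e) - a) + (a - const (w - e)) \<in> M"
      using vw unfolding near_def by (intro qmod_add[OF M]) blast+
    moreover have "(const (v + e) - a) + (a - const (w - e)) = const (v + e - (w - e))"
      unfolding rhom_diff[OF rhom_const, of "v + e" "w - e"] by simp
    ultimately have "const (v + e - (w - e)) \<in> M" by simp
    moreover have "v + e - (w - e) < 0" using \<open>v < w\<close> by (simp add: e_def field_simps)
    ultimately show False using neg_const by blast
  qed
  then show ?thesis using assms by (meson linorder_neqE_linordered_idom)
qed

lemma near_exists: "\<exists>v. near a v"
proof -
  define S where "S = {r. const r - a \<in> M}"
  obtain r0 where r0: "r0 \<in> S" using ar unfolding arch_def S_def by blast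
  obtain N where N: "const N - (- a) \<in> M" using ar unfolding arch_def by blast
  have up: "s \<in> S" if "r \<in> S" "r \<le> s" for r s
  proof -
    have "const (s - r) + (const r - a) \<in> M"
      using that by (intro qmod_add[OF M] qmod_const[OF M]) (auto simp: S_def)
    then show ?thesis by (simp add: S_def rhom_diff[OF rhom_const])
  qed
  have lb: "- N \<le> r" if "r \<in> S" for r
  proof (rule ccontr)
    assume "\<not> - N \<le> r"
    moreover have "(const r - a) + (const N - (- a)) \<in> M" using that N by (intro qmod_add[OF M]) (auto simp: S_def)
    ultimately show False using neg_const[of "r + N"] by (simp add: rhom_add[OF rhom_const])
  qed
  then have bdd: "bdd_below S" by (rule bdd_belowI)
  have "near a (Inf S)"
    unfolding near_def
  proof safe
    fix e :: real assume e: "e > 0"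
    then obtain r where "r \<in> S" "r < Inf S + e" using cInf_lessD[of S "Inf S + e"] r0 by auto
    then show "const (Inf S + e) - a \<in> M" using up[of r "Inf S + e"] by (simp add: S_def)
    have "Inf S - e \<notin> S" using cInf_lower[OF _ bdd, of "Inf S - e"] e by auto
    then show "a - const (Inf S - e) \<in> M" using total[of "const (Inf S - e) - a"] by (simp add: S_def)
  qed
  then show ?thesis by blast
qed

lemma near_add: assumes "near a v" "near b w" shows "near (a + b) (v + w)"
  unfolding near_def
proof (intro allI impI)
  fix e :: real assume "e > 0"
  then have h: "e / 2 > 0" by simp
  have "(const (v + e / 2) - a) + (const (w + e / 2) - b) \<in> M" "(a - const (v - e / 2)) + (b - const (w - e / 2)) \<in> M"
    using assms h unfolding near_def by (intro qmod_add[OF M]; blast)+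
  moreover have "const (v + w + e) = const (v + e / 2) + (const (w + e / 2) :: 'n rpoly)"
    "const (v + w - e) = const (v - e / 2) + (const (w - e / 2) :: 'n rpoly)"
    by (simp_all add: algebra_simps flip: rhom_add[OF rhom_const])
  ultimately show "const (v + w + e) - (a + b) \<in> M \<and> a + b - const (v + w - e) \<in> M"
    by (simp add: algebra_simps)
qed

lemma near_uminus: assumes "near a v" shows "near (- a) (- v)"
  unfolding near_def
proof (intro allI impI)
  fix e :: real assume "e > 0"
  then have "const (v + e) - a \<in> M" "a - const (v - e) \<in> M" using assms unfolding near_def by blast+
  moreover have "const (- v + e) = - (const (v - e) :: 'n rpoly)" "const (- v - e) = - (const (v + e) :: 'n rpoly)"
    by (simp_all flip: rhom_uminus[OF rhom_const])
  ultimately show "const (- v + e) - - a \<in> M \<and> - a - const (- v - e) \<in> M" by simp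
qed

lemma near_const: "near (const c) c"
  unfolding near_def by (auto intro!: qmod_const[OF M] simp flip: rhom_diff[OF rhom_const])

lemma near_scale_pos: assumes "near a v" "c > 0" shows "near (const c * a) (c * v)"
  unfolding near_def
proof (intro allI impI)
  fix e :: real assume "e > 0"
  then have "e / c > 0" using assms by simp
  then have "const (v + e / c) - a \<in> M" "a - const (v - e / c) \<in> M"
    using assms unfolding near_def by blast+
  then have "const c * (const (v + e / c) - a) \<in> M" "const c * (a - const (v - e / c)) \<in> M"
    using assms(2) qmod_const_mult[OF M, of c] by simp_all
  moreover have "const (c * v + e) = const c * (const (v + e / c) :: 'n rpoly)"
    "const (c * v - e) = const c * (const (v - e / c) :: 'n rpoly)"
    using assms(2) by (simp_all add: algebra_simps flip: rhom_mult[OF rhom_const])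
  ultimately show "const (c * v + e) - const c * a \<in> M \<and> const c * a - const (c * v - e) \<in> M"
    by (simp add: algebra_simps)
qed

lemma near_scale: assumes "near a v" shows "near (const c * a) (c * v)"
proof (cases c "0 :: real" rule: linorder_cases)
  case less
  then have "near (- (const (- c) * a)) (- (- c * v))" using near_scale_pos[OF assms, of "- c"] by (intro near_uminus) simp
  then show ?thesis by (simp add: rhom_uminus[OF rhom_const])
next
  case equal
  then show ?thesis using near_const[of 0] by (simp add: rhom_0[OF rhom_const])
qed (rule near_scale_pos[OF assms])

text \<open>Multiplicativity begins at value 0: if \<open>a\<close> is between - sqrt e and sqrt e
  modulo \<open>M\<close>, then a^2 is below e. A shift by a constant gives all squares, and
  polarisation gives products.\<close>

lemma near_square_0: assumes "near a 0" shows "near (a\<^sup>2) 0"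
  unfolding near_def
proof (intro allI impI)
  fix e :: real assume e: "e > 0"
  then have s: "sqrt e > 0" by simp
  have "const (sqrt e) - a \<in> M" using assms s unfolding near_def by force
  moreover have "a - const (- sqrt e) \<in> M" using assms s unfolding near_def by force
  then have "const (sqrt e) + a \<in> M" by (simp add: rhom_uminus[OF rhom_const] add.commute)
  ultimately have "const ((sqrt e)\<^sup>2) - a\<^sup>2 \<in> M" using qmod_diff_squares[OF M s] by blast
  moreover have "a\<^sup>2 + const e \<in> M" using e by (intro qmod_add[OF M] qmod_square[OF M] qmod_const[OF M]) simp
  ultimately show "const (0 + e) - a\<^sup>2 \<in> M \<and> a\<^sup>2 - const (0 - e) \<in> M"
    using e by (simp add: rhom_uminus[OF rhom_const])
qed

lemma near_square: assumes "near a v" shows "near (a\<^sup>2) (v\<^sup>2)"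
proof -
  define b where "b = a + const (- v)"
  have b: "near b 0" unfolding b_def using near_add[OF assms near_const[of "- v"]] by simp
  have "near ((b\<^sup>2 + const (2 * v) * b) + const (v\<^sup>2)) ((0 + 2 * v * 0) + v\<^sup>2)"
    by (intro near_add near_square_0[OF b] near_scale[OF b] near_const)
  moreover have "(b\<^sup>2 + const (2 * v) * b) + const (v\<^sup>2) = a\<^sup>2"
    unfolding mult_2 b_def rhom_add[OF rhom_const] rhom_power[OF rhom_const] rhom_uminus[OF rhom_const]
    by (simp add: power2_eq_square algebra_simps)
  ultimately show ?thesis by simp
qed

lemma near_mult: assumes "near a v" "near b w" shows "near (a * b) (v * w)"
proof -
  have "near (const (1 / 4) * ((a + b)\<^sup>2 + - ((a + - b)\<^sup>2))) (1 / 4 * ((v + w)\<^sup>2 + - ((v + - w)\<^sup>2)))"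
    by (intro near_scale near_add near_uminus near_square assms)
  moreover have "1 / 4 * ((v + w)\<^sup>2 + - ((v + - w)\<^sup>2)) = v * w" by (simp add: power2_eq_square algebra_simps)
  ultimately show ?thesis using quarter_squares[of a b] by simp
qed

text \<open>\<open>near\<close> is the graph of a ring homomorphism to the reals that fixes the
  constants. Such a map is evaluation at the images of the variables.\<close>

lemma point: "\<exists>x. \<forall>m\<in>M. 0 \<le> poly_at m x"
proof -
  define \<phi> where "\<phi> a = (THE v. near a v)" for a
  have near: "near a (\<phi> a)" for a
    unfolding \<phi>_def by (rule theI') (use near_exists near_unique in blast)
  have eq: "\<phi> a = v" if "near a v" for a v using near_unique[OF near that] .
  have \<phi>c: "\<phi> (const c) = c" for c by (rule eq[OF near_const])
  have "\<phi> 1 = 1" using \<phi>c[of 1] by (simp add: rhom_1[OF rhom_const])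
  then have \<phi>: "rhom \<phi>"
    unfolding rhom_def using eq[OF near_add[OF near near]] eq[OF near_mult[OF near near]] by blast
  define x where "x = (\<chi> i. \<phi> (var i))"
  have "poly_at p x = \<phi> p" for p
  proof -
    have "poly_at p x = ev (\<lambda>c. \<phi> (const c)) (\<lambda>i. \<phi> (var i)) p" by (simp add: poly_at_eq_ev x_def \<phi>c id_def)
    also have "\<dots> = \<phi> p" by (rule rhom_eq_ev[OF \<phi>, symmetric])
    finally show ?thesis .
  qed
  moreover have "0 \<le> \<phi> m" if "m \<in> M" for m
  proof (rule ccontr)
    assume "\<not> 0 \<le> \<phi> m"
    then have e: "- \<phi> m / 2 > 0" by simp
    then have "(const (\<phi> m + - \<phi> m / 2) - m) + m \<in> M"
      using near[of m] that unfolding near_def by (intro qmod_add[OF M]) blast+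
    then have "const (\<phi> m + - \<phi> m / 2) \<in> M" by simp
    then show False using neg_const[of "\<phi> m + - \<phi> m / 2"] e by linarith
  qed
  ultimately show ?thesis by (intro exI[of _ x]) simp
qed

end

subsection \<open>Putinar's Positivstellensatz\<close>

text \<open>If the module generated by \<open>M\<close> and \<open>- f\<close> did not contain -1, a
  maximal extension would give a point where all of \<open>M\<close> is nonnegative and
  \<open>f\<close> is not positive. So s f - 1 is in \<open>M\<close> for a sum of squares s. To
  remove the factor s, a constant is added to \<open>f\<close> that brings it into \<open>M\<close>,
  and this constant is lowered to 0 in finitely many steps.\<close>

theorem putinar:
  fixes M :: "'n::finite rpoly set"
  assumes M: "qmod M" and ar: "arch M"
    and f: "\<And>x. (\<And>m. m \<in> M \<Longrightarrow> 0 \<le> poly_at m x) \<Longrightarrow> 0 < poly_at f x"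
  shows "f \<in> M"
proof -
  define M1 where "M1 = {m + s * - f | m s. m \<in> M \<and> s \<in> sums_of_squares}"
  have "- 1 \<in> M1"
  proof (rule ccontr)
    assume "- 1 \<notin> M1"
    then obtain M2 where M2: "maximal_qmod M2" "M1 \<subseteq> M2"
      using maximal_qmod_exists qmod_adjoin(1)[OF M] unfolding M1_def by blast
    have sub: "M \<subseteq> M2" "- f \<in> M2" using qmod_adjoin(2,3)[OF M, where a = "- f"] M2(2) unfolding M1_def by blast+
    interpret arch_maximal M2
      using M2 arch_mono[OF ar sub(1)] by unfold_locales
    obtain x where x: "\<And>m. m \<in> M2 \<Longrightarrow> 0 \<le> poly_at m x" using point by blast
    then have "0 < poly_at f x" using f sub by blast
    moreover have "0 \<le> poly_at (- f) x" using x sub by blast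
    ultimately show False by (simp add: rhom_uminus[OF rhom_poly_at])
  qed
  then obtain m s where ms: "- 1 = m + s * - f" "m \<in> M" "s \<in> sums_of_squares" by (auto simp: M1_def)
  have sf: "s * f - 1 \<in> M" using ms by (simp add: algebra_simps)
  obtain r1 r2 r3 where r: "const r1 - s\<^sup>2 * f \<in> M" "const r2 - s \<in> M" "const r3 - (- f) \<in> M"
    using ar unfolding arch_def by blast
  \<comment> \<open>One bound for all three elements. It is an integer so that k^3 steps of size
    1/k^2 bring the constant from k to exactly 0.\<close>
  obtain k :: nat where k: "real k \<ge> max (max (r1 + 1) r2) (max r3 1)" using real_arch_simple by blast
  have up: "const r' - a \<in> M" if "const r - a \<in> M" "r \<le> r'" for r r' a
  proof -
    have "const (r' - r) + (const r - a) \<in> M" using that by (intro qmod_add[OF M] qmod_const[OF M]) auto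
    then show ?thesis by (simp add: rhom_diff[OF rhom_const])
  qed
  define c where "c = (const (real k) :: 'n rpoly)"
  have k1: "real k \<ge> 1" using k by simp
  have c2: "const (2 * real k) = c + c"
    using rhom_add[OF rhom_const, of "real k" "real k"] by (simp add: c_def)
  have c3: "const (2 * real k - 1) = c + c - 1"
    by (simp only: rhom_diff[OF rhom_const] c2 rhom_1[OF rhom_const])
  have A: "c + c - 1 - s\<^sup>2 * f \<in> M" "c + c - s \<in> M" "c + f \<in> M"
    using up[OF r(1), of "2 * real k - 1"] up[OF r(2), of "2 * real k"] up[OF r(3), of "real k"] k
    by (simp_all add: c2 c3 c_def[symmetric])
  text \<open>The identity below, due to Jacobi, lowers the constant by \<open>1 / k\<^sup>2\<close>.\<close>
  have step: "const (t - 1 / (real k)\<^sup>2) + f \<in> M" if t: "t \<ge> 0" "const t + f \<in> M" for t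
  proof -
    have "(c - s)\<^sup>2 * (const t + f) + (c + c) * (s * f - 1) + const t * (s * (c + c - s)) + (c + c - 1 - s\<^sup>2 * f) \<in> M"
      using qmod_add[OF M qmod_add[OF M qmod_add[OF M qmod_square_mult[OF M t(2), of "c - s"]
        qmod_const_mult[OF M _ sf, of "2 * real k"]] qmod_const_mult[OF M t(1) qmod_mult[OF M ms(3) A(2)]]] A(1)]
      unfolding c2 by simp
    moreover have "(c - s)\<^sup>2 * (const t + f) + (c + c) * (s * f - 1) + const t * (s * (c + c - s)) + (c + c - 1 - s\<^sup>2 * f)
        = c\<^sup>2 * (const t + f) - 1"
      by (simp add: power2_eq_square algebra_simps)
    ultimately have "c\<^sup>2 * (const t + f) - 1 \<in> M" by (simp only:)
    from qmod_const_mult[OF M _ this] have "const (1 / (real k)\<^sup>2) * (c\<^sup>2 * (const t + f) - 1) \<in> M"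
      by simp
    moreover have "const (1 / (real k)\<^sup>2) * c\<^sup>2 = (1 :: 'n rpoly)"
      using k1 by (simp add: c_def rhom_1[OF rhom_const] flip: rhom_mult[OF rhom_const] rhom_power[OF rhom_const])
    ultimately have "(const t + f) - const (1 / (real k)\<^sup>2) \<in> M"
      by (simp add: right_diff_distrib mult.assoc[symmetric])
    then show ?thesis by (simp add: rhom_diff[OF rhom_const] algebra_simps)
  qed
  have "const (real k - real n / (real k)\<^sup>2) + f \<in> M" if "n \<le> k ^ 3" for n
    using that
  proof (induction n)
    case 0
    then show ?case using A(3) by (simp add: c_def)
  next
    case (Suc n)
    have "real n \<le> real (k ^ 3)" using Suc.prems by (simp only: of_nat_le_iff)
    then have "real n / (real k)\<^sup>2 \<le> real k" using k1 by (simp add: field_simps power2_eq_square power3_eq_cube)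
    then have "const (real k - real n / (real k)\<^sup>2 - 1 / (real k)\<^sup>2) + f \<in> M" using Suc by (intro step) auto
    moreover have "real k - real n / (real k)\<^sup>2 - 1 / (real k)\<^sup>2 = real k - real (Suc n) / (real k)\<^sup>2"
      by (simp add: add_divide_distrib)
    ultimately show ?case by simp
  qed
  from this[of "k ^ 3"] have "const (real k - real (k ^ 3) / (real k)\<^sup>2) + f \<in> M" by simp
  moreover have "real k - real (k ^ 3) / (real k)\<^sup>2 = 0" using k1 by (simp add: power2_eq_square power3_eq_cube)
  ultimately show ?thesis by (simp add: rhom_0[OF rhom_const])
qed

subsection \<open>The Positivstellensatz for one inequality\<close>

definition preordering :: "'a::comm_ring_1 set \<Rightarrow> bool"
  where "preordering P \<longleftrightarrow> (\<forall>a. a\<^sup>2 \<in> P) \<and> (\<forall>a\<in>P. \<forall>b\<in>P. a + b \<in> P \<and> a * b \<in> P)"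

lemma preordering_adjoin:
  assumes "preordering P"
  shows "preordering {x + y * a | x y. x \<in> P \<and> y \<in> P}" (is "preordering ?Q")
    and "P \<subseteq> {x + y * a | x y. x \<in> P \<and> y \<in> P}" and "a \<in> {x + y * a | x y. x \<in> P \<and> y \<in> P}"
proof -
  have P: "x + y \<in> P" "x * y \<in> P" "z\<^sup>2 \<in> P" if "x \<in> P" "y \<in> P" for x y z
    using assms that by (auto simp: preordering_def)
  have sq: "z\<^sup>2 \<in> P" for z using assms by (auto simp: preordering_def)
  have z: "0 \<in> P" "1 \<in> P" using sq[of 0] sq[of 1] by auto
  have I: "x + y * a \<in> ?Q" if "x \<in> P" "y \<in> P" for x y using that by blast
  show sub: "P \<subseteq> ?Q" using I[OF _ z(1)] by auto
  show "a \<in> ?Q" using I[OF z] by simp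
  have "u + v \<in> ?Q \<and> u * v \<in> ?Q" if uv: "u \<in> ?Q" "v \<in> ?Q" for u v
  proof -
    obtain x y x' y' where e: "u = x + y * a" "v = x' + y' * a" "x \<in> P" "y \<in> P" "x' \<in> P" "y' \<in> P"
      using uv by blast
    have "u + v = (x + x') + (y + y') * a" "u * v = (x * x' + y * y' * a\<^sup>2) + (x * y' + y * x') * a"
      by (simp_all add: e power2_eq_square algebra_simps)
    moreover have "(x + x') + (y + y') * a \<in> ?Q" "(x * x' + y * y' * a\<^sup>2) + (x * y' + y * x') * a \<in> ?Q"
      by (intro I P(1,2) sq e)+
    ultimately show ?thesis by (simp only:)
  qed
  then show "preordering ?Q" unfolding preordering_def using sub sq by blast
qed

text \<open>A maximal preordering without -1 will do. If - a is outside, adjoining it produces y a =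
  1 + x with x, y in \<open>P\<close>. Totality and primality both follow by multiplying two such
  identities: the product (1 + x)(1 + x') would exhibit -1 as an element of
  \<open>P\<close>.\<close>

lemma prime_cone_exists:
  fixes T :: "'a::comm_ring_1 set"
  assumes "preordering T" "- 1 \<notin> T"
  shows "\<exists>P. prime_cone P \<and> T \<subseteq> P"
proof -
  define A where "A = {P. preordering P \<and> - 1 \<notin> P \<and> T \<subseteq> P}"
  have "\<exists>N\<in>A. \<forall>N'\<in>A. N \<subseteq> N' \<longrightarrow> N' = N"
  proof (rule subset_Zorn_nonempty)
    show "A \<noteq> {}" using assms by (auto simp: A_def)
    fix C assume C: "C \<noteq> {}" "subset.chain A C"
    then have CA: "\<And>N. N \<in> C \<Longrightarrow> preordering N \<and> - 1 \<notin> N \<and> T \<subseteq> N" by (auto simp: subset.chain_def A_def)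
    have "a + b \<in> \<Union>C \<and> a * b \<in> \<Union>C" if "a \<in> \<Union>C" "b \<in> \<Union>C" for a b
    proof -
      obtain N N' where N: "N \<in> C" "N' \<in> C" "a \<in> N" "b \<in> N'" using \<open>a \<in> \<Union>C\<close> \<open>b \<in> \<Union>C\<close> by blast
      then have "N \<subseteq> N' \<or> N' \<subseteq> N" using C(2) by (meson subset_chain_def)
      then obtain L where "L \<in> C" "a \<in> L" "b \<in> L" using N by blast
      then show ?thesis using CA unfolding preordering_def by blast
    qed
    moreover have "\<forall>a. a\<^sup>2 \<in> \<Union>C" using CA C(1) unfolding preordering_def by blast
    moreover have "- 1 \<notin> \<Union>C" "T \<subseteq> \<Union>C" using CA C(1) by blast+
    ultimately show "\<Union>C \<in> A" unfolding A_def preordering_def by blast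
  qed
  then obtain P where PA: "P \<in> A" and max: "\<And>N'. N' \<in> A \<Longrightarrow> P \<subseteq> N' \<Longrightarrow> N' = P" by blast
  have pre: "preordering P" and m1: "- 1 \<notin> P" and TP: "T \<subseteq> P" using PA by (auto simp: A_def)
  have add: "x + y \<in> P" and mult: "x * y \<in> P" if "x \<in> P" "y \<in> P" for x y
    using pre that by (auto simp: preordering_def)
  have sq: "z\<^sup>2 \<in> P" for z using pre by (auto simp: preordering_def)
  have ex: "\<exists>x y. x \<in> P \<and> y \<in> P \<and> y * a = 1 + x" if "- a \<notin> P" for a
  proof -
    let ?Q = "{x + y * - a | x y. x \<in> P \<and> y \<in> P}"
    have "?Q \<noteq> P" using preordering_adjoin(3)[OF pre, where a = "- a"] that by blast
    then have "?Q \<notin> A" using max[of ?Q] preordering_adjoin(2)[OF pre, where a = "- a"] by blast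
    then have "- 1 \<in> ?Q"
      using preordering_adjoin(1,2)[OF pre, where a = "- a"] TP unfolding A_def by blast
    then obtain x y where "x \<in> P" "y \<in> P" "- 1 = x + y * - a" by blast
    have "y * a = x - (x + y * - a)" by simp
    also have "\<dots> = 1 + x" unfolding \<open>- 1 = x + y * - a\<close>[symmetric] by simp
    finally have "y * a = 1 + x" .
    then show ?thesis using \<open>x \<in> P\<close> \<open>y \<in> P\<close> by blast
  qed
  have total: "a \<in> P \<or> - a \<in> P" for a
  proof (rule ccontr)
    assume n: "\<not> ?thesis"
    obtain x y where xy: "x \<in> P" "y \<in> P" "y * a = 1 + x" using ex[of a] n by blast
    obtain x' y' where xy': "x' \<in> P" "y' \<in> P" "y' * - a = 1 + x'" using ex[of "- a"] n by auto
    have "(y * a) * (y' * - a) = (1 + x) * (1 + x')" using xy(3) xy'(3) by simp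
    moreover have "x + x' + x * x' + y * y' * a\<^sup>2 = (1 + x) * (1 + x') - (y * a) * (y' * - a) - 1"
      by (simp add: power2_eq_square algebra_simps)
    ultimately have "x + x' + x * x' + y * y' * a\<^sup>2 = - 1" by simp
    moreover have "x + x' + x * x' + y * y' * a\<^sup>2 \<in> P" using xy xy' sq by (intro add mult)
    ultimately show False using m1 by simp
  qed
  have prime: "(a \<in> P \<and> - a \<in> P) \<or> (b \<in> P \<and> - b \<in> P)" if ab: "a * b \<in> P" "- (a * b) \<in> P" for a b
  proof (rule ccontr)
    assume n: "\<not> ?thesis"
    \<comment> \<open>Signs are chosen so that \<open>- a'\<close> and \<open>- b'\<close> are
      outside \<open>P\<close>, which is possible as neither \<open>a\<close> nor \<open>b\<close>
      is in the support. The product may change sign, but both signs of it are in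
      \<open>P\<close>.\<close>
    define a' where "a' = (if - a \<in> P then - a else a)"
    define b' where "b' = (if - b \<in> P then - b else b)"
    have n': "- a' \<notin> P" "- b' \<notin> P" using n by (auto simp: a'_def b'_def)
    have ab': "- (a' * b') \<in> P" using ab by (auto simp: a'_def b'_def)
    obtain x y where xy: "x \<in> P" "y \<in> P" "y * a' = 1 + x" using ex[OF n'(1)] by blast
    obtain x' y' where xy': "x' \<in> P" "y' \<in> P" "y' * b' = 1 + x'" using ex[OF n'(2)] by blast
    have "(y * a') * (y' * b') = (1 + x) * (1 + x')" using xy(3) xy'(3) by simp
    moreover have "x + x' + x * x' + y * y' * - (a' * b') = (1 + x) * (1 + x') - (y * a') * (y' * b') - 1"
      by (simp add: power2_eq_square algebra_simps)
    ultimately have "x + x' + x * x' + y * y' * - (a' * b') = - 1" by simp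
    moreover have "x + x' + x * x' + y * y' * - (a' * b') \<in> P" using xy xy' ab' by (intro add mult)
    ultimately show False using m1 by simp
  qed
  have "prime_cone P" unfolding prime_cone_def using add mult total m1 prime by blast
  then show ?thesis using TP by blast
qed

text \<open>With a single generator the quadratic module is already closed under products, because
  u^2 is a square. So this preordering lies inside every quadratic module containing
  \<open>u\<close>, in particular inside Q(g).\<close>

definition one_gen :: "'n::finite rpoly \<Rightarrow> 'n rpoly set"
  where "one_gen u = {s + t * u | s t. s \<in> sums_of_squares \<and> t \<in> sums_of_squares}"

lemma preordering_sos: "preordering sums_of_squares"
  by (simp add: preordering_def sos_square sos_add sos_mult)

lemma preordering_one_gen: "preordering (one_gen u)"
  unfolding one_gen_def by (rule preordering_adjoin(1)[OF preordering_sos])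

lemma sos_one_gen: "sums_of_squares \<subseteq> one_gen u" and gen_one_gen: "u \<in> one_gen u"
  unfolding one_gen_def by (rule preordering_adjoin[OF preordering_sos])+

lemma qmod_preordering: "preordering P \<Longrightarrow> qmod P"
proof -
  assume P: "preordering P"
  have s: "s \<in> P" if "s \<in> sums_of_squares" for s
    using that
  proof (induction s rule: sos_induct)
    case zero
    have "0\<^sup>2 \<in> P" using P unfolding preordering_def by blast
    then show ?case by simp
  qed (use P in \<open>auto simp: preordering_def\<close>)
  show ?thesis unfolding qmod_def using s sos_1 P unfolding preordering_def by blast
qed

lemma positivstellensatz:
  fixes u f :: "'n::finite rpoly"
  assumes no: "\<And>a. 0 \<le> poly_at u a \<Longrightarrow> 0 < poly_at f a"
  shows "\<exists>p q. p \<in> one_gen u \<and> q \<in> one_gen u \<and> p * f = 1 + q"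
proof -
  let ?T = "{x + y * - f | x y. x \<in> one_gen u \<and> y \<in> one_gen u}"
  note T = preordering_adjoin[OF preordering_one_gen[of u], where a = "- f"]
  have "- 1 \<in> ?T"
  proof (rule ccontr)
    assume "- 1 \<notin> ?T"
    then obtain P where P: "prime_cone P" "?T \<subseteq> P" using prime_cone_exists[OF T(1)] by blast
    have uP: "u \<in> P" "- f \<in> P" using T(2,3) P(2) gen_one_gen by blast+
    have "finite {u, f}" by simp
    then obtain a where a: "cone_sg P u = sg (poly_at u a)" "cone_sg P f = sg (poly_at f a)"
      using prime_cone_realized[OF P(1)] unfolding realized_def by blast
    have "sg (poly_at u a) \<noteq> - 1" using a(1) uP(1) by (auto simp: cone_sg_def split: if_splits)
    then have "0 < poly_at f a" using no by (metis not_le sg_eq_m1_iff)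
    then show False using a(2) uP(2) by (auto simp: cone_sg_def split: if_splits)
  qed
  then obtain x y where xy: "x \<in> one_gen u" "y \<in> one_gen u" "- 1 = x + y * - f" by blast
  have "y * f = x - (x + y * - f)" by simp
  also have "\<dots> = 1 + x" unfolding xy(3)[symmetric] by simp
  finally show ?thesis using xy by blast
qed

text \<open>Woermann's argument: if \<open>p * f = 1 + q\<close> then \<open>(1 + q) * T[f] \<subseteq> T\<close>, and \<open>T[f]\<close> is archimedean.\<close>

lemma ball_in_one_gen:
  fixes u :: "'n::finite rpoly"
  assumes "bounded {a. 0 \<le> poly_at u a}"
  shows "\<exists>c. const c - (\<Sum>i\<in>UNIV. (var i)\<^sup>2) \<in> one_gen u"
proof -
  let ?T = "one_gen u"
  note pre = preordering_one_gen[of u]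
  note M = qmod_preordering[OF pre]
  define n2 where "n2 = (\<Sum>i\<in>UNIV. (var i)\<^sup>2 :: 'n rpoly)"
  obtain B where B: "\<And>a. 0 \<le> poly_at u a \<Longrightarrow> norm a < B" "B > 0"
    using assms by (auto simp: bounded_pos_less)
  define c where "c = B\<^sup>2"
  define f where "f = const c - n2"
  have pf: "poly_at f a = c - (norm a)\<^sup>2" for a
  proof -
    have "poly_at n2 a = (\<Sum>i\<in>UNIV. (a $ i)\<^sup>2)"
      by (simp add: n2_def rhom_sum[OF rhom_poly_at] rhom_power[OF rhom_poly_at])
         (simp add: poly_at_eq_ev ev_var[OF rhom_id])
    also have "\<dots> = (norm a)\<^sup>2" by (simp add: norm_vec_def L2_set_def sum_nonneg)
    finally show ?thesis
      by (simp add: f_def rhom_diff[OF rhom_poly_at]) (simp add: poly_at_eq_ev ev_const[OF rhom_id])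
  qed
  have "0 < poly_at f a" if "0 \<le> poly_at u a" for a
    using B(1)[OF that] B(2) unfolding pf c_def by (simp add: power_strict_mono)
  then obtain p q where p: "p \<in> ?T" "q \<in> ?T" "p * f = 1 + q" using positivstellensatz[of u f] by blast
  let ?M = "{x + y * f | x y. x \<in> ?T \<and> y \<in> ?T}"
  have M': "qmod ?M" "f \<in> ?M"
    using qmod_preordering preordering_adjoin(1,3)[OF pre, where a = f] by blast+
  have "arch ?M" by (rule arch_if_ball[OF M'(1)]) (use M'(2) in \<open>simp add: f_def n2_def\<close>)
  then obtain r where "const r - q \<in> ?M" unfolding arch_def by blast
  then obtain x y where xy: "x \<in> ?T" "y \<in> ?T" "const r - q = x + y * f" by blast
  have add: "a + b \<in> ?T" and mult: "a * b \<in> ?T" if "a \<in> ?T" "b \<in> ?T" for a b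
    using pre that by (auto simp: preordering_def)
  have sq: "a\<^sup>2 \<in> ?T" for a using pre by (auto simp: preordering_def)
  have one: "1 \<in> ?T" using sq[of 1] by simp
  define h where "h = (const (r / 2) :: 'n rpoly)"
  have h: "const r = h + h" "const (r + r\<^sup>2 / 4) = h + h + h\<^sup>2"
    by (simp_all add: h_def power_divide flip: rhom_add[OF rhom_const] rhom_power[OF rhom_const])
  \<comment> \<open>Multiplying r - q = x + y f by 1 + q = p f gives an element of
    \<open>one_gen u\<close>, as y p f^2 is one. Adding the square of q - r/2 to (1 + q)(r - q)
    cancels the terms r q and q^2 and leaves r + r^2/4 - q.\<close>
  have "(1 + q) * x + y * (p * f\<^sup>2) + (q - h)\<^sup>2 \<in> ?T" by (intro add mult one p xy sq)
  moreover have "(1 + q) * x + y * (p * f\<^sup>2) + (q - h)\<^sup>2 = const (r + r\<^sup>2 / 4) - q"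
  proof -
    have "y * (p * f\<^sup>2) = (1 + q) * (y * f)" unfolding p(3)[symmetric] by (simp add: power2_eq_square algebra_simps)
    then have "(1 + q) * x + y * (p * f\<^sup>2) = (1 + q) * (const r - q)" unfolding xy(3) by (simp add: distrib_left)
    then show ?thesis unfolding h by (simp add: power2_eq_square algebra_simps)
  qed
  ultimately have q: "const (r + r\<^sup>2 / 4) - q \<in> ?T" by simp
  have n2: "n2 \<in> ?T"
    unfolding n2_def by (rule subsetD[OF sos_one_gen]) (intro sos_sum sos_square)
  have c: "const c \<in> ?T" by (rule qmod_const[OF M]) (simp add: c_def)
  \<comment> \<open>Here p f^2 = (1 + q) f. With f = c - n2, adding n2 q removes the product of q
    and n2, and the bound on \<open>q\<close> just found turns the remaining c q into a
    constant.\<close>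
  have "p * f\<^sup>2 + const c * (const (r + r\<^sup>2 / 4) - q) + n2 * q \<in> ?T"
    by (intro add mult p(1,2) q sq n2 c)
  moreover have "p * f\<^sup>2 + const c * (const (r + r\<^sup>2 / 4) - q) + n2 * q = const (c + c * (r + r\<^sup>2 / 4)) - n2"
  proof -
    have pff: "p * f\<^sup>2 = (1 + q) * f" unfolding p(3)[symmetric] by (simp add: power2_eq_square algebra_simps)
    have "(1 + q) * f + const c * (const (r + r\<^sup>2 / 4) - q) + n2 * q = const c + const c * const (r + r\<^sup>2 / 4) - n2"
      unfolding f_def by (simp add: algebra_simps)
    then show ?thesis by (simp only: pff rhom_add[OF rhom_const, of c] rhom_mult[OF rhom_const, of c])
  qed
  ultimately show ?thesis unfolding n2_def[symmetric] by (intro exI[of _ "c + c * (r + r\<^sup>2 / 4)"]) simp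
qed

subsection \<open>The module of a tuple\<close>

lemma qmod_quadratic_module: "qmod (quadratic_module g)"
proof -
  let ?G = "\<lambda>i. (1 # g) ! i"
  have I: "(\<Sum>i\<le>length g. \<sigma> i * ?G i) \<in> quadratic_module g" if "\<And>i. i \<le> length g \<Longrightarrow> \<sigma> i \<in> sums_of_squares" for \<sigma>
    using that unfolding quadratic_module_def by blast
  have "a + b \<in> quadratic_module g" if "a \<in> quadratic_module g" "b \<in> quadratic_module g" for a b
  proof -
    obtain \<sigma> \<tau> where e: "\<And>i. i \<le> length g \<Longrightarrow> \<sigma> i \<in> sums_of_squares" "a = (\<Sum>i\<le>length g. \<sigma> i * ?G i)"
      "\<And>i. i \<le> length g \<Longrightarrow> \<tau> i \<in> sums_of_squares" "b = (\<Sum>i\<le>length g. \<tau> i * ?G i)"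
      using \<open>a \<in> quadratic_module g\<close> \<open>b \<in> quadratic_module g\<close> unfolding quadratic_module_def by blast
    have ab: "a + b = (\<Sum>i\<le>length g. (\<sigma> i + \<tau> i) * ?G i)" by (simp add: e distrib_right sum.distrib)
    show ?thesis unfolding ab by (rule I) (intro sos_add e)
  qed
  moreover have "s * a \<in> quadratic_module g" if a: "a \<in> quadratic_module g" and s: "s \<in> sums_of_squares" for a s
  proof -
    obtain \<sigma> where e: "\<And>i. i \<le> length g \<Longrightarrow> \<sigma> i \<in> sums_of_squares" "a = (\<Sum>i\<le>length g. \<sigma> i * ?G i)"
      using a unfolding quadratic_module_def by blast
    have sa: "s * a = (\<Sum>i\<le>length g. (s * \<sigma> i) * ?G i)" by (simp add: e sum_distrib_left mult.assoc)
    show ?thesis unfolding sa by (rule I) (intro sos_mult s e)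
  qed
  moreover have "1 \<in> quadratic_module g"
  proof -
    have "(\<Sum>i\<le>length g. (if i = 0 then 1 else 0) * ?G i) = 1"
      by (simp add: if_distrib[of "\<lambda>x. x * _"] sum.delta cong: if_cong)
    then show ?thesis using I[of "\<lambda>i. if i = 0 then 1 else 0"] sos_0 sos_1 by force
  qed
  ultimately show ?thesis unfolding qmod_def by blast
qed

lemma generator_in_quadratic_module:
  assumes "p \<in> set g"
  shows "p \<in> quadratic_module g"
proof -
  obtain k where k: "k < length g" "p = g ! k" using assms by (auto simp: in_set_conv_nth)
  have "(\<Sum>i\<le>length g. (if i = Suc k then 1 else 0) * (1 # g) ! i) = p"
    using k by (simp add: if_distrib[of "\<lambda>x. x * _"] sum.delta cong: if_cong)
  moreover have "\<forall>i\<le>length g. (if i = Suc k then 1 else 0) \<in> sums_of_squares" using sos_0 sos_1 by auto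
  ultimately show ?thesis
    unfolding quadratic_module_def by (intro CollectI exI[of _ "\<lambda>i. if i = Suc k then 1 else 0"]) simp
qed

lemma quadratic_module_nonneg:
  assumes "q \<in> quadratic_module g" "a \<in> basic_closed g"
  shows "0 \<le> poly_at q a"
proof -
  obtain \<sigma> where e: "\<And>i. i \<le> length g \<Longrightarrow> \<sigma> i \<in> sums_of_squares" "q = (\<Sum>i\<le>length g. \<sigma> i * (1 # g) ! i)"
    using assms(1) unfolding quadratic_module_def by blast
  have "0 \<le> poly_at ((1 # g) ! i) a" if "i \<le> length g" for i
    using assms(2) that by (cases i) (auto simp: basic_closed_def rhom_1[OF rhom_poly_at])
  then show ?thesis
    unfolding e(2) rhom_sum[OF rhom_poly_at] rhom_mult[OF rhom_poly_at]
    using e(1) poly_at_sos by (intro sum_nonneg mult_nonneg_nonneg) auto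
qed

theorem archimedean_positivstellensatz:
  assumes ar: "archimedean (quadratic_module g)" and f: "\<And>a. a \<in> basic_closed g \<Longrightarrow> 0 < poly_at f a"
  shows "f \<in> quadratic_module g"
proof -
  note M = qmod_quadratic_module[of g]
  obtain u where u: "u \<in> quadratic_module g" "compact (basic_closed [u])"
    using ar by (auto simp: archimedean_def)
  have "bounded {a. 0 \<le> poly_at u a}" using compact_imp_bounded[OF u(2)] by (simp add: basic_closed_def)
  then obtain c where c: "const c - (\<Sum>i\<in>UNIV. (var i)\<^sup>2) \<in> one_gen u" using ball_in_one_gen by blast
  have "one_gen u \<subseteq> quadratic_module g"
    unfolding one_gen_def using qmod_add[OF M] qmod_sos[OF M] qmod_mult[OF M _ u(1)] by blast
  then have "arch (quadratic_module g)" using arch_if_ball[OF M] c by blast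
  moreover have "0 < poly_at f x" if "\<And>m. m \<in> quadratic_module g \<Longrightarrow> 0 \<le> poly_at m x" for x
    by (rule f) (use that generator_in_quadratic_module in \<open>auto simp: basic_closed_def\<close>)
  ultimately show ?thesis using putinar[OF M] by blast
qed

subsection \<open>Conic duality for moments\<close>

lemma finite_exponents_le: "finite (exponents_le d :: 'n::finite expo set)"
proof (rule inj_on_finite)
  show "inj_on Poly_Mapping.lookup (exponents_le d :: 'n expo set)"
    by (auto simp: inj_on_def intro: poly_mapping_eqI)
  show "Poly_Mapping.lookup ` (exponents_le d :: 'n expo set) \<subseteq> UNIV \<rightarrow>\<^sub>E {..d}"
  proof safe
    fix \<alpha> :: "'n expo" and i assume "\<alpha> \<in> exponents_le d"
    moreover have "Poly_Mapping.lookup \<alpha> i \<le> total_degree \<alpha>"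
      unfolding total_degree_def by (rule member_le_sum) auto
    ultimately show "Poly_Mapping.lookup \<alpha> i \<le> d" by (simp add: exponents_le_def)
  qed auto
  show "finite ((UNIV :: 'n set) \<rightarrow>\<^sub>E {..d})" by (intro finite_PiE) auto
qed

lemma zero_exponents_le: "0 \<in> exponents_le d"
  by (simp add: exponents_le_def total_degree_def)

lemma monomial_at_0: "monomial_at x 0 = 1"
  by (simp add: monomial_at_def)

lemma continuous_monomial_at: "continuous_on S (\<lambda>x. monomial_at x \<alpha>)"
  unfolding monomial_at_def by (intro continuous_intros)

text \<open>Either \<open>y\<close> agrees up to degree \<open>d\<close> with the moments of a
  finitely supported measure on \<open>K\<close>, or some polynomial separates it. \<open>K\<close>
  and \<open>y\<close> are quantified inside, so that a counterexample is a degree alone.\<close>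

definition moment_duality :: "'n::finite itself \<Rightarrow> nat \<Rightarrow> bool"
  where "moment_duality _ d \<longleftrightarrow> (\<forall>(K :: (real ^ 'n) set) y. compact K \<longrightarrow> K \<noteq> {} \<longrightarrow>
    (\<exists>F w. finite F \<and> F \<subseteq> K \<and> (\<forall>x\<in>F. 0 \<le> w x) \<and>
      (\<forall>\<alpha>\<in>exponents_le d. y \<alpha> = (\<Sum>x\<in>F. w x * monomial_at x \<alpha>))) \<or>
    (\<exists>p. (\<forall>x\<in>K. 0 \<le> (\<Sum>\<alpha>\<in>exponents_le d. p \<alpha> * monomial_at x \<alpha>)) \<and>
      (\<Sum>\<alpha>\<in>exponents_le d. p \<alpha> * y \<alpha>) < 0))"

text \<open>The convexity theorems of the library live on Euclidean types, so the exponents of bounded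
  degree have to form a type. It is built for one degree only, a counterexample if there is one.\<close>

definition test_degree :: "'n::finite itself \<Rightarrow> nat"
  where "test_degree t = (SOME d. \<not> moment_duality t d)"

typedef (overloaded) 'n mono = "exponents_le (test_degree TYPE('n::finite)) :: 'n expo set"
  using zero_exponents_le by blast

lemma bij_Rep_mono: "bij_betw Rep_mono UNIV (exponents_le (test_degree TYPE('n::finite)) :: 'n expo set)"
  by (rule bij_betw_byWitness[where f' = Abs_mono])
     (auto simp: Rep_mono_inverse Abs_mono_inverse Rep_mono)

instance mono :: (finite) finite
proof
  show "finite (UNIV :: 'a mono set)"
    using bij_betw_finite[OF bij_Rep_mono] finite_exponents_le by blast
qed

text \<open>\<open>V\<close> is the moment map. The cone over the convex hull of V(K) is closed
  because the hull is compact and avoids the origin, the coordinate of exponent 0 being 1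
  throughout. A point outside is therefore strictly separated.\<close>

lemma moment_duality_test: "moment_duality TYPE('n::finite) (test_degree TYPE('n))"
  unfolding moment_duality_def
proof (intro allI impI)
  let ?E = "exponents_le (test_degree TYPE('n)) :: 'n expo set"
  fix K :: "(real ^ 'n) set" and y :: "'n expo \<Rightarrow> real"
  assume K: "compact K" "K \<noteq> {}"
  define V :: "real ^ 'n \<Rightarrow> real ^ 'n mono" where "V x = (\<chi> i. monomial_at x (Rep_mono i))" for x
  define y' :: "real ^ 'n mono" where "y' = (\<chi> i. y (Rep_mono i))"
  define C where "C = convex hull (V ` K)"
  have "continuous_on K V"
    unfolding V_def by (intro continuous_on_vec_lambda continuous_monomial_at)
  then have compC: "compact C" unfolding C_def using K(1) by (intro compact_convex_hull compact_continuous_image)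
  define i0 :: "'n mono" where "i0 = Abs_mono 0"
  have i0: "Rep_mono i0 = 0" unfolding i0_def by (rule Abs_mono_inverse[OF zero_exponents_le])
  have "C \<subseteq> {z. z $ i0 = 1}"
    unfolding C_def
  proof (rule hull_minimal)
    show "V ` K \<subseteq> {z. z $ i0 = 1}" by (auto simp: V_def i0 monomial_at_0)
    show "convex {z :: real ^ 'n mono. z $ i0 = 1}" unfolding convex_def by (auto simp: algebra_simps)
  qed
  then have "0 \<notin> C" by auto
  then have closed: "closed (conic hull C)" using compC by (intro closed_conic_hull) blast
  have conv: "convex (conic hull C)" unfolding C_def by (intro convex_conic_hull convex_convex_hull)
  have sumE: "(\<Sum>\<alpha>\<in>?E. f \<alpha>) = (\<Sum>i\<in>UNIV. f (Rep_mono i))" for f :: "'n expo \<Rightarrow> real"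
    by (rule sum.reindex_bij_betw[OF bij_Rep_mono, symmetric])
  show "(\<exists>F w. finite F \<and> F \<subseteq> K \<and> (\<forall>x\<in>F. 0 \<le> w x) \<and> (\<forall>\<alpha>\<in>?E. y \<alpha> = (\<Sum>x\<in>F. w x * monomial_at x \<alpha>))) \<or>
    (\<exists>p. (\<forall>x\<in>K. 0 \<le> (\<Sum>\<alpha>\<in>?E. p \<alpha> * monomial_at x \<alpha>)) \<and> (\<Sum>\<alpha>\<in>?E. p \<alpha> * y \<alpha>) < 0)"
  proof (cases "y' \<in> conic hull C")
    case True
    then obtain c z where c: "0 \<le> c" "z \<in> C" "y' = c *\<^sub>R z" by (auto simp: conic_hull_explicit)
    then obtain S u where S: "finite S" "S \<subseteq> V ` K" "\<And>v. v \<in> S \<Longrightarrow> 0 \<le> u v" "(\<Sum>v\<in>S. u v *\<^sub>R v) = z"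
      unfolding C_def convex_hull_explicit by blast
    \<comment> \<open>\<open>V\<close> need not be injective (in degree 0 it is constant), so one
      preimage per vector is selected before the sum is reindexed.\<close>
    obtain F where F: "F \<subseteq> K" "inj_on V F" "S = V ` F" using subset_image_inj[of S V K] S(2) by blast
    have finF: "finite F" using S(1) F finite_imageD by blast
    define w where "w x = c * u (V x)" for x
    have "y \<alpha> = (\<Sum>x\<in>F. w x * monomial_at x \<alpha>)" if \<alpha>: "\<alpha> \<in> ?E" for \<alpha>
    proof -
      have R: "Rep_mono (Abs_mono \<alpha>) = \<alpha>" by (rule Abs_mono_inverse[OF \<alpha>])
      have "y \<alpha> = y' $ Abs_mono \<alpha>" by (simp add: y'_def R)
      also have "\<dots> = c * (\<Sum>v\<in>S. u v *\<^sub>R v) $ Abs_mono \<alpha>" by (simp add: c(3) S(4))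
      also have "\<dots> = c * (\<Sum>x\<in>F. u (V x) * monomial_at x \<alpha>)"
      proof -
        have "(\<Sum>v\<in>S. u v *\<^sub>R v) = (\<Sum>x\<in>F. u (V x) *\<^sub>R V x)" by (simp add: F(3) sum.reindex[OF F(2)])
        then show ?thesis by (simp add: V_def R)
      qed
      finally show ?thesis by (simp add: w_def sum_distrib_left mult.assoc)
    qed
    moreover have "\<forall>x\<in>F. 0 \<le> w x" using c(1) S(3) F(3) by (auto simp: w_def)
    ultimately show ?thesis using finF F(1) by blast
  next
    case False
    have "C \<noteq> {}" using K(2) by (simp add: C_def)
    then have 0: "0 \<in> conic hull C" by (simp add: conic_hull_contains_0)
    obtain a b where ab: "a \<bullet> y' < b" "\<And>x. x \<in> conic hull C \<Longrightarrow> b < a \<bullet> x"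
      using separating_hyperplane_closed_point[OF conv closed False] by blast
    have b0: "b < 0" using ab(2)[OF 0] by simp
    have nn: "0 \<le> a \<bullet> V x" if x: "x \<in> K" for x
    proof (rule ccontr)
      assume n: "\<not> 0 \<le> a \<bullet> V x"
      have "V x \<in> C" unfolding C_def using x by (intro hull_inc) auto
      \<comment> \<open>A negative value of the functional could be scaled to exactly
        \<open>b\<close> inside the cone, against strict separation.\<close>
      then have "(b / (a \<bullet> V x)) *\<^sub>R V x \<in> conic hull C"
        unfolding conic_hull_explicit using n b0 by (auto intro!: exI[of _ "b / (a \<bullet> V x)"] divide_nonpos_nonpos)
      from ab(2)[OF this] show False using n by simp
    qed
    define p where "p \<alpha> = a $ Abs_mono \<alpha>" for \<alpha>
    have in1: "(\<Sum>\<alpha>\<in>?E. p \<alpha> * monomial_at x \<alpha>) = a \<bullet> V x" for x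
      unfolding sumE by (simp add: p_def Rep_mono_inverse inner_vec_def V_def)
    have in2: "(\<Sum>\<alpha>\<in>?E. p \<alpha> * y \<alpha>) = a \<bullet> y'"
      unfolding sumE by (simp add: p_def Rep_mono_inverse inner_vec_def y'_def)
    show ?thesis using nn ab(1) b0 in1 in2 by (intro disjI2 exI[of _ p]) auto
  qed
qed

theorem moment_duality: "moment_duality TYPE('n::finite) d"
proof (rule ccontr)
  assume "\<not> moment_duality TYPE('n) d"
  then have "\<not> moment_duality TYPE('n) (test_degree TYPE('n))"
    unfolding test_degree_def by (rule someI)
  then show False using moment_duality_test by blast
qed

text \<open>The weights define a point measure on \<open>F\<close>, where every subset is
  measurable. Its image under the identity is the required Borel measure.\<close>

lemma atomic_in_moment_cone:
  fixes K :: "(real ^ 'n::finite) set"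
  assumes "closed K" "finite F" "F \<subseteq> K" "\<And>x. x \<in> F \<Longrightarrow> 0 \<le> w x"
    and y: "y \<in> exponents_le d \<rightarrow>\<^sub>E UNIV"
    and yF: "\<And>\<alpha>. \<alpha> \<in> exponents_le d \<Longrightarrow> y \<alpha> = (\<Sum>x\<in>F. w x * monomial_at x \<alpha>)"
  shows "y \<in> moment_cone K d"
proof -
  define N where "N = point_measure F (\<lambda>x. ennreal (w x))"
  define \<mu> where "\<mu> = distr N borel (\<lambda>x. x)"
  have id: "(\<lambda>x. x) \<in> measurable N borel" by (auto simp: N_def measurable_def space_point_measure sets_point_measure)
  have em: "emeasure \<mu> U = 0" if "open U" "U \<inter> F = {}" for U
  proof -
    have "emeasure \<mu> U = emeasure N (U \<inter> F)"
      unfolding \<mu>_def using emeasure_distr[OF id, of U] that(1) by (simp add: N_def space_point_measure vimage_def Int_def)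
    then show ?thesis using that by simp
  qed
  have supp: "measure_support \<mu> \<subseteq> K"
  proof
    fix x assume x: "x \<in> measure_support \<mu>"
    show "x \<in> K"
    proof (rule ccontr)
      assume "x \<notin> K"
      then have "emeasure \<mu> (- K) > 0" using x assms(1) by (auto simp: measure_support_def)
      moreover have "emeasure \<mu> (- K) = 0" by (rule em) (use assms(1,3) in \<open>auto simp: open_Compl\<close>)
      ultimately show False by simp
    qed
  qed
  have m: "(\<lambda>x. indicator K x *\<^sub>R monomial_at x \<alpha>) \<in> borel_measurable borel" for \<alpha>
    by (intro borel_measurable_scaleR borel_measurable_continuous_onI continuous_monomial_at
        borel_measurable_indicator) (use assms(1) in auto)
  have int: "set_integrable \<mu> K (\<lambda>x. monomial_at x \<alpha>)" for \<alpha>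
    unfolding set_integrable_def \<mu>_def
    by (subst integrable_distr_eq[OF id m]) (simp add: N_def integrable_point_measure_finite assms(2))
  have "set_lebesgue_integral \<mu> K (\<lambda>x. monomial_at x \<alpha>) = (\<Sum>x\<in>F. w x * monomial_at x \<alpha>)" for \<alpha>
  proof -
    have "set_lebesgue_integral \<mu> K (\<lambda>x. monomial_at x \<alpha>) = (\<Sum>x\<in>F. w x *\<^sub>R (indicator K x *\<^sub>R monomial_at x \<alpha>))"
      unfolding set_lebesgue_integral_def \<mu>_def
      by (subst integral_distr[OF id m]) (simp add: N_def lebesgue_integral_point_measure_finite assms(2,4))
    also have "\<dots> = (\<Sum>x\<in>F. w x * monomial_at x \<alpha>)"
      using assms(3) by (intro sum.cong) (auto simp: indicator_def)
    finally show ?thesis .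
  qed
  then show ?thesis
    unfolding moment_cone_def using y yF int supp by (auto intro!: exI[of _ \<mu>] simp: \<mu>_def)
qed

subsection \<open>Polynomials of bounded degree\<close>

definition poly_of :: "nat \<Rightarrow> ('n::finite expo \<Rightarrow> real) \<Rightarrow> 'n rpoly"
  where "poly_of d c = (\<Sum>\<alpha>\<in>exponents_le d. Poly_Mapping.single \<alpha> (c \<alpha>))"

lemma lookup_poly_of: "Poly_Mapping.lookup (poly_of d c) \<alpha> = (if \<alpha> \<in> exponents_le d then c \<alpha> else 0)"
  by (simp add: poly_of_def lookup_sum lookup_single when_def sum.delta[OF finite_exponents_le])

lemma poly_of_polys_le: "poly_of d c \<in> polys_le d"
  by (auto simp: polys_le_def in_keys_iff lookup_poly_of split: if_splits)

lemma poly_at_polys_le: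
  "p \<in> polys_le d \<Longrightarrow> poly_at p a = (\<Sum>\<alpha>\<in>exponents_le d. Poly_Mapping.lookup p \<alpha> * monomial_at a \<alpha>)"
  unfolding poly_at_def by (rule sum.mono_neutral_left) (auto simp: polys_le_def in_keys_iff finite_exponents_le)

lemma riesz_polys_le:
  "p \<in> polys_le d \<Longrightarrow> riesz y p = (\<Sum>\<alpha>\<in>exponents_le d. Poly_Mapping.lookup p \<alpha> * y \<alpha>)"
  unfolding riesz_def by (rule sum.mono_neutral_left) (auto simp: polys_le_def in_keys_iff finite_exponents_le)

lemma continuous_poly_at: "continuous_on S (\<lambda>a. poly_at p a)"
  unfolding poly_at_def by (intro continuous_intros continuous_monomial_at)

lemma closed_basic_closed: "closed (basic_closed g)"
proof -
  have "basic_closed g = (\<Inter>p\<in>set g. {a. 0 \<le> poly_at p a})" by (auto simp: basic_closed_def)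
  then show ?thesis by (auto intro!: closed_INT closed_Collect_le continuous_poly_at)
qed

lemma monomials_bounded:
  fixes K :: "(real ^ 'n::finite) set"
  assumes "compact K"
  shows "\<exists>B>0. \<forall>x\<in>K. (\<Sum>\<alpha>\<in>exponents_le d. \<bar>monomial_at x \<alpha>\<bar>) \<le> B"
proof -
  define m where "m x = (\<Sum>\<alpha>\<in>exponents_le d. \<bar>monomial_at x \<alpha>\<bar>)" for x :: "real ^ 'n"
  have "continuous_on K m" unfolding m_def by (intro continuous_intros continuous_monomial_at)
  then have "bounded (m ` K)" using assms by (intro compact_imp_bounded compact_continuous_image)
  then obtain B where "B > 0" "\<forall>z\<in>m ` K. norm z \<le> B" unfolding bounded_pos by blast
  then have "\<forall>x\<in>K. m x \<le> B" by (auto simp: abs_le_iff)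
  then show ?thesis using \<open>B > 0\<close> unfolding m_def by blast
qed

text \<open>Serves two purposes: with monomial values for \<open>m\<close> it controls the values on
  \<open>K\<close>, with \<open>m = y\<close> the Riesz functional.\<close>

lemma weighted_sum_perturb:
  fixes c c' m :: "'a \<Rightarrow> real"
  assumes "\<And>\<alpha>. \<alpha> \<in> E \<Longrightarrow> \<bar>c' \<alpha> - c \<alpha>\<bar> \<le> e" "(\<Sum>\<alpha>\<in>E. \<bar>m \<alpha>\<bar>) \<le> B" "0 \<le> e"
  shows "\<bar>(\<Sum>\<alpha>\<in>E. c' \<alpha> * m \<alpha>) - (\<Sum>\<alpha>\<in>E. c \<alpha> * m \<alpha>)\<bar> \<le> e * B"
proof -
  have "\<bar>(\<Sum>\<alpha>\<in>E. c' \<alpha> * m \<alpha>) - (\<Sum>\<alpha>\<in>E. c \<alpha> * m \<alpha>)\<bar> = \<bar>\<Sum>\<alpha>\<in>E. (c' \<alpha> - c \<alpha>) * m \<alpha>\<bar>"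
    by (simp add: left_diff_distrib sum_subtractf)
  also have "\<dots> \<le> (\<Sum>\<alpha>\<in>E. \<bar>c' \<alpha> - c \<alpha>\<bar> * \<bar>m \<alpha>\<bar>)"
    by (rule order.trans[OF sum_abs]) (simp add: abs_mult)
  also have "\<dots> \<le> (\<Sum>\<alpha>\<in>E. e * \<bar>m \<alpha>\<bar>)" using assms(1) by (intro sum_mono mult_right_mono) auto
  also have "\<dots> \<le> e * B" using assms(2,3) by (simp add: sum_distrib_left[symmetric] mult_left_mono)
  finally show ?thesis .
qed

lemma interior_nonneg_polys:
  fixes K :: "(real ^ 'n::finite) set"
  assumes K: "compact K" and p: "p \<in> polys_le d" and pos: "\<And>a. a \<in> K \<Longrightarrow> 1 \<le> poly_at p a"
  shows "p \<in> polys_le_topology d interior_of nonneg_polys K d"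
proof -
  let ?E = "exponents_le d :: 'n expo set"
  obtain B where B: "B > 0" "\<And>x. x \<in> K \<Longrightarrow> (\<Sum>\<alpha>\<in>?E. \<bar>monomial_at x \<alpha>\<bar>) \<le> B"
    using monomials_bounded[OF K] by blast
  \<comment> \<open>A change of every coefficient by less than 1/B changes the values on
    \<open>K\<close> by at most 1, the margin that is assumed.\<close>
  define U where "U = (\<Inter>\<alpha>\<in>?E. {c :: 'n expo \<Rightarrow> real. \<bar>c \<alpha> - Poly_Mapping.lookup p \<alpha>\<bar> < 1 / B})"
  have "open U"
    unfolding U_def
    by (intro open_INT finite_exponents_le ballI open_Collect_less continuous_intros continuous_on_product_coordinates)
  then have op: "openin (polys_le_topology d) (Poly_Mapping.lookup -` U \<inter> polys_le d)"
    unfolding polys_le_topology_def openin_pullback_topology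
    by (intro exI[of _ U]) (simp only: open_openin simp_thms)
  have "0 \<le> poly_at f a" if f: "f \<in> polys_le d" "Poly_Mapping.lookup f \<in> U" and a: "a \<in> K" for f a
  proof -
    have "\<bar>(\<Sum>\<alpha>\<in>?E. Poly_Mapping.lookup f \<alpha> * monomial_at a \<alpha>) - (\<Sum>\<alpha>\<in>?E. Poly_Mapping.lookup p \<alpha> * monomial_at a \<alpha>)\<bar>
        \<le> 1 / B * B"
      by (rule weighted_sum_perturb[OF _ B(2)[OF a]]) (use f(2) B(1) in \<open>auto simp: U_def intro: less_imp_le\<close>)
    then have "\<bar>poly_at f a - poly_at p a\<bar> \<le> 1" 
      using B(1) by (simp add: poly_at_polys_le[OF f(1)] poly_at_polys_le[OF p])
    then show ?thesis using pos[OF a] by linarith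
  qed
  then have "Poly_Mapping.lookup -` U \<inter> polys_le d \<subseteq> nonneg_polys K d"
    by (auto simp: nonneg_polys_def)
  moreover have "p \<in> Poly_Mapping.lookup -` U \<inter> polys_le d" using p B(1) by (simp add: U_def)
  ultimately show ?thesis using op unfolding interior_of_def by blast
qed

lemma rational_approx:
  assumes "0 < (e :: real)"
  shows "\<exists>r. (\<forall>\<alpha>. r \<alpha> \<in> \<rat>) \<and> (\<forall>\<alpha>. \<bar>r \<alpha> - c \<alpha>\<bar> \<le> e)"
proof -
  have "\<forall>\<alpha>. \<exists>q\<in>\<rat>. \<bar>q - c \<alpha>\<bar> \<le> e"
  proof
    fix \<alpha>
    obtain q where "q \<in> \<rat>" "c \<alpha> - e < q" "q < c \<alpha>" using Rats_dense_in_real[of "c \<alpha> - e" "c \<alpha>"] assms by auto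
    then show "\<exists>q\<in>\<rat>. \<bar>q - c \<alpha>\<bar> \<le> e" by (intro bexI[of _ q]) auto
  qed
  then show ?thesis by metis
qed

theorem mainTheorem3:
  fixes d :: nat
    and y :: "'n::finite expo \<Rightarrow> real"
    and g :: "'n rpoly list"
    and K :: "(real ^ 'n) set"
  assumes "y \<in> exponents_le d \<rightarrow>\<^sub>E \<rat>"
    and "y 0 > 0"
    and "archimedean (quadratic_module g)"
    and "K = basic_closed g"
    and "K \<noteq> {}"
    and "y \<notin> moment_cone K d"
  shows "\<forall>M::real\<ge>1. \<exists>p.
    p \<in> polys_le_topology d interior_of nonneg_polys K d \<and>
    rational_coeffs p \<and>
    p \<in> (\<lambda>q. 1 + q) ` quadratic_module g \<and>
    riesz y p = 0 \<and>
    (INF a\<in>K. poly_at p a) > M"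
proof (intro allI impI)
  fix M :: real assume M: "1 \<le> M"
  let ?E = "exponents_le d :: 'n expo set"
  have finE: "finite ?E" and z0: "0 \<in> ?E" by (rule finite_exponents_le zero_exponents_le)+
  have closedK: "closed K" using closed_basic_closed assms(4) by blast
  have compK: "compact K"
  proof -
    obtain u where u: "u \<in> quadratic_module g" "compact (basic_closed [u])"
      using assms(3) by (auto simp: archimedean_def)
    have "K \<subseteq> basic_closed [u]" using quadratic_module_nonneg[OF u(1)] assms(4) by (auto simp: basic_closed_def[of "[u]"])
    then show ?thesis using compact_Int_closed[OF u(2) closedK] by (simp add: Int_absorb1)
  qed
  have yU: "y \<in> ?E \<rightarrow>\<^sub>E UNIV" using assms(1) by (auto simp: PiE_def)
  have yQ: "y \<alpha> \<in> \<rat>" if "\<alpha> \<in> ?E" for \<alpha> using assms(1) that by blast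
  note duality = moment_duality[where 'n = 'n and d = d, unfolded moment_duality_def, rule_format, OF compK assms(5), of y]
  obtain p0 where p0: "\<And>x. x \<in> K \<Longrightarrow> 0 \<le> (\<Sum>\<alpha>\<in>?E. p0 \<alpha> * monomial_at x \<alpha>)" "(\<Sum>\<alpha>\<in>?E. p0 \<alpha> * y \<alpha>) < 0"
    using duality
  proof (elim disjE exE conjE)
    fix F w
    assume F: "finite F" "F \<subseteq> K" "\<forall>x\<in>F. 0 \<le> w x" "\<forall>\<alpha>\<in>?E. y \<alpha> = (\<Sum>x\<in>F. w x * monomial_at x \<alpha>)"
    have "y \<in> moment_cone K d"
      by (rule atomic_in_moment_cone[OF closedK F(1,2) _ yU]) (use F(3,4) in auto)
    then show ?thesis using assms(6) by blast
  next
    fix p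
    assume "\<forall>x\<in>K. 0 \<le> (\<Sum>\<alpha>\<in>?E. p \<alpha> * monomial_at x \<alpha>)" "(\<Sum>\<alpha>\<in>?E. p \<alpha> * y \<alpha>) < 0"
    then show ?thesis using that by blast
  qed
  obtain B where B: "B > 0" "\<And>x. x \<in> K \<Longrightarrow> (\<Sum>\<alpha>\<in>?E. \<bar>monomial_at x \<alpha>\<bar>) \<le> B"
    using monomials_bounded[OF compK] by blast
  define L where "L = (\<Sum>\<alpha>\<in>?E. p0 \<alpha> * y \<alpha>)"
  define D where "D = (\<Sum>\<alpha>\<in>?E. \<bar>y \<alpha>\<bar>) + 1"
  have D: "D > 0" unfolding D_def by (simp add: add_nonneg_pos sum_nonneg)
  \<comment> \<open>Half of the negative Riesz value is spent on positivity: adding \<open>e\<close>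
    raises the functional from \<open>L\<close> to \<open>L / 2\<close>.\<close>
  define e where "e = - L / (2 * y 0)"
  have e: "e > 0" using p0(2) assms(2) by (simp add: e_def L_def divide_neg_pos)
  define p1 where "p1 \<alpha> = p0 \<alpha> + (if \<alpha> = 0 then e else 0)" for \<alpha>
  have p1_sum: "(\<Sum>\<alpha>\<in>?E. p1 \<alpha> * m \<alpha>) = (\<Sum>\<alpha>\<in>?E. p0 \<alpha> * m \<alpha>) + e * m 0" for m :: "'n expo \<Rightarrow> real"
    using z0
    by (simp add: p1_def distrib_right sum.distrib if_distrib[of "\<lambda>x. x * _"] sum.delta[OF finE] cong: if_cong)
  have p1_y: "(\<Sum>\<alpha>\<in>?E. p1 \<alpha> * y \<alpha>) = L / 2" using assms(2) by (simp add: p1_sum e_def L_def[symmetric])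
  \<comment> \<open>The first bound keeps the rounded polynomial at least e/2 on \<open>K\<close>,
    the second keeps its Riesz value at most L/4.\<close>
  define \<delta> where "\<delta> = min (e / (2 * B)) (- L / (4 * D))"
  have L0: "L < 0" using p0(2) by (simp add: L_def)
  have \<delta>: "\<delta> > 0" using e B(1) D L0 by (simp add: \<delta>_def divide_neg_pos)
  obtain r where r: "\<And>\<alpha>. r \<alpha> \<in> \<rat>" "\<And>\<alpha>. \<bar>r \<alpha> - p1 \<alpha>\<bar> \<le> \<delta>" using rational_approx[OF \<delta>] by blast
  have r_pos: "e / 2 \<le> (\<Sum>\<alpha>\<in>?E. r \<alpha> * monomial_at x \<alpha>)" if x: "x \<in> K" for x
  proof -
    have "\<bar>(\<Sum>\<alpha>\<in>?E. r \<alpha> * monomial_at x \<alpha>) - (\<Sum>\<alpha>\<in>?E. p1 \<alpha> * monomial_at x \<alpha>)\<bar> \<le> \<delta> * B"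
      using r(2) B(2)[OF x] \<delta> by (intro weighted_sum_perturb) auto
    moreover have "\<delta> * B \<le> e / (2 * B) * B" using B(1) by (intro mult_right_mono) (auto simp: \<delta>_def)
    moreover have "e / (2 * B) * B = e / 2" using B(1) by simp
    moreover have "e \<le> (\<Sum>\<alpha>\<in>?E. p1 \<alpha> * monomial_at x \<alpha>)" using p0(1)[OF x] by (simp add: p1_sum monomial_at_0)
    ultimately show ?thesis by linarith
  qed
  define Lr where "Lr = (\<Sum>\<alpha>\<in>?E. r \<alpha> * y \<alpha>)"
  have Lr: "Lr < 0"
  proof -
    have "\<bar>Lr - (\<Sum>\<alpha>\<in>?E. p1 \<alpha> * y \<alpha>)\<bar> \<le> \<delta> * D"
      unfolding Lr_def using r(2) \<delta> by (intro weighted_sum_perturb) (auto simp: D_def)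
    moreover have "\<delta> * D \<le> - L / (4 * D) * D" using D by (intro mult_right_mono) (auto simp: \<delta>_def)
    moreover have "- L / (4 * D) * D = - L / 4" using D by simp
    ultimately show ?thesis using L0 unfolding p1_y by linarith
  qed
  have LrQ: "Lr \<in> \<rat>" unfolding Lr_def using r(1) yQ by (intro Rats_sum Rats_mult) auto
  \<comment> \<open>A natural factor keeps the coefficients rational. The target M + 1 in place of M
    makes the infimum exceed M strictly.\<close>
  obtain s :: nat where s: "(M + 1) / (e / 2) \<le> real s" using real_arch_simple by blast
  \<comment> \<open>The solution of \<open>real s * Lr + t * y 0 = 0\<close>. It is rational because
    the entries of \<open>y\<close> and the coefficients \<open>r\<close> are.\<close>
  define t where "t = - real s * Lr / y 0"
  have t0: "0 \<le> t" using Lr assms(2) by (simp add: t_def mult_nonneg_nonpos divide_nonpos_pos)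
  have tQ: "t \<in> \<rat>" unfolding t_def using LrQ yQ[OF zero_exponents_le] by (intro Rats_divide Rats_mult) auto
  define c where "c \<alpha> = real s * r \<alpha> + (if \<alpha> = 0 then t else 0)" for \<alpha>
  have c_sum: "(\<Sum>\<alpha>\<in>?E. c \<alpha> * m \<alpha>) = real s * (\<Sum>\<alpha>\<in>?E. r \<alpha> * m \<alpha>) + t * m 0" for m :: "'n expo \<Rightarrow> real"
    using z0
    by (simp add: c_def distrib_right sum.distrib sum_distrib_left mult.assoc if_distrib[of "\<lambda>x. x * _"]
      sum.delta[OF finE] cong: if_cong)
  define p where "p = poly_of d c"
  have p: "p \<in> polys_le d" unfolding p_def by (rule poly_of_polys_le)
  have lookup_sum: "(\<Sum>\<alpha>\<in>?E. Poly_Mapping.lookup p \<alpha> * m \<alpha>) = (\<Sum>\<alpha>\<in>?E. c \<alpha> * m \<alpha>)" for m :: "'n expo \<Rightarrow> real"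
    by (intro sum.cong) (auto simp: p_def lookup_poly_of)
  have p_ge: "M + 1 \<le> poly_at p a" if a: "a \<in> K" for a
  proof -
    have "M + 1 \<le> real s * (e / 2)" using s e by (simp add: field_simps)
    also have "\<dots> \<le> real s * (\<Sum>\<alpha>\<in>?E. r \<alpha> * monomial_at a \<alpha>)" using r_pos[OF a] by (intro mult_left_mono) auto
    also have "\<dots> \<le> poly_at p a"
      using t0 by (simp add: poly_at_polys_le[OF p] lookup_sum c_sum monomial_at_0)
    finally show ?thesis .
  qed
  have "p \<in> polys_le_topology d interior_of nonneg_polys K d"
    by (rule interior_nonneg_polys[OF compK p]) (use p_ge M in force)
  moreover have "rational_coeffs p"
    unfolding rational_coeffs_def p_def lookup_poly_of c_def using r(1) tQ by (auto intro!: Rats_add Rats_mult)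
  moreover have "p \<in> (\<lambda>q. 1 + q) ` quadratic_module g"
  proof (rule image_eqI)
    show "p = 1 + (p - 1)" by simp
    show "p - 1 \<in> quadratic_module g"
    proof (rule archimedean_positivstellensatz[OF assms(3)])
      fix a assume "a \<in> basic_closed g"
      then show "0 < poly_at (p - 1) a"
        using p_ge[of a] M assms(4) by (simp add: rhom_diff[OF rhom_poly_at] rhom_1[OF rhom_poly_at])
    qed
  qed
  moreover have "riesz y p = 0"
    using assms(2) by (simp add: riesz_polys_le[OF p] lookup_sum c_sum Lr_def[symmetric] t_def)
  moreover have "M < (INF a\<in>K. poly_at p a)"
  proof -
    have "M + 1 \<le> (INF a\<in>K. poly_at p a)" using assms(5) p_ge by (intro cINF_greatest) auto
    then show ?thesis by simp
  qed
  ultimately show "\<exists>p. p \<in> polys_le_topology d interior_of nonneg_polys K d \<and> rational_coeffs p \<and>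
      p \<in> (\<lambda>q. 1 + q) ` quadratic_module g \<and> riesz y p = 0 \<and> (INF a\<in>K. poly_at p a) > M" by blast
qed

end
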